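(* Let $L=10^6$. Let $\mathbb{V}=\{(i,j)\in\mathbb{Z}^2: i+j\text{ even}\}$ and let $\mathbb{E}$ be the set of oriented edges $((i,j),(i+1,j'))$ with $(i,j),(i+1,j')\in\mathbb{V}$ and $|j'-j|=1$. Let $\xi=(\xi_i)_{i\in\mathbb{Z}}$ be i.i.d. random variables with $\mathbb{P}(\xi_i\ge n)=\rho^n$ for $n\in\{0,1,2,\dots\}$, where $\rho\in[0,1]$. Given $\xi$ and $p\in[0,1]$, let $P^\xi_p$ be the law of the percolation on $(\mathbb{V},\mathbb{E})$ in which each edge $((i,j),(i+1,j\pm1))$ is open with probability $p^{\xi_i+1}$, independently of the others. If $\rho\le L^{-16}$ and $p\ge(1-L^{-10})^{1/4}$, then for almost every realization of $\xi$, $$P^\xi_p\big[(0,0)\text{ is connected to infinity}\big]>0.$$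
   Context: "$(0,0)$ is connected to infinity" means that there exist infinitely many vertices reachable from $(0,0)$ by oriented paths of open edges of $\mathbb{E}$ (equivalently, there is an infinite open oriented path starting at $(0,0)$). *)

theory Defs
  imports "HOL-Probability.Probability"
begin

definition Vset :: "(int \<times> int) set" where
  "Vset = {(i, j). even (i + j)}"

definition Eset :: "((int \<times> int) \<times> (int \<times> int)) set" where
  "Eset = {((i, j), (i', j')). (i, j) \<in> Vset \<and> (i', j') \<in> Vset \<and> i' = i + 1 \<and> \<bar>j' - j\<bar> = 1}"

definition perc_measure :: "(int \<Rightarrow> nat) \<Rightarrow> real \<Rightarrow> (((int \<times> int) \<times> (int \<times> int)) \<Rightarrow> bool) measure" where
  "perc_measure xi p =
     PiM Eset (\<lambda>e. measure_pmf (bernoulli_pmf (p ^ (xi (fst (fst e)) + 1))))"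

definition open_step :: "(((int \<times> int) \<times> (int \<times> int)) \<Rightarrow> bool) \<Rightarrow> int \<times> int \<Rightarrow> int \<times> int \<Rightarrow> bool" where
  "open_step \<omega> u v \<longleftrightarrow> (u, v) \<in> Eset \<and> \<omega> (u, v)"

definition connected_to_infinity :: "(((int \<times> int) \<times> (int \<times> int)) \<Rightarrow> bool) \<Rightarrow> bool" where
  "connected_to_infinity \<omega> \<longleftrightarrow> infinite {v. (open_step \<omega>)\<^sup>*\<^sup>* (0, 0) v}"

end

theory Submission
  imports Defs
begin

text \<open>
  Both the environment and the percolation are renormalised, and one step of the two fits together.
  Replace each edge by its starting vertex and divide the badness of the columns by 1000, so that bad
  columns are extremely rare compared with \<open>1 - p\<close>.

  The sequence of badnesses is cut in the middle of runs of 100 good columns. A block without bad column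
  becomes good, a block with a single column of badness \<open>m\<close> gets badness \<open>m - 1\<close>, and a block with
  several bad columns is penalised heavily; the blocks are again independent and identically
  distributed, and \<open>E[2048^\<xi>; \<xi> \<ge> 1]\<close> shrinks by a factor 8 in each step. With positive probability the
  first 50 columns are good on every scale, and by the 0-1 law this holds almost surely after deleting
  finitely many columns.

  Sites are grouped into boxes that lie over the blocks in a brick pattern and hence depend on disjoint
  sets of sites. Every block starts and ends with 50 good columns. There a single closed site cannot
  stop a path, so every path that enters the box can be led to any of 16 corridors across the bad column,
  and from there to both exits. Hence if the odds against a site in a column of badness \<open>m\<close> are at most
  \<open>B 2^m\<close>, the odds against a good box over a block of badness \<open>m\<close> are at most \<open>(B / 2) 2^m\<close>: in good
  columns failure is of second order, and over a single bad column the 16 attempts gain more than the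
  required factor 4. Since the failure probabilities of the origin on the successive scales sum to at
  most \<open>2 B\<close>, it is connected to arbitrary distance with probability at least \<open>1 - 2 B\<close>.
\<close>


section \<open>Open paths and good boxes\<close>

text \<open>Odds are propagated instead of probabilities because \<open>B * 2 ^ m\<close> exceeds 1
  for large badness \<open>m\<close>, while \<open>1 / (1 + B * 2 ^ m)\<close> is still a meaningful
  bound. The required factor 4 is two halvings: of \<open>B\<close>, which makes the failures of the
  origin summable over the scales, and of \<open>2 ^ m\<close>, because a lone bad column loses one
  unit. This loss is what improves the environment: it gains a factor 2048 in the moment, against
  only 100 possible positions of the lone column. With two or more bad columns no clever route is
  sought; a large set of sites is simply required to be open. The penalty is huge, but such blocks
  are of second order in the moment. It forces the moment to be tiny even after multiplication by
  \<open>2048 ^ (2 * 12300)\<close>, which \<open>\<rho> \<le> 1 / 10 ^ 96\<close> alone does not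
  give. Division by 1000 replaces \<open>\<rho>\<close> by \<open>\<rho> ^ 1000\<close> at the price
  of a factor \<open>p ^ 2000\<close> per unit of badness, and
  \<open>1 - p \<le> 1 / 10 ^ 60\<close> leaves ample room for that. Dependence between scales is
  harmless, as failures on different scales are only added up.\<close>

inductive open_path :: "(nat \<times> int \<Rightarrow> bool) \<Rightarrow> nat \<Rightarrow> int \<Rightarrow> nat \<Rightarrow> int \<Rightarrow> bool" for P where
  base: "P (i, u) \<Longrightarrow> open_path P i u i u"
| step: "open_path P i u k v \<Longrightarrow> P (Suc k, v') \<Longrightarrow> \<bar>v' - v\<bar> = 1 \<Longrightarrow> open_path P i u (Suc k) v'"

lemma open_path_le: "open_path P i u k v \<Longrightarrow> i \<le> k"
  by (induction rule: open_path.induct) auto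

lemma open_path_parity: "open_path P i u k v \<Longrightarrow> even (int k + v) \<longleftrightarrow> even (int i + u)"
proof (induction rule: open_path.induct)
  case (step i u k v v')
  then have "v' = v + 1 \<or> v' = v - 1" by linarith
  then show ?case using step.IH by auto
qed simp

lemma open_path_end: "open_path P i u k v \<Longrightarrow> P (k, v)"
  by (induction rule: open_path.induct) auto

lemma open_path_trans: "open_path P k v l w \<Longrightarrow> open_path P i u k v \<Longrightarrow> open_path P i u l w"
  by (induction rule: open_path.induct) (auto intro: open_path.step)

lemma open_path_mono_on:
  assumes "open_path P i u k v" and "\<And>m j. i \<le> m \<Longrightarrow> m \<le> k \<Longrightarrow> P (m, j) \<Longrightarrow> Q (m, j)"
  shows "open_path Q i u k v"
  using assms
proof (induction rule: open_path.induct)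
  case (step i u k v v')
  have "i \<le> k" using step.hyps(1) by (rule open_path_le)
  then show ?case using step by (auto intro!: open_path.step)
qed (auto intro: open_path.base)

lemma open_path_of_fun:
  assumes "i \<le> k"
    and "\<And>m. i \<le> m \<Longrightarrow> m \<le> k \<Longrightarrow> P (m, f m)"
    and "\<And>m. i \<le> m \<Longrightarrow> m < k \<Longrightarrow> \<bar>f (Suc m) - f m\<bar> = (1::int)"
  shows "open_path P i (f i) k (f k)"
  using assms
proof (induction k rule: dec_induct)
  case base
  then show ?case by (auto intro: open_path.base)
next
  case (step n)
  then show ?case by (auto intro!: open_path.step)
qed

text \<open>Walks with steps of size 1 and even difference cannot cross without meeting, so their
  pointwise minimum and maximum again move by 1. This glues straight lines and zigzags into a single
  walk.\<close>

lemma min_step: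
  fixes a b a' b' :: int
  assumes "\<bar>a' - a\<bar> = 1" "\<bar>b' - b\<bar> = 1" "even (a - b)"
  shows "\<bar>min a' b' - min a b\<bar> = 1" "\<bar>max a' b' - max a b\<bar> = 1"
  using assms by presburger+

text \<open>Away from their common endpoints the two paths below are strictly separated by height, so a
  single closed site cannot block both.\<close>

lemma open_path_avoiding:
  fixes T B :: int
  assumes lt: "i0 < i1" and dist: "\<bar>v - u\<bar> + 2 \<le> int i1 - int i0"
    and par: "even (int i0 + u)" "even (int i1 + v)"
    and T: "u < T" "v < T" and B: "B < u" "B < v" and BT: "B + 2 < T"
    and P0: "P (i0, u)" and P1: "P (i1, v)"
    and one: "\<And>m j m' j'. i0 < m \<Longrightarrow> m < i1 \<Longrightarrow> i0 < m' \<Longrightarrow> m' < i1 \<Longrightarrow> B \<le> j \<Longrightarrow> j \<le> T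
       \<Longrightarrow> B \<le> j' \<Longrightarrow> j' \<le> T \<Longrightarrow> \<not> P (m, j) \<Longrightarrow> \<not> P (m', j') \<Longrightarrow> m = m' \<and> j = j'"
  shows "open_path P i0 u i1 v"
proof -
  \<comment> \<open>\<open>T - d T m\<close> zigzags just below the ceiling and
    \<open>B + d B m\<close> just above the floor; \<open>d\<close> adjusts the parity so that
    \<open>min_step\<close> applies. Thus \<open>fh\<close> is the highest walk from
    \<open>u\<close> to \<open>v\<close> under the ceiling, and \<open>fl\<close> the lowest one
    over the floor.\<close>
  define d :: "int \<Rightarrow> nat \<Rightarrow> int" where "d z m = (if even (int m + z) then 0 else 1)" for z m
  define fh where "fh m = min (min (u + (int m - int i0)) (v + (int i1 - int m))) (T - d T m)" for m
  define fl where "fl m = max (max (u - (int m - int i0)) (v - (int i1 - int m))) (B + d B m)" for m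
  have dstep: "\<bar>(z - d z (Suc m)) - (z - d z m)\<bar> = 1" "\<bar>(z + d z (Suc m)) - (z + d z m)\<bar> = 1" for z m
    by (auto simp: d_def)
  have dpar: "even (int m + (z - d z m))" "even (int m + (z + d z m))" for z m
    by (auto simp: d_def)
  have d01: "0 \<le> d z m" "d z m \<le> 1" for z m by (auto simp: d_def)
  have e1: "even (u + (int m - int i0) - (v + (int i1 - int m)))"
    "even (u - (int m - int i0) - (v - (int i1 - int m)))" for m
    using par by presburger+
  have eX: "even (u + (int m - int i0) - X)" "even (v + (int i1 - int m) - X)"
    "even (u - (int m - int i0) - X)" "even (v - (int i1 - int m) - X)"
    if "even (int m + X)" for m X
    using par that by presburger+
  have e2: "even (min (u + (int m - int i0)) (v + (int i1 - int m)) - (T - d T m))" for m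
    using eX(1,2)[OF dpar(1)[of m T]] unfolding min_def by (auto simp del: even_diff)
  have e3: "even (max (u - (int m - int i0)) (v - (int i1 - int m)) - (B + d B m))" for m
    using eX(3,4)[OF dpar(2)[of m B]] unfolding max_def by (auto simp del: even_diff)
  have sh: "\<bar>fh (Suc m) - fh m\<bar> = 1" for m
    unfolding fh_def
    by (rule min_step(1)[OF min_step(1)[OF _ _ e1(1)] dstep(1) e2]) auto
  have sl: "\<bar>fl (Suc m) - fl m\<bar> = 1" for m
    unfolding fl_def
    by (rule min_step(2)[OF min_step(2)[OF _ _ e1(2)] dstep(2) e3]) auto
  have ends: "fh i0 = u" "fl i0 = u" "fh i1 = v" "fl i1 = v"
    using dist T B d01[of T i0] d01[of T i1] d01[of B i0] d01[of B i1] par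
    by (auto simp: fh_def fl_def)
  \<comment> \<open>At an inner column both horizontal distances are at least 1. With the slack 2 in
    \<open>dist\<close> and with \<open>BT\<close>, each of the three bounds defining
    \<open>fh\<close> exceeds each of the three defining \<open>fl\<close>.\<close>
  have sep: "fl m < fh m" if "i0 < m" "m < i1" for m
  proof -
    have "int i0 < int m" "int m < int i1" using that by auto
    then show ?thesis unfolding fh_def fl_def
      using dist T B BT d01[of T m] d01[of B m] by linarith
  qed
  have rng: "B \<le> fl m \<and> fl m \<le> T \<and> B \<le> fh m \<and> fh m \<le> T" if "i0 < m" "m < i1" for m
    using sep[OF that] d01[of T m] d01[of B m] unfolding fh_def fl_def by auto
  have "(\<forall>m. i0 < m \<and> m < i1 \<longrightarrow> P (m, fh m)) \<or> (\<forall>m. i0 < m \<and> m < i1 \<longrightarrow> P (m, fl m))"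
  proof (rule ccontr)
    assume "\<not> ?thesis"
    then obtain m m' where "i0 < m" "m < i1" "\<not> P (m, fh m)" "i0 < m'" "m' < i1" "\<not> P (m', fl m')"
      by blast
    then show False using one[of m m' "fh m" "fl m'"] rng[of m] rng[of m'] sep[of m] by auto
  qed
  then show ?thesis
  proof
    assume *: "\<forall>m. i0 < m \<and> m < i1 \<longrightarrow> P (m, fh m)"
    have "P (m, fh m)" if "i0 \<le> m" "m \<le> i1" for m
      using * that ends P0 P1 by (cases "m = i0"; cases "m = i1") auto
    from open_path_of_fun[of i0 i1 P fh, OF _ this sh] show ?thesis using lt ends by simp
  next
    assume *: "\<forall>m. i0 < m \<and> m < i1 \<longrightarrow> P (m, fl m)"
    have "P (m, fl m)" if "i0 \<le> m" "m \<le> i1" for m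
      using * that ends P0 P1 by (cases "m = i0"; cases "m = i1") auto
    from open_path_of_fun[of i0 i1 P fl, OF _ this sl] show ?thesis using lt ends by simp
  qed
qed

definition in_box :: "nat \<Rightarrow> nat \<Rightarrow> int \<Rightarrow> nat \<times> int \<Rightarrow> bool" where
  "in_box s t C = (\<lambda>(i, j). s \<le> i \<and> i < t \<and> C - 40 \<le> j \<and> j < C + 40)"

text \<open>Exits of a box lie next to entrances of its two successors, since the centre lines \<open>C\<close> of
  neighbouring boxes differ by 40. By the second clause a open_path that has reached an exit can enter the
  next box.\<close>

definition good_box :: "(nat \<times> int \<Rightarrow> bool) \<Rightarrow> nat \<Rightarrow> nat \<Rightarrow> int \<Rightarrow> bool" where
  "good_box \<eta> s t C \<longleftrightarrow>
     (\<forall>u \<sigma>. \<bar>u - C\<bar> \<le> 23 \<and> even (int s + u) \<and> \<eta> (s, u) \<and> \<bar>\<sigma>\<bar> = 1 \<longrightarrow>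
        (\<exists>w. C + 20 * \<sigma> - 1 \<le> w \<and> w \<le> C + 20 * \<sigma> + 2 \<and>
          open_path (\<lambda>x. \<eta> x \<and> in_box s t C x) s u (t - 1) w)) \<and>
     (\<forall>u. \<bar>u - C\<bar> \<le> 23 \<and> \<bar>u + 2 - C\<bar> \<le> 23 \<and> even (int s + u) \<longrightarrow> \<eta> (s, u) \<or> \<eta> (s, u + 2))"

text \<open>The paths in \<open>good_box\<close> are confined to the box for this reason: the event
  is decided by finitely many sites, and boxes with disjoint sites are independent.\<close>

lemma good_cong:
  assumes "\<And>x. in_box s t C x \<Longrightarrow> \<eta> x = \<eta>' x" and "s < t"
  shows "good_box \<eta> s t C = good_box \<eta>' s t C"
proof -
  have 1: "(\<lambda>x. \<eta> x \<and> in_box s t C x) = (\<lambda>x. \<eta>' x \<and> in_box s t C x)"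
    using assms by auto
  have 2: "\<eta> (s, u) = \<eta>' (s, u)" if "\<bar>u - C\<bar> \<le> 23" for u
    by (rule assms(1)) (use assms(2) that in \<open>auto simp: in_box_def\<close>)
  have 3: "\<eta> (s, u + 2) = \<eta>' (s, u + 2)" if "\<bar>u + 2 - C\<bar> \<le> 23" for u
    using 2[of "u + 2"] that by simp
  have 4: "(\<bar>u - C\<bar> \<le> 23 \<and> even (int s + u) \<and> \<eta> (s, u) \<and> Q) \<longleftrightarrow>
      (\<bar>u - C\<bar> \<le> 23 \<and> even (int s + u) \<and> \<eta>' (s, u) \<and> Q)" for u Q
    using 2 by blast
  have 5: "(\<bar>u - C\<bar> \<le> 23 \<and> \<bar>u + 2 - C\<bar> \<le> 23 \<and> even (int s + u) \<longrightarrow> \<eta> (s, u) \<or> \<eta> (s, u + 2)) \<longleftrightarrow>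
      (\<bar>u - C\<bar> \<le> 23 \<and> \<bar>u + 2 - C\<bar> \<le> 23 \<and> even (int s + u) \<longrightarrow> \<eta>' (s, u) \<or> \<eta>' (s, u + 2))" for u
    using 2 3 by blast
  show ?thesis unfolding good_box_def 1 4 5 ..
qed

text \<open>A zigzag between two adjacent heights that visits lattice sites only. For
  \<open>r < 16\<close> the corridors are disjoint and fill the heights from \<open>C - 16\<close>
  to \<open>C + 15\<close>.\<close>

definition corridor :: "int \<Rightarrow> nat \<Rightarrow> nat \<Rightarrow> nat \<times> int" where
  "corridor C r i = (i, C - 16 + 2 * int r + (if even (int i + C) then 0 else 1))"

text \<open>A crossing is glued from three pieces: entrance to corridor, corridor, corridor to exit.
  By \<open>one\<close> at most one site off \<open>a..b\<close> is closed, so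
  \<open>open_path_avoiding\<close> supplies the two outer pieces.\<close>

lemma goodI:
  assumes a: "s + 50 \<le> a" and ab: "a \<le> b" and b: "b + 50 \<le> t"
    and one: "\<And>x y. in_box s t C x \<Longrightarrow> in_box s t C y \<Longrightarrow> fst x \<notin> {a..b} \<Longrightarrow> fst y \<notin> {a..b}
       \<Longrightarrow> \<not> \<eta> x \<Longrightarrow> \<not> \<eta> y \<Longrightarrow> x = y"
    and r: "r < 16" and cor: "\<And>i. i \<in> {a..b} \<Longrightarrow> \<eta> (corridor C r i)"
  shows "good_box \<eta> s t C"
proof -
  define P where "P = (\<lambda>x. \<eta> x \<and> in_box s t C x)"
  define g where "g i = C - 16 + 2 * int r + (if even (int i + C) then 0 else 1)" for i :: nat
  have g: "corridor C r i = (i, g i)" for i by (simp add: corridor_def g_def)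
  have gr: "C - 16 \<le> g i" "g i \<le> C + 15" "even (int i + g i)" for i using r by (auto simp: g_def)
  have Pg: "P (i, g i)" if "i \<in> {a..b}" for i
    using cor[OF that] gr[of i] that a b unfolding g P_def in_box_def by auto
  have pair: "\<eta> (s, u) \<or> \<eta> (s, u + 2)" if "\<bar>u - C\<bar> \<le> 23" "\<bar>u + 2 - C\<bar> \<le> 23" for u
  proof (rule ccontr)
    assume "\<not> ?thesis"
    moreover have "in_box s t C (s, u)" "in_box s t C (s, u + 2)" "s \<notin> {a..b}"
      using that a ab b by (auto simp: in_box_def)
    ultimately have "(s, u) = (s, u + 2)" by (intro one) auto
    then show False by simp
  qed
  have oneP: "m = m' \<and> j = j'" if "s \<le> m" "m < t" "s \<le> m'" "m' < t" "m \<notin> {a..b}" "m' \<notin> {a..b}"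
    "C - 24 \<le> j" "j \<le> C + 24" "C - 24 \<le> j'" "j' \<le> C + 24" "\<not> P (m, j)" "\<not> P (m', j')" for m m' j j'
  proof -
    have "in_box s t C (m, j)" "in_box s t C (m', j')" using that by (auto simp: in_box_def)
    then have "(m, j) = (m', j')" using that by (intro one) (auto simp: P_def)
    then show ?thesis by simp
  qed
  have first: "open_path P s u a (g a)" if u: "\<bar>u - C\<bar> \<le> 23" "even (int s + u)" "\<eta> (s, u)" for u
  proof (rule open_path_avoiding[where T = "C + 24" and B = "C - 24"])
    show "P (s, u)" using u a ab b by (auto simp: P_def in_box_def)
    show "P (a, g a)" using Pg ab by auto
    \<comment> \<open>The heights differ by at most 23 + 16, and 39 + 2 fits into the 50 columns
      before \<open>a\<close>.\<close>
    show "\<bar>g a - u\<bar> + 2 \<le> int a - int s" using u gr[of a] a by auto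
    show "\<And>m j m' j'. s < m \<Longrightarrow> m < a \<Longrightarrow> s < m' \<Longrightarrow> m' < a \<Longrightarrow> C - 24 \<le> j \<Longrightarrow> j \<le> C + 24
       \<Longrightarrow> C - 24 \<le> j' \<Longrightarrow> j' \<le> C + 24 \<Longrightarrow> \<not> P (m, j) \<Longrightarrow> \<not> P (m', j') \<Longrightarrow> m = m' \<and> j = j'"
      by (rule oneP) (use ab b in auto)
  qed (use u gr[of a] a in auto)
  have mid: "open_path P a (g a) b (g b)"
    by (rule open_path_of_fun[OF ab]) (auto simp: Pg, auto simp: g_def)
  have last: "\<exists>w. C + 20 * \<sigma> - 1 \<le> w \<and> w \<le> C + 20 * \<sigma> + 2 \<and> open_path P b (g b) (t - 1) w"
    if s: "\<bar>\<sigma>\<bar> = 1" for \<sigma>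
  proof -
    \<comment> \<open>\<open>w0\<close> and \<open>w0 + 2\<close> are the two lattice sites in the
      exit window from -1 to +2; at most one of them is closed.\<close>
    define w0 where "w0 = C + 20 * \<sigma> - (if even (int (t - 1) + C) then 0 else 1)"
    have pw: "even (int (t - 1) + w0)" by (auto simp: w0_def)
    have rw: "C + 20 * \<sigma> - 1 \<le> w0" "w0 \<le> C + 20 * \<sigma>" by (auto simp: w0_def)
    have sr: "20 * \<sigma> \<le> 20" "- 20 \<le> 20 * \<sigma>" using s by auto
    have "P (t - 1, w0) \<or> P (t - 1, w0 + 2)"
    proof (rule ccontr)
      assume "\<not> ?thesis"
      then have "t - 1 = t - 1 \<and> w0 = w0 + 2"
        by (intro oneP) (use a ab b rw sr in auto)
      then show False by simp
    qed
    then obtain w where w: "w = w0 \<or> w = w0 + 2" "P (t - 1, w)" by auto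
    have pw': "even (int (t - 1) + w)" using w pw by auto
    have rw': "C + 20 * \<sigma> - 1 \<le> w" "w \<le> C + 20 * \<sigma> + 2" using w rw by auto
    have "open_path P b (g b) (t - 1) w"
    proof (rule open_path_avoiding[where T = "C + 24" and B = "C - 24"])
      show "P (b, g b)" using Pg ab by auto
      show "P (t - 1, w)" by fact
      show "\<bar>w - g b\<bar> + 2 \<le> int (t - 1) - int b" using rw' sr gr[of b] b by auto
      show "\<And>m j m' j'. b < m \<Longrightarrow> m < t - 1 \<Longrightarrow> b < m' \<Longrightarrow> m' < t - 1 \<Longrightarrow> C - 24 \<le> j \<Longrightarrow> j \<le> C + 24
         \<Longrightarrow> C - 24 \<le> j' \<Longrightarrow> j' \<le> C + 24 \<Longrightarrow> \<not> P (m, j) \<Longrightarrow> \<not> P (m', j') \<Longrightarrow> m = m' \<and> j = j'"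
        by (rule oneP) (use a ab b in auto)
    qed (use rw' sr gr[of b] b pw' in auto)
    then show ?thesis using rw' by auto
  qed
  show ?thesis
    unfolding good_box_def P_def[symmetric]
    using pair first mid last by (meson open_path_trans)
qed

lemma good_exit:
  assumes "good_box \<eta> s t C" "\<bar>u - C\<bar> \<le> 23" "even (int s + u)" "\<eta> (s, u)" "\<bar>\<sigma>\<bar> = 1"
  shows "\<exists>w. C + 20 * \<sigma> - 1 \<le> w \<and> w \<le> C + 20 * \<sigma> + 2 \<and> open_path \<eta> s u (t - 1) w"
proof -
  obtain w where w: "C + 20 * \<sigma> - 1 \<le> w" "w \<le> C + 20 * \<sigma> + 2"
      "open_path (\<lambda>x. \<eta> x \<and> in_box s t C x) s u (t - 1) w"
    using assms unfolding good_box_def by blast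
  have "open_path \<eta> s u (t - 1) w"
    by (rule open_path_mono_on[OF w(3)]) auto
  then show ?thesis using w by blast
qed

text \<open>Only sites with \<open>i + j\<close> even belong to the lattice; the others are declared open so that the
  field is independent over all of \<open>nat \<times> int\<close>.\<close>

definition renorm :: "(nat \<Rightarrow> nat) \<Rightarrow> (nat \<times> int \<Rightarrow> bool) \<Rightarrow> nat \<times> int \<Rightarrow> bool" where
  "renorm c \<eta> = (\<lambda>(I, J). even (int I + J) \<longrightarrow> good_box \<eta> (c I) (c (Suc I)) (40 * J))"

lemma open_path_renorm:
  assumes c0: "c 0 = 0" and cS: "\<And>I. c I < c (Suc I)" and \<eta>0: "\<eta> (0, 0)"
    and open_path: "open_path (renorm c \<eta>) 0 0 n J"
  shows "\<exists>w. open_path \<eta> 0 0 (c (Suc n) - 1) w"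
proof -
  \<comment> \<open>Both exits of the last box are carried along, because only the next coarse step
    tells which one is needed.\<close>
  have "(\<forall>\<sigma>. \<bar>\<sigma>\<bar> = 1 \<longrightarrow> (\<exists>w. 40 * J + 20 * \<sigma> - 1 \<le> w \<and> w \<le> 40 * J + 20 * \<sigma> + 2 \<and>
      open_path \<eta> 0 0 (c (Suc n) - 1) w))"
    using open_path
  proof (induction "0::nat" "0::int" n J rule: open_path.induct)
    case base
    then have "good_box \<eta> 0 (c (Suc 0)) 0" using c0 by (simp add: renorm_def)
    from good_exit[OF this, of 0] show ?case using \<eta>0 by simp
  next
    case (step k v v')
    define \<sigma> where "\<sigma> = v' - v"
    have \<sigma>: "\<bar>\<sigma>\<bar> = 1" "v' = v + \<sigma>" using step by (auto simp: \<sigma>_def)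
    then obtain w where w: "40 * v + 20 * \<sigma> - 1 \<le> w" "w \<le> 40 * v + 20 * \<sigma> + 2"
      "open_path \<eta> 0 0 (c (Suc k) - 1) w" using step by blast
    have pos: "0 < c (Suc k)" using cS[of k] by linarith
    have pw: "even (int (c (Suc k) - 1) + w)" using open_path_parity[OF w(3)] by simp
    have par: "even (int (Suc k) + v')"
      using open_path_parity[OF step(1)] \<sigma> by (auto simp: abs_if split: if_splits)
    have good_box: "good_box \<eta> (c (Suc k)) (c (Suc (Suc k))) (40 * v')"
      using step.hyps(3) par by (auto simp: renorm_def)
    \<comment> \<open>Relative to the new centre, \<open>w\<close> lies between
      \<open>-20 * \<sigma> - 1\<close> and \<open>-20 * \<sigma> + 2\<close>, so both neighbours
      \<open>w - 1\<close> and \<open>w + 1\<close> are within 23. This is the origin of the 23 in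
      \<open>good_box\<close>.\<close>
    have rng: "\<bar>w - 1 - 40 * v'\<bar> \<le> 23" "\<bar>w - 1 + 2 - 40 * v'\<bar> \<le> 23"
      using w \<sigma> by (auto simp: abs_if split: if_splits)
    have "even (int (c (Suc k)) + (w - 1))" using pw pos by (auto simp: of_nat_diff)
    then obtain u where u: "\<bar>u - w\<bar> = 1" "\<eta> (c (Suc k), u)" "even (int (c (Suc k)) + u)"
      "\<bar>u - 40 * v'\<bar> \<le> 23"
    proof -
      assume ev: "even (int (c (Suc k)) + (w - 1))"
      then have "\<eta> (c (Suc k), w - 1) \<or> \<eta> (c (Suc k), w - 1 + 2)"
        using good_box rng unfolding good_box_def by blast
      then show thesis
      proof
        assume "\<eta> (c (Suc k), w - 1)"
        then show thesis using that[of "w - 1"] ev rng by auto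
      next
        assume "\<eta> (c (Suc k), w - 1 + 2)"
        then show thesis using that[of "w - 1 + 2"] ev rng by auto
      qed
    qed
    \<comment> \<open>The exit lies in the last column of the old box and the entrance in the first
      column of the new one; one step joins them.\<close>
    have "open_path \<eta> 0 0 (Suc (c (Suc k) - 1)) u"
      by (rule open_path.step[OF w(3)]) (use u pos in auto)
    then have p1: "open_path \<eta> 0 0 (c (Suc k)) u" using pos by simp
    show ?case
    proof (intro allI impI)
      fix \<sigma>' :: int assume "\<bar>\<sigma>'\<bar> = 1"
      from good_exit[OF good_box u(4,3,2) this] obtain w' where
        w': "40 * v' + 20 * \<sigma>' - 1 \<le> w'" "w' \<le> 40 * v' + 20 * \<sigma>' + 2"
        "open_path \<eta> (c (Suc k)) u (c (Suc (Suc k)) - 1) w'" by blast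
      have "open_path \<eta> 0 0 (c (Suc (Suc k)) - 1) w'" using p1 by (rule open_path_trans[OF w'(3)])
      then show "\<exists>w\<ge>40 * v' + 20 * \<sigma>' - 1. w \<le> 40 * v' + 20 * \<sigma>' + 2 \<and>
           open_path \<eta> 0 0 (c (Suc (Suc k)) - 1) w" using w' by blast
    qed
  qed
  from this[rule_format, of 1] show ?thesis by auto
qed


section \<open>Probability of a good box\<close>

text \<open>All bad columns lie in \<open>a..b\<close>. A single bad column loses one unit; otherwise the penalty of 82
  per column pays for asking that every site off \<open>a..b\<close> and every site of one corridor be open.\<close>

definition block :: "(nat \<Rightarrow> nat) \<Rightarrow> nat \<Rightarrow> nat \<Rightarrow> nat \<Rightarrow> bool" where
  "block \<xi> s t m \<longleftrightarrow> (\<exists>a b. s + 50 \<le> a \<and> a \<le> b \<and> b + 50 \<le> t \<and>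
     (\<forall>i. s \<le> i \<and> i < t \<and> i \<notin> {a..b} \<longrightarrow> \<xi> i = 0) \<and>
     (a = b \<and> t \<le> s + 200 \<and> \<xi> a \<le> m + 1 \<or> (\<Sum>i=a..b. \<xi> i) + 82 * (t - s) \<le> m))"

lemma finite_in_box: "finite {x. in_box s t C x}"
proof -
  have "{x. in_box s t C x} \<subseteq> {s..<t} \<times> {C - 40..<C + 40}" by (auto simp: in_box_def)
  then show ?thesis by (rule finite_subset) auto
qed

lemma card_in_box: "card {x. in_box s t C x} = (t - s) * 80"
proof -
  have "{x. in_box s t C x} = {s..<t} \<times> {C - 40..<C + 40}" by (auto simp: in_box_def)
  then show ?thesis by (simp add: card_cartesian_product)
qed

text \<open>In the expanded product every monomial other than 1 carries some \<open>B ^ k\<close>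
  with \<open>k \<ge> 1\<close>, and \<open>B ^ k \<le> B\<close>. So the odds against a conjunction
  stay linear in \<open>B\<close>.\<close>

lemma prod_one_plus_le:
  fixes y :: "'i \<Rightarrow> real"
  assumes "finite A" "\<And>x. x \<in> A \<Longrightarrow> 0 \<le> y x" "0 \<le> B" "B \<le> 1"
  shows "(\<Prod>x\<in>A. 1 + B * y x) \<le> 1 + B * ((\<Prod>x\<in>A. 1 + y x) - 1)"
  using assms
proof (induction A rule: finite_induct)
  case (insert x A)
  let ?p = "\<Prod>x\<in>A. 1 + y x"
  have p: "1 \<le> ?p" using insert by (intro prod_ge_1) auto
  have y: "0 \<le> y x" using insert by auto
  have "(\<Prod>z\<in>insert x A. 1 + B * y z) \<le> (1 + B * y x) * (1 + B * (?p - 1))"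
    using insert by (auto intro!: mult_left_mono)
  also have "\<dots> = 1 + B * (y x + ?p - 1 + B * (y x * (?p - 1)))" by (simp add: algebra_simps)
  also have "\<dots> \<le> 1 + B * (y x + ?p - 1 + 1 * (y x * (?p - 1)))"
    using insert.prems p y by (intro add_left_mono mult_left_mono mult_right_mono) auto
  finally show ?case using insert by (simp add: algebra_simps)
qed simp

text \<open>Meant for events such as \<open>good_box\<close>, which quantify over paths. As only the
  finitely many sites in \<open>S\<close> matter, the event is a finite union over the possible sets
  \<open>Z\<close> of open sites in \<open>S\<close>.\<close>

lemma pred_finite_dependence:
  assumes fin: "finite S" and X: "\<And>x. x \<in> S \<Longrightarrow> Measurable.pred N (X x)"
    and dep: "\<And>f f'. \<forall>x\<in>S. f x = f' x \<Longrightarrow> P f = P f'"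
  shows "Measurable.pred N (\<lambda>\<omega>. P (\<lambda>x. X x \<omega>))"
proof -
  have "P (\<lambda>x. X x \<omega>) \<longleftrightarrow> (\<exists>Z\<in>Pow S. P (\<lambda>x. x \<in> Z) \<and> (\<forall>x\<in>S. X x \<omega> = (x \<in> Z)))" (is "?L = ?R") for \<omega>
  proof
    assume ?L
    moreover have "P (\<lambda>x. X x \<omega>) = P (\<lambda>x. x \<in> {x \<in> S. X x \<omega>})"
      by (intro dep) auto
    ultimately show ?R by (intro bexI[of _ "{x \<in> S. X x \<omega>}"]) auto
  next
    assume ?R
    then obtain Z where Z: "P (\<lambda>x. x \<in> Z)" "\<forall>x\<in>S. X x \<omega> = (x \<in> Z)" by auto
    then show ?L using dep[of "\<lambda>x. X x \<omega>" "\<lambda>x. x \<in> Z"] by simp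
  qed
  moreover have "finite (Pow S)" using fin by simp
  ultimately show ?thesis using fin X by simp
qed

context prob_space
begin

definition indep_field :: "(nat \<times> int \<Rightarrow> 'a \<Rightarrow> bool) \<Rightarrow> bool" where
  "indep_field \<eta> \<longleftrightarrow> indep_vars (\<lambda>_. count_space UNIV) \<eta> UNIV"

lemma indep_field_measurable:
  "indep_field \<eta> \<Longrightarrow> Measurable.pred M (\<eta> x)"
  unfolding indep_field_def indep_vars_def by blast

lemma prob_all_sites:
  assumes "indep_field \<eta>" "finite J"
  shows "prob {\<omega> \<in> space M. \<forall>x\<in>J. \<eta> x \<omega> = v x} = (\<Prod>x\<in>J. prob {\<omega> \<in> space M. \<eta> x \<omega> = v x})"
proof (cases "J = {}")
  case True then show ?thesis by (simp add: prob_space)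
next
  case False
  have "prob (\<Inter>x\<in>J. \<eta> x -` {v x} \<inter> space M) = (\<Prod>x\<in>J. prob (\<eta> x -` {v x} \<inter> space M))"
    using assms False unfolding indep_field_def by (intro indep_varsD[where I = UNIV]) auto
  moreover have "(\<Inter>x\<in>J. \<eta> x -` {v x} \<inter> space M) = {\<omega> \<in> space M. \<forall>x\<in>J. \<eta> x \<omega> = v x}"
    using False by auto
  moreover have "\<eta> x -` {v x} \<inter> space M = {\<omega> \<in> space M. \<eta> x \<omega> = v x}" for x by auto
  ultimately show ?thesis by simp
qed

lemma prob_Not:
  assumes "indep_field \<eta>"
  shows "prob {\<omega> \<in> space M. \<not> \<eta> x \<omega>} = 1 - prob {\<omega> \<in> space M. \<eta> x \<omega>}"
  using indep_field_measurable[OF assms, of x] by (intro prob_neg) simp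

lemma good_measurable:
  assumes "indep_field \<eta>" "s < t"
  shows "Measurable.pred M (\<lambda>\<omega>. good_box (\<lambda>x. \<eta> x \<omega>) s t C)"
proof (rule pred_finite_dependence[OF finite_in_box, where P = "\<lambda>f. good_box f s t C"])
  show "Measurable.pred M (\<eta> x)" for x using assms(1) by (rule indep_field_measurable)
  show "good_box f s t C = good_box f' s t C" if "\<forall>x\<in>{x. in_box s t C x}. f x = f' x" for f f'
    using that assms(2) by (intro good_cong) auto
qed

text \<open>A lower bound \<open>1 / (1 + o)\<close> for a probability says that the odds against
  the event are at most \<open>o\<close>. All sites off \<open>a..b\<close> and those of corridor 0
  are asked to be open, and independence multiplies the factors
  \<open>1 + B * 2 ^ \<xi> i\<close>.\<close>

lemma prob_good_dense:
  assumes ind: "indep_field \<eta>" and B: "0 < B" "B \<le> 1"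
    and g: "\<And>i j. 1 / (1 + B * 2 ^ \<xi> i) \<le> prob {\<omega> \<in> space M. \<eta> (i, j) \<omega>}"
    and a: "s + 50 \<le> a" and ab: "a \<le> b" and b: "b + 50 \<le> t"
    and zero: "\<And>i. s \<le> i \<Longrightarrow> i < t \<Longrightarrow> i \<notin> {a..b} \<Longrightarrow> \<xi> i = 0"
    and m: "(\<Sum>i=a..b. \<xi> i) + 82 * (t - s) \<le> m"
  shows "1 / (1 + B / 2 * 2 ^ m) \<le> prob {\<omega> \<in> space M. good_box (\<lambda>x. \<eta> x \<omega>) s t C}"
proof -
  define D where "D = {x. in_box s t C x \<and> fst x \<notin> {a..b}}"
  define K where "K = corridor C 0 ` {a..b}"
  have finD: "finite D" unfolding D_def by (rule finite_subset[OF _ finite_in_box]) auto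
  have finK: "finite K" unfolding K_def by simp
  have injK: "inj_on (corridor C 0) {a..b}" by (auto simp: inj_on_def corridor_def)
  have disj: "D \<inter> K = {}" by (auto simp: D_def K_def corridor_def)
  have st: "s < t" using a ab b by auto
  have cD: "card D \<le> (t - s) * 80"
    unfolding card_in_box[of s t C, symmetric] D_def by (rule card_mono[OF finite_in_box]) auto
  let ?E = "{\<omega> \<in> space M. \<forall>x\<in>D \<union> K. \<eta> x \<omega> = True}"
  let ?y = "\<lambda>x. (2::real) ^ \<xi> (fst x)"
  have "?E \<subseteq> {\<omega> \<in> space M. good_box (\<lambda>x. \<eta> x \<omega>) s t C}"
  proof safe
    fix \<omega> assume "\<omega> \<in> space M" and all: "\<forall>x\<in>D \<union> K. \<eta> x \<omega> = True"
    show "good_box (\<lambda>x. \<eta> x \<omega>) s t C"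
      by (rule goodI[OF a ab b, where r = 0]) (use all in \<open>auto simp: D_def K_def\<close>)
  qed
  then have 1: "prob ?E \<le> prob {\<omega> \<in> space M. good_box (\<lambda>x. \<eta> x \<omega>) s t C}"
    using good_measurable[OF ind st] by (intro finite_measure_mono) auto
  have "(\<Prod>x\<in>D \<union> K. 1 / (1 + B * ?y x)) \<le> (\<Prod>x\<in>D \<union> K. prob {\<omega> \<in> space M. \<eta> x \<omega> = True})"
    using g B by (intro prod_mono) (auto intro!: divide_nonneg_nonneg add_nonneg_nonneg)
  also have "\<dots> = prob ?E" using finD finK by (intro prob_all_sites[symmetric] ind) auto
  finally have 2: "1 / (\<Prod>x\<in>D \<union> K. 1 + B * ?y x) \<le> prob ?E" by (simp add: prod_dividef)
  have D1: "(\<Prod>x\<in>D. 1 + ?y x) = 2 ^ card D"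
  proof -
    have "1 + ?y x = 2" if "x \<in> D" for x
      using that zero[of "fst x"] by (auto simp: D_def in_box_def)
    then show ?thesis by simp
  qed
  have K1: "(\<Prod>x\<in>K. 1 + ?y x) \<le> 2 ^ ((\<Sum>i=a..b. \<xi> i) + (t - s))"
  proof -
    have "(\<Prod>x\<in>K. 1 + ?y x) = (\<Prod>i=a..b. 1 + 2 ^ \<xi> i)"
      unfolding K_def by (subst prod.reindex[OF injK]) (simp add: corridor_def)
    also have "\<dots> \<le> (\<Prod>i=a..b. 2 ^ (\<xi> i + 1))" by (intro prod_mono) auto
    also have "\<dots> = 2 ^ (\<Sum>i=a..b. \<xi> i + 1)" by (rule power_sum[symmetric])
    also have "\<dots> \<le> 2 ^ ((\<Sum>i=a..b. \<xi> i) + (t - s))"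
      using a ab b by (intro power_increasing) (auto simp: sum.distrib sum_Suc)
    finally show ?thesis .
  qed
  have "(\<Prod>x\<in>D \<union> K. 1 + B * ?y x) \<le> 1 + B * ((\<Prod>x\<in>D \<union> K. 1 + ?y x) - 1)"
    using B finD finK by (intro prod_one_plus_le) auto
  also have "\<dots> \<le> 1 + B * (\<Prod>x\<in>D \<union> K. 1 + ?y x)" using B by simp
  also have "(\<Prod>x\<in>D \<union> K. 1 + ?y x) = (\<Prod>x\<in>D. 1 + ?y x) * (\<Prod>x\<in>K. 1 + ?y x)"
    using finD finK disj by (rule prod.union_disjoint)
  also have "1 + B * \<dots> \<le> 1 + B * (2 ^ ((t - s) * 80) * 2 ^ ((\<Sum>i=a..b. \<xi> i) + (t - s)))"
    unfolding D1 using B K1 cD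
    by (intro add_left_mono mult_left_mono mult_mono power_increasing) (auto intro: prod_nonneg)
  also have "\<dots> = 1 + B / 2 * 2 ^ ((\<Sum>i=a..b. \<xi> i) + 81 * (t - s) + 1)"
  proof -
    have "(t - s) * 80 + ((\<Sum>i=a..b. \<xi> i) + (t - s)) = (\<Sum>i=a..b. \<xi> i) + 81 * (t - s)" by simp
    then show ?thesis by (simp flip: power_add)
  qed
  \<comment> \<open>Per column there are at most 80 factors 2 from sites off \<open>a..b\<close> and
    one from \<open>1 + 2 ^ \<xi> i \<le> 2 ^ (\<xi> i + 1)\<close> in the corridor; one more pays
    for turning \<open>B\<close> into \<open>B / 2\<close>. Hence the 82 in
    \<open>block\<close>.\<close>
  also have "\<dots> \<le> 1 + B / 2 * 2 ^ m"
    using B m st by (intro add_left_mono mult_left_mono power_increasing) auto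
  finally have 3: "(\<Prod>x\<in>D \<union> K. 1 + B * ?y x) \<le> 1 + B / 2 * 2 ^ m" .
  have "0 < (\<Prod>x\<in>D \<union> K. 1 + B * ?y x)"
    using B by (intro prod_pos) (auto intro!: add_pos_nonneg)
  then have "1 / (1 + B / 2 * 2 ^ m) \<le> 1 / (\<Prod>x\<in>D \<union> K. 1 + B * ?y x)"
    using 3 by (intro divide_left_mono) (auto intro!: mult_pos_pos add_pos_nonneg)
  then show ?thesis using 1 2 by linarith
qed

text \<open>Bernoulli: 16 independent attempts divide the odds of failure by at least 16.\<close>

lemma odds_improve:
  fixes \<delta> o' G T :: real
  assumes o: "0 < o'" "o' \<le> 4 * T" and G: "1 / (1 + o') \<le> G" "G \<le> 1"
    and \<delta>: "0 \<le> \<delta>" "\<delta> \<le> 1/4" "\<delta> \<le> T / 4"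
  shows "1 / (1 + T) \<le> (1 - \<delta>) * (1 - (1 - G) ^ 16)"
proof -
  have "(1 - G) ^ 16 \<le> (o' / (1 + o')) ^ 16"
    using G o by (intro power_mono) (auto simp: field_simps)
  also have "\<dots> \<le> o' / (16 + o')"
  proof -
    have "1 + real 16 * (1 / o') \<le> (1 + 1 / o') ^ 16"
      using o by (intro Bernoulli_inequality) (auto simp: field_simps)
    moreover have "(o' / (1 + o')) ^ 16 = 1 / (1 + 1 / o') ^ 16"
      using o by (simp add: field_simps power_divide)
    moreover have "o' / (16 + o') = 1 / (1 + real 16 * (1 / o'))"
      using o by (simp add: field_simps)
    ultimately show ?thesis using o
      by (auto intro!: divide_left_mono mult_pos_pos add_pos_nonneg zero_less_power)
  qed
  also have "\<dots> = 1 - 1 / (1 + o' / 16)" using o by (simp add: field_simps)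
  finally have 1: "1 / (1 + o' / 16) \<le> 1 - (1 - G) ^ 16" by simp
  have T: "0 < T" using o by linarith
  \<comment> \<open>The losses \<open>\<delta>\<close> and \<open>\<delta> * T\<close> cost at most
    \<open>T / 4\<close> each, and \<open>o' / 16 \<le> T / 4\<close>, so the sum stays below
    \<open>T\<close>.\<close>
  have "\<delta> * T \<le> 1/4 * T" using \<delta> T by (intro mult_right_mono) auto
  moreover have "(1 - \<delta>) * (1 + T) = 1 + T - \<delta> - \<delta> * T" by (simp add: algebra_simps)
  ultimately have "1 + o' / 16 \<le> (1 - \<delta>) * (1 + T)" using o \<delta> T by linarith
  then have "1 / (1 + T) \<le> (1 - \<delta>) * (1 / (1 + o' / 16))"
    using o T by (simp add: field_simps)
  also have "\<dots> \<le> (1 - \<delta>) * (1 - (1 - G) ^ 16)"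
    using 1 \<delta> by (intro mult_left_mono) auto
  finally show ?thesis .
qed

text \<open>A union bound over ordered pairs of distinct sites, each pair being closed with
  probability at most \<open>\<epsilon> * \<epsilon>\<close> by independence. This is the
  second-order gain in good columns.\<close>

lemma prob_two_closed_le:
  assumes ind: "indep_field \<eta>" and A: "finite A" "0 \<le> \<epsilon>"
    and g: "\<And>x. x \<in> A \<Longrightarrow> prob {\<omega> \<in> space M. \<not> \<eta> x \<omega>} \<le> \<epsilon>"
  shows "1 - (real (card A) * \<epsilon>)\<^sup>2 \<le>
     prob {\<omega> \<in> space M. \<forall>x\<in>A. \<forall>y\<in>A. \<not> \<eta> x \<omega> \<and> \<not> \<eta> y \<omega> \<longrightarrow> x = y}" (is "_ \<le> prob ?E")
proof -
  note [measurable] = indep_field_measurable[OF ind]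
  let ?F = "\<lambda>p. {\<omega> \<in> space M. \<not> \<eta> (fst p) \<omega> \<and> \<not> \<eta> (snd p) \<omega>}"
  let ?I = "{p \<in> A \<times> A. fst p \<noteq> snd p}"
  have [measurable]: "?E \<in> events" using A by measurable
  have finI: "finite ?I" using A by auto
  have "1 - prob ?E = prob (space M - ?E)" by (subst prob_compl) auto
  also have "\<dots> \<le> prob (\<Union>p\<in>?I. ?F p)"
    using finI by (intro finite_measure_mono sets.finite_UN) auto
  also have "\<dots> \<le> (\<Sum>p\<in>?I. prob (?F p))"
    using finI by (intro finite_measure_subadditive_finite) auto
  also have "\<dots> \<le> (\<Sum>p\<in>?I. \<epsilon> * \<epsilon>)"
  proof (rule sum_mono)
    fix p assume p: "p \<in> ?I"
    then have "prob {\<omega> \<in> space M. \<forall>x\<in>{fst p, snd p}. \<eta> x \<omega> = False}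
       = (\<Prod>x\<in>{fst p, snd p}. prob {\<omega> \<in> space M. \<eta> x \<omega> = False})"
      by (intro prob_all_sites ind) auto
    also have "\<dots> = prob {\<omega> \<in> space M. \<not> \<eta> (fst p) \<omega>} * prob {\<omega> \<in> space M. \<not> \<eta> (snd p) \<omega>}"
      using p by simp
    also have "\<dots> \<le> \<epsilon> * \<epsilon>" using p A by (intro mult_mono g) auto
    finally show "prob (?F p) \<le> \<epsilon> * \<epsilon>" by (simp cong: conj_cong)
  qed
  also have "\<dots> \<le> (real (card A) * real (card A)) * (\<epsilon> * \<epsilon>)"
  proof -
    have "card ?I \<le> card (A \<times> A)" using A by (intro card_mono) auto
    then have "real (card ?I) \<le> real (card A) * real (card A)"
      by (simp add: card_cartesian_product flip: of_nat_mult)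
    then show ?thesis using A by (auto intro!: mult_right_mono)
  qed
  finally show ?thesis by (simp add: power2_eq_square algebra_simps)
qed

text \<open>Two events on disjoint sets of sites: at most one closed site off column
  \<open>a\<close> (\<open>?E1\<close>), and some corridor open in column \<open>a\<close>
  (\<open>?E2\<close>). Any open corridor serves, so all 16 count as attempts.\<close>

lemma prob_good_single:
  assumes ind: "indep_field \<eta>" and B: "0 < B" "B \<le> 1 / 10 ^ 12"
    and g: "\<And>i j. 1 / (1 + B * 2 ^ \<xi> i) \<le> prob {\<omega> \<in> space M. \<eta> (i, j) \<omega>}"
    and a: "s + 50 \<le> a" and b: "a + 50 \<le> t" and t: "t \<le> s + 200"
    and zero: "\<And>i. s \<le> i \<Longrightarrow> i < t \<Longrightarrow> i \<noteq> a \<Longrightarrow> \<xi> i = 0"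
    and m: "\<xi> a \<le> m + 1"
  shows "1 / (1 + B / 2 * 2 ^ m) \<le> prob {\<omega> \<in> space M. good_box (\<lambda>x. \<eta> x \<omega>) s t C}"
proof -
  note [measurable] = indep_field_measurable[OF ind]
  define D where "D = {x. in_box s t C x \<and> fst x \<notin> {a..a}}"
  define K where "K = (\<lambda>r. corridor C r a) ` {..<16}"
  have finD: "finite D" unfolding D_def by (rule finite_subset[OF _ finite_in_box]) auto
  have finK: "finite K" unfolding K_def by simp
  have injK: "inj_on (\<lambda>r. corridor C r a) {..<16}" by (auto simp: inj_on_def corridor_def)
  have disj: "D \<inter> K = {}" by (auto simp: D_def K_def corridor_def)
  have "card D \<le> (t - s) * 80"
    unfolding card_in_box[of s t C, symmetric] D_def by (rule card_mono[OF finite_in_box]) auto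
  \<comment> \<open>At most 200 columns of 80 sites.\<close>
  also have "\<dots> \<le> 16000" using t by simp
  finally have cD: "card D \<le> 16000" .
  let ?E1 = "\<lambda>\<omega>. \<forall>x\<in>D. \<forall>y\<in>D. \<not> \<eta> x \<omega> \<and> \<not> \<eta> y \<omega> \<longrightarrow> x = y"
  let ?E2 = "\<lambda>\<omega>. \<exists>x\<in>K. \<eta> x \<omega>"
  let ?P = "\<lambda>A :: (nat \<times> int) set. PiM A (\<lambda>_. count_space (UNIV :: bool set))"
  have st: "s < t" using a b by auto
  define T where "T = B / 2 * 2 ^ m"
  have T: "B \<le> 2 * T" using B unfolding T_def by simp
  have closed: "prob {\<omega> \<in> space M. \<not> \<eta> x \<omega>} \<le> B" if "x \<in> D" for x
  proof -
    have "\<xi> (fst x) = 0" using that zero[of "fst x"] by (auto simp: D_def in_box_def)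
    then have "1 / (1 + B) \<le> prob {\<omega> \<in> space M. \<eta> x \<omega>}"
      using g[of "fst x" "snd x"] by simp
    moreover have "1 - B \<le> 1 / (1 + B)" using B by (simp add: field_simps)
    ultimately show ?thesis by (simp add: prob_Not[OF ind])
  qed
  have "1 - (real (card D) * B)\<^sup>2 \<le> prob {\<omega> \<in> space M. ?E1 \<omega>}"
    using B finD by (intro prob_two_closed_le ind closed) auto
  moreover have "(real (card D) * B)\<^sup>2 \<le> (16000 * B)\<^sup>2"
    using cD B by (intro power_mono mult_right_mono) auto
  ultimately have P1: "1 - (16000 * B)\<^sup>2 \<le> prob {\<omega> \<in> space M. ?E1 \<omega>}" by linarith
  define G where "G = 1 / (1 + B * 2 ^ \<xi> a)"
  have G: "0 \<le> G" "G \<le> 1" using B by (auto simp: G_def divide_simps add_pos_pos)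
  have "prob {\<omega> \<in> space M. \<not> ?E2 \<omega>} = prob {\<omega> \<in> space M. \<forall>x\<in>K. \<eta> x \<omega> = False}" by simp
  also have "\<dots> = (\<Prod>x\<in>K. prob {\<omega> \<in> space M. \<eta> x \<omega> = False})"
    using finK by (intro prob_all_sites ind) auto
  also have "\<dots> \<le> (\<Prod>x\<in>K. 1 - G)"
  proof (rule prod_mono)
    fix x assume "x \<in> K"
    then obtain j where "x = (a, j)" by (auto simp: K_def corridor_def)
    then show "0 \<le> prob {\<omega> \<in> space M. \<eta> x \<omega> = False} \<and> prob {\<omega> \<in> space M. \<eta> x \<omega> = False} \<le> 1 - G"
      using g[of a j] by (simp add: prob_Not[OF ind] G_def)
  qed
  also have "\<dots> = (1 - G) ^ 16" using card_image[OF injK] by (simp add: K_def)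
  finally have P2: "1 - (1 - G) ^ 16 \<le> prob {\<omega> \<in> space M. ?E2 \<omega>}"
    using finK by (subst (asm) prob_neg) auto
  have "indep_var (?P D) (\<lambda>\<omega>. restrict (\<lambda>x. \<eta> x \<omega>) D) (?P K) (\<lambda>\<omega>. restrict (\<lambda>x. \<eta> x \<omega>) K)"
    using ind disj unfolding indep_field_def by (intro indep_var_restrict) auto
  moreover have "{f \<in> space (?P D). \<forall>x\<in>D. \<forall>y\<in>D. \<not> f x \<and> \<not> f y \<longrightarrow> x = y} \<in> sets (?P D)"
    using finD by measurable
  moreover have "{f \<in> space (?P K). \<exists>x\<in>K. f x} \<in> sets (?P K)"
    using finK by measurable
  ultimately have "prob {\<omega> \<in> space M. ?E1 \<omega> \<and> ?E2 \<omega>} =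
      prob {\<omega> \<in> space M. ?E1 \<omega>} * prob {\<omega> \<in> space M. ?E2 \<omega>}"
    by (auto dest!: indep_varD simp: space_PiM vimage_def Int_def conj_commute cong: conj_cong)
  also have "\<dots> \<ge> (1 - (16000 * B)\<^sup>2) * (1 - (1 - G) ^ 16)"
  proof (rule mult_mono[OF P1 P2])
    show "0 \<le> 1 - (1 - G) ^ 16" using G by (auto intro!: power_le_one)
  qed auto
  also have "(1 - (16000 * B)\<^sup>2) * (1 - (1 - G) ^ 16) \<ge> 1 / (1 + T)"
  proof (rule odds_improve)
    show "0 < B * 2 ^ \<xi> a" using B by simp
    \<comment> \<open>From \<open>B\<close> and badness \<open>m + 1\<close> to \<open>B / 2\<close>
      and badness \<open>m\<close>: the factor 4 that the 16 attempts have to beat.\<close>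
    have "B * 2 ^ \<xi> a \<le> B * 2 ^ (m + 1)" using B m by (intro mult_left_mono power_increasing) auto
    then show "B * 2 ^ \<xi> a \<le> 4 * T" by (simp add: T_def)
    show "1 / (1 + B * 2 ^ \<xi> a) \<le> G" by (simp add: G_def)
    \<comment> \<open>Smallness of \<open>B\<close> enters here: a pair of closed sites must be
      unlikely even compared with \<open>B\<close>.\<close>
    have "(16000 * B)\<^sup>2 = (256000000 * B) * B" by (simp add: power2_eq_square)
    also have "\<dots> \<le> (1/8) * B" using B by (intro mult_right_mono) auto
    finally have *: "(16000 * B)\<^sup>2 \<le> B / 8" by simp
    show "(16000 * B)\<^sup>2 \<le> 1 / 4" using * B by simp
    show "(16000 * B)\<^sup>2 \<le> T / 4" using * T by simp
  qed (use G in auto)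
  finally have "1 / (1 + T) \<le> prob {\<omega> \<in> space M. ?E1 \<omega> \<and> ?E2 \<omega>}" .
  also have "\<dots> \<le> prob {\<omega> \<in> space M. good_box (\<lambda>x. \<eta> x \<omega>) s t C}"
  proof (rule finite_measure_mono)
    show "{\<omega> \<in> space M. ?E1 \<omega> \<and> ?E2 \<omega>} \<subseteq> {\<omega> \<in> space M. good_box (\<lambda>x. \<eta> x \<omega>) s t C}"
    proof safe
      fix \<omega> x assume E1: "?E1 \<omega>" and x: "x \<in> K" "\<eta> x \<omega>"
      then obtain r where r: "r < 16" "x = corridor C r a" by (auto simp: K_def)
      show "good_box (\<lambda>x. \<eta> x \<omega>) s t C"
        by (rule goodI[OF a order_refl b _ r(1)]) (use E1 x r in \<open>auto simp: D_def\<close>)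
    qed
    show "{\<omega> \<in> space M. good_box (\<lambda>x. \<eta> x \<omega>) s t C} \<in> events" using good_measurable[OF ind st] by simp
  qed
  finally show ?thesis unfolding T_def .
qed

lemma prob_good:
  assumes ind: "indep_field \<eta>" and B: "0 < B" "B \<le> 1 / 10 ^ 12"
    and g: "\<And>i j. 1 / (1 + B * 2 ^ \<xi> i) \<le> prob {\<omega> \<in> space M. \<eta> (i, j) \<omega>}"
    and bl: "block \<xi> s t m"
  shows "1 / (1 + B / 2 * 2 ^ m) \<le> prob {\<omega> \<in> space M. good_box (\<lambda>x. \<eta> x \<omega>) s t C}"
proof -
  obtain a b where ab: "s + 50 \<le> a" "a \<le> b" "b + 50 \<le> t"
     "\<And>i. s \<le> i \<Longrightarrow> i < t \<Longrightarrow> i \<notin> {a..b} \<Longrightarrow> \<xi> i = 0"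
     "a = b \<and> t \<le> s + 200 \<and> \<xi> a \<le> m + 1 \<or> (\<Sum>i=a..b. \<xi> i) + 82 * (t - s) \<le> m"
    using bl unfolding block_def by blast
  have "B \<le> 1" using B by simp
  then show ?thesis
    using ab(5) prob_good_single[OF ind B g ab(1), of t m C] prob_good_dense[OF ind B(1) _ g ab(1,2,3,4), of m C]
      ab by auto
qed

end


section \<open>Iterated renormalisation of the percolation\<close>

lemma open_path_prefix: "open_path P i u k v \<Longrightarrow> i \<le> m \<Longrightarrow> m \<le> k \<Longrightarrow> \<exists>w. open_path P i u m w"
proof (induction rule: open_path.induct)
  case (step i u k v v')
  then show ?case by (cases "m = Suc k") (auto intro: open_path.step)
qed (auto intro: open_path.base)

lemma open_path_0_iff: "open_path P 0 u 0 w \<longleftrightarrow> w = u \<and> P (0, u)"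
  by (subst open_path.simps) auto

lemma open_path_Suc_iff:
  "open_path P 0 u (Suc n) w \<longleftrightarrow> (open_path P 0 u n (w - 1) \<or> open_path P 0 u n (w + 1)) \<and> P (Suc n, w)"
proof
  assume "open_path P 0 u (Suc n) w"
  then show "(open_path P 0 u n (w - 1) \<or> open_path P 0 u n (w + 1)) \<and> P (Suc n, w)"
  proof (cases rule: open_path.cases)
    case (step v)
    then have "v = w - 1 \<or> v = w + 1" by linarith
    then show ?thesis using step by auto
  qed
qed (auto intro: open_path.step)

lemma pred_path:
  assumes [measurable]: "\<And>x. Measurable.pred N (X x)"
  shows "Measurable.pred N (\<lambda>\<omega>. open_path (\<lambda>x. X x \<omega>) 0 u n w)"
proof (induction n arbitrary: w)
  case 0 show ?case unfolding open_path_0_iff by measurable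
next
  case (Suc n)
  note [measurable] = Suc.IH
  show ?case unfolding open_path_Suc_iff by measurable
qed

definition renorm_dom :: "(nat \<Rightarrow> nat) \<Rightarrow> nat \<times> int \<Rightarrow> (nat \<times> int) set" where
  "renorm_dom c = (\<lambda>(I, J). if even (int I + J) then {x. in_box (c I) (c (Suc I)) (40 * J) x} else {})"

lemma renorm_cong:
  assumes "c (fst y) < c (Suc (fst y))" "\<forall>x\<in>renorm_dom c y. f x = f' x"
  shows "renorm c f y = renorm c f' y"
  using assms good_cong[of "c (fst y)" "c (Suc (fst y))" "40 * snd y" f f']
  by (auto simp: renorm_def renorm_dom_def split: prod.splits if_splits)

lemma finite_renorm_dom: "finite (renorm_dom c y)"
  by (auto simp: renorm_dom_def finite_in_box split: prod.splits)

text \<open>Boxes over different blocks use different columns. Over the same block \<open>J\<close>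
  and \<open>J'\<close> have equal parity, so distinct centre lines are at least 80 apart, the
  height of a box; this is the purpose of the brick pattern.\<close>

lemma disjoint_renorm_dom:
  assumes c: "strict_mono c"
  shows "disjoint_family (renorm_dom c)"
  unfolding disjoint_family_on_def
proof (intro ballI impI, rule ccontr)
  fix y y' :: "nat \<times> int" assume ne: "y \<noteq> y'" and "renorm_dom c y \<inter> renorm_dom c y' \<noteq> {}"
  then obtain i j where ij: "(i, j) \<in> renorm_dom c y" "(i, j) \<in> renorm_dom c y'" by auto
  obtain I J I' J' where y: "y = (I, J)" "y' = (I', J')" by (metis surj_pair)
  have *: "even (int I + J)" "c I \<le> i" "i < c (Suc I)" "40 * J - 40 \<le> j" "j < 40 * J + 40"
     "even (int I' + J')" "c I' \<le> i" "i < c (Suc I')" "40 * J' - 40 \<le> j" "j < 40 * J' + 40"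
    using ij by (auto simp: y renorm_dom_def in_box_def split: if_splits)
  have "I \<le> I'" "I' \<le> I"
    using * strict_mono_less[OF c, of I "Suc I'"] strict_mono_less[OF c, of I' "Suc I"] by linarith+
  then have I: "I = I'" by simp
  have "even ((int I + J) - (int I + J'))" using *(1,6) unfolding I by (rule dvd_diff)
  then have "2 dvd J - J'" by (metis add_diff_cancel_left)
  then obtain d where "J - J' = 2 * d" by (rule dvdE)
  moreover have "\<bar>J - J'\<bar> < 2" using * by linarith
  ultimately have "J = J'" by arith
  then show False using ne y I by simp
qed

context prob_space
begin

text \<open>The new sites are functions of disjoint groups of old sites, so the same step can be
  applied again on the next scale.\<close>

lemma indep_field_renorm:
  assumes ind: "indep_field \<eta>" and c: "\<And>I. c I < c (Suc I)"
  shows "indep_field (\<lambda>x \<omega>. renorm c (\<lambda>y. \<eta> y \<omega>) x)"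
proof -
  let ?K = "renorm_dom c"
  have "indep_vars (\<lambda>j. PiM (?K j) (\<lambda>_. count_space UNIV)) (\<lambda>j \<omega>. restrict (\<lambda>i. \<eta> i \<omega>) (?K j)) UNIV"
    using ind disjoint_renorm_dom[of c] c unfolding indep_field_def
    by (intro indep_vars_restrict) (auto simp: strict_mono_Suc_iff)
  then have "indep_vars (\<lambda>_. count_space UNIV)
      (\<lambda>j \<omega>. renorm c (restrict (\<lambda>i. \<eta> i \<omega>) (?K j)) j) UNIV"
  proof (rule indep_vars_compose2)
    fix j :: "nat \<times> int"
    show "(\<lambda>f. renorm c f j) \<in> PiM (?K j) (\<lambda>_. count_space UNIV) \<rightarrow>\<^sub>M count_space UNIV"
    proof (rule pred_finite_dependence[OF finite_renorm_dom, where X = "\<lambda>x f. f x" and P = "\<lambda>f. renorm c f j"])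
      show "Measurable.pred (PiM (?K j) (\<lambda>_. count_space UNIV)) (\<lambda>f. f x)" if "x \<in> ?K j" for x
        using that by measurable
      show "renorm c f j = renorm c f' j" if "\<forall>x\<in>?K j. f x = f' x" for f f'
        using c that by (rule renorm_cong)
    qed
  qed
  moreover have "renorm c (restrict (\<lambda>i. \<eta> i \<omega>) (?K j)) j = renorm c (\<lambda>y. \<eta> y \<omega>) j" for j \<omega>
    using c by (intro renorm_cong) auto
  ultimately show ?thesis by (simp add: indep_field_def)
qed

lemma prob_renorm:
  assumes "indep_field \<eta>" "0 < B" "B \<le> 1 / 10 ^ 12"
    and "\<And>i j. 1 / (1 + B * 2 ^ \<xi> i) \<le> prob {\<omega> \<in> space M. \<eta> (i, j) \<omega>}"
    and "block \<xi> (c I) (c (Suc I)) m"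
  shows "1 / (1 + B / 2 * 2 ^ m) \<le> prob {\<omega> \<in> space M. renorm c (\<lambda>y. \<eta> y \<omega>) (I, J)}"
proof (cases "even (int I + J)")
  case True
  then show ?thesis using prob_good[OF assms, of "40 * J"] by (simp add: renorm_def)
next
  case False
  have "1 / (1 + B / 2 * 2 ^ m) \<le> 1" using assms(2) by (simp add: divide_simps add_pos_nonneg)
  then show ?thesis using False by (simp add: renorm_def prob_space)
qed

end

text \<open>\<open>\<xi> k\<close> is the environment on scale \<open>k\<close> and
  \<open>c k\<close> lists the block boundaries in it. The condition \<open>\<xi> k 0 = 0\<close>
  keeps the odds against the origin at \<open>B / 2 ^ k\<close>.\<close>

definition ladder :: "(nat \<Rightarrow> nat \<Rightarrow> nat) \<Rightarrow> (nat \<Rightarrow> nat \<Rightarrow> nat) \<Rightarrow> bool" where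
  "ladder \<xi> c \<longleftrightarrow> (\<forall>k. c k 0 = 0 \<and> \<xi> k 0 = 0 \<and> (\<forall>I. block (\<xi> k) (c k I) (c k (Suc I)) (\<xi> (Suc k) I)))"

lemma block_length: "block \<xi> s t m \<Longrightarrow> s + 100 \<le> t"
  by (auto simp: block_def)

text \<open>The bound is uniform in \<open>n\<close>. If the origin is open on the scales up to
  \<open>n\<close>, the one-site path on scale \<open>n\<close> is refined scale by scale with
  \<open>open_path_renorm\<close>, and each refinement lengthens it by at least one column.\<close>

lemma (in prob_space) prob_path_ge:
  fixes \<eta>0 :: "nat \<times> int \<Rightarrow> 'a \<Rightarrow> bool"
  assumes ind: "indep_field \<eta>0" and B: "0 < B" "B \<le> 1 / 10 ^ 12"
    and g: "\<And>i j. 1 / (1 + B * 2 ^ \<xi> 0 i) \<le> prob {\<omega> \<in> space M. \<eta>0 (i, j) \<omega>}"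
    and lad: "ladder \<xi> c"
  shows "1 - 2 * B \<le> prob {\<omega> \<in> space M. \<exists>w. open_path (\<lambda>x. \<eta>0 x \<omega>) 0 0 n w}"
proof -
  define H where "H = rec_nat \<eta>0 (\<lambda>k \<eta> x \<omega>. renorm (c k) (\<lambda>y. \<eta> y \<omega>) x)"
  have H: "H 0 = \<eta>0" "\<And>k. H (Suc k) = (\<lambda>x \<omega>. renorm (c k) (\<lambda>y. H k y \<omega>) x)" by (auto simp: H_def)
  have c0: "c k 0 = 0" and \<xi>0: "\<xi> k 0 = 0" and bl: "block (\<xi> k) (c k I) (c k (Suc I)) (\<xi> (Suc k) I)" for k I
    using lad unfolding ladder_def by blast+
  have cI: "c k I + 100 \<le> c k (Suc I)" for k I using bl by (rule block_length)
  have cl: "c k I < c k (Suc I)" for k I using cI[of k I] by linarith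
  have cn: "n + 1 \<le> c k (Suc n) - 1" for k n
  proof (induction n)
    case 0 show ?case using cI[of k 0] c0 by simp
  next
    case (Suc n) then show ?case using cI[of k "Suc n"] by linarith
  qed
  have Bk: "0 < B / 2 ^ k" "B / 2 ^ k \<le> 1 / 10 ^ 12" for k
  proof -
    have "B / 2 ^ k \<le> B / 1" using B by (intro divide_left_mono) auto
    then show "B / 2 ^ k \<le> 1 / 10 ^ 12" using B(2) by linarith
  qed (use B in auto)
  have inv: "indep_field (H k) \<and> (\<forall>i j. 1 / (1 + B / 2 ^ k * 2 ^ \<xi> k i) \<le> prob {\<omega> \<in> space M. H k (i, j) \<omega>})" for k
  proof (induction k)
    case 0 then show ?case using ind g by (simp add: H)
  next
    case (Suc k)
    have "indep_field (H (Suc k))"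
      unfolding H using Suc.IH cl by (intro indep_field_renorm) auto
    moreover have "1 / (1 + B / 2 ^ k / 2 * 2 ^ \<xi> (Suc k) i) \<le> prob {\<omega> \<in> space M. H (Suc k) (i, j) \<omega>}" for i j
      unfolding H using Suc.IH Bk bl by (intro prob_renorm[where \<xi> = "\<xi> k"]) auto
    ultimately show ?case by (simp add: mult.commute)
  qed
  have [measurable]: "Measurable.pred M (H k x)" for k x
    using inv[of k] by (intro indep_field_measurable) auto
  let ?N = "\<lambda>k. {\<omega> \<in> space M. \<not> H k (0, 0) \<omega>}"
  have N: "prob (?N k) \<le> B * (1/2) ^ k" for k
  proof -
    have "1 / (1 + B / 2 ^ k) \<le> prob {\<omega> \<in> space M. H k (0, 0) \<omega>}"
      using inv[of k] \<xi>0[of k] by (metis mult.right_neutral power_0)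
    moreover have "1 - B / 2 ^ k \<le> 1 / (1 + B / 2 ^ k)" using Bk[of k] by (simp add: field_simps)
    ultimately show ?thesis using inv[of k] by (simp add: prob_Not power_one_over)
  qed
  have "prob (\<Union>k\<le>n. ?N k) \<le> (\<Sum>k\<le>n. prob (?N k))"
    by (intro finite_measure_subadditive_finite) auto
  also have "\<dots> \<le> (\<Sum>k\<le>n. B * (1/2) ^ k)" by (intro sum_mono N)
  also have "\<dots> = B * (\<Sum>k<Suc n. (1/2) ^ k)" by (simp add: sum_distrib_left lessThan_Suc_atMost)
  also have "\<dots> \<le> B * 2"
  proof -
    have "(\<Sum>k<m. (1/2) ^ k) = 2 - 2 * (1/2 :: real) ^ m" for m by (induction m) auto
    then show ?thesis using B by (intro mult_left_mono) auto
  qed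
  finally have "prob (\<Union>k\<le>n. ?N k) \<le> 2 * B" by simp
  moreover have "prob (space M - (\<Union>k\<le>n. ?N k)) = 1 - prob (\<Union>k\<le>n. ?N k)"
    by (intro prob_compl) auto
  moreover have "prob (space M - (\<Union>k\<le>n. ?N k)) \<le> prob {\<omega> \<in> space M. \<exists>w. open_path (\<lambda>x. \<eta>0 x \<omega>) 0 0 n w}"
  proof (rule finite_measure_mono)
    show "space M - (\<Union>k\<le>n. ?N k) \<subseteq> {\<omega> \<in> space M. \<exists>w. open_path (\<lambda>x. \<eta>0 x \<omega>) 0 0 n w}"
    proof safe
      fix \<omega> assume \<omega>: "\<omega> \<in> space M" "\<omega> \<notin> (\<Union>k\<le>n. ?N k)"
      then have op: "H k (0, 0) \<omega>" if "k \<le> n" for k using that by auto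
      have "\<exists>l\<ge>d. \<exists>w. open_path (\<lambda>x. H (n - d) x \<omega>) 0 0 l w" if "d \<le> n" for d
        using that
      proof (induction d)
        case 0
        then show ?case using op[of n] by (intro exI[of _ 0]) (auto intro: open_path.base)
      next
        case (Suc d)
        then obtain l w where l: "d \<le> l" "open_path (\<lambda>x. H (n - d) x \<omega>) 0 0 l w" by auto
        have nd: "n - d = Suc (n - Suc d)" using Suc.prems by simp
        have "\<exists>w. open_path (\<lambda>x. H (n - Suc d) x \<omega>) 0 0 (c (n - Suc d) (Suc l) - 1) w"
        proof (rule open_path_renorm)
          show "open_path (renorm (c (n - Suc d)) (\<lambda>x. H (n - Suc d) x \<omega>)) 0 0 l w"
            using l(2) unfolding nd H(2) .
        qed (use c0 cl op in auto)
        moreover have "Suc d \<le> c (n - Suc d) (Suc l) - 1" using cn[of l "n - Suc d"] l(1) by linarith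
        ultimately show ?case by blast
      qed
      from this[of n] obtain l w where "n \<le> l" "open_path (\<lambda>x. \<eta>0 x \<omega>) 0 0 l w" by (auto simp: H)
      then show "\<exists>w. open_path (\<lambda>x. \<eta>0 x \<omega>) 0 0 n w" by (intro open_path_prefix) auto
    qed
    have [measurable]: "Measurable.pred M (\<eta>0 x)" for x using ind by (rule indep_field_measurable)
    note [measurable] = pred_path[of \<eta>0 M]
    show "{\<omega> \<in> space M. \<exists>w. open_path (\<lambda>x. \<eta>0 x \<omega>) 0 0 n w} \<in> events" by measurable
  qed
  ultimately show ?thesis by linarith
qed


section \<open>Renormalisation of the environment\<close>

abbreviation SQ :: "(nat \<Rightarrow> nat) measure" where
  "SQ \<equiv> PiM UNIV (\<lambda>_. count_space UNIV)"

definition seq_drop :: "nat \<Rightarrow> (nat \<Rightarrow> 'b) \<Rightarrow> nat \<Rightarrow> 'b" where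
  "seq_drop n t = (\<lambda>i. t (n + i))"

definition zrun :: "nat \<Rightarrow> (nat \<Rightarrow> nat) \<Rightarrow> bool" where
  "zrun n t \<longleftrightarrow> (\<forall>i<100. t (n + i) = 0)"

text \<open>The columns before the first run form the word of a block. Without any run
  \<open>LEAST\<close> is meaningless, hence the recurring premise
  \<open>\<exists>n. zrun n t\<close>, which holds almost surely.\<close>

definition first_zrun :: "(nat \<Rightarrow> nat) \<Rightarrow> nat" where
  "first_zrun t = (LEAST n. zrun n t)"

definition wsum :: "(nat \<Rightarrow> nat) \<Rightarrow> nat" where
  "wsum t = (\<Sum>i<first_zrun t. t i)"

definition nbad :: "(nat \<Rightarrow> nat) \<Rightarrow> nat" where
  "nbad t = card {i. i < first_zrun t \<and> t i \<noteq> 0}"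

text \<open>A block with \<open>n \<ge> 2\<close> bad columns has length at most \<open>100 (n + 1) \<le> 150 n\<close>, and \<open>12300 = 82 * 150\<close>.\<close>

definition cost :: "(nat \<Rightarrow> nat) \<Rightarrow> nat" where
  "cost t = (if nbad t \<le> 1 then wsum t - 1 else wsum t + 12300 * nbad t)"

text \<open>Here the cuts are at the ends of the runs, so that each cut is a stopping time and the
  sequence behind it is fresh. The shift by 50 in \<open>block_cut\<close> moves them to the
  middle.\<close>

primrec block_start :: "(nat \<Rightarrow> nat) \<Rightarrow> nat \<Rightarrow> nat" where
  "block_start t 0 = 0"
| "block_start t (Suc I) = block_start t I + (first_zrun (seq_drop (block_start t I) t) + 100)"

definition word_costs :: "(nat \<Rightarrow> nat) \<Rightarrow> nat \<Rightarrow> nat" where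
  "word_costs t I = cost (seq_drop (block_start t I) t)"

lemma seq_drop_0 [simp]: "seq_drop 0 t = t" by (simp add: seq_drop_def)

lemma seq_drop_shift: "seq_drop m (seq_drop n t) = seq_drop (n + m) t"
  by (simp add: seq_drop_def add.assoc)

lemma seq_drop_apply: "seq_drop n t i = t (n + i)" by (simp add: seq_drop_def)

lemma zrun_shift: "zrun m (seq_drop n t) \<longleftrightarrow> zrun (n + m) t"
  by (simp add: zrun_def seq_drop_def add.assoc)

text \<open>The definition adds blocks at the end; induction with the Markov property has to peel
  off the first block instead.\<close>

lemma block_start_Suc: "block_start t (Suc I) = (first_zrun t + 100) + block_start (seq_drop (first_zrun t + 100) t) I"
proof (induction I)
  case (Suc I)
  have "block_start t (Suc (Suc I)) = block_start t (Suc I) + (first_zrun (seq_drop (block_start t (Suc I)) t) + 100)"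
    by (rule block_start.simps(2))
  then show ?case unfolding Suc.IH by (simp add: seq_drop_shift)
qed simp

lemma word_costs_0: "word_costs t 0 = cost t" by (simp add: word_costs_def)

lemma word_costs_Suc: "word_costs t (Suc I) = word_costs (seq_drop (first_zrun t + 100) t) I"
  by (simp only: word_costs_def block_start_Suc seq_drop_shift)

lemma zrun_tau: "\<exists>n. zrun n t \<Longrightarrow> zrun (first_zrun t) t"
  unfolding first_zrun_def by (rule LeastI_ex)

lemma first_zrun_le: "zrun n t \<Longrightarrow> first_zrun t \<le> n"
  unfolding first_zrun_def by (rule Least_le)

lemma nbad_0:
  assumes "\<exists>n. zrun n t" "nbad t = 0"
  shows "first_zrun t = 0" "wsum t = 0" "t 0 = 0"
proof -
  have z: "t i = 0" if "i < first_zrun t" for i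
    using assms(2) that by (auto simp: nbad_def)
  have "t i = 0" if "i < first_zrun t + 100" for i
  proof (cases "i < first_zrun t")
    case False
    then obtain d where "i = first_zrun t + d" using le_Suc_ex not_less by blast
    then show ?thesis using zrun_tau[OF assms(1)] that by (auto simp: zrun_def)
  qed (rule z)
  then have "zrun 0 t" by (auto simp: zrun_def)
  then show "first_zrun t = 0" using first_zrun_le by auto
  then show "wsum t = 0" by (simp add: wsum_def)
  show "t 0 = 0" using \<open>zrun 0 t\<close> by (auto simp: zrun_def dest: spec[of _ 0])
qed

text \<open>The first bad column comes within 100 columns, as otherwise a run would start at 0.
  Behind it the word continues up to the same run, so facts about words follow by induction on
  \<open>nbad\<close>.\<close>

lemma nbad_Suc:
  assumes ex: "\<exists>n. zrun n t" and n: "nbad t = Suc n"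
  obtains g where "g < 100" "t g \<noteq> 0" "\<And>i. i < g \<Longrightarrow> t i = 0"
    "wsum t = t g + wsum (seq_drop (Suc g) t)" "nbad (seq_drop (Suc g) t) = n"
    "first_zrun t = Suc g + first_zrun (seq_drop (Suc g) t)" "\<exists>n. zrun n (seq_drop (Suc g) t)"
proof -
  have "{i. i < first_zrun t \<and> t i \<noteq> 0} \<noteq> {}" using n unfolding nbad_def by (metis card.empty nat.distinct(1))
  then obtain i0 where i0: "i0 < first_zrun t" "t i0 \<noteq> 0" by auto
  define g where "g = (LEAST i. t i \<noteq> 0)"
  have g: "t g \<noteq> 0" unfolding g_def using i0(2) by (rule LeastI)
  have g0: "t i = 0" if "i < g" for i using that not_less_Least unfolding g_def by blast
  have gt: "g < first_zrun t" using Least_le[of "\<lambda>i. t i \<noteq> 0", OF i0(2)] i0(1) unfolding g_def by simp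
  have g100: "g < 100"
  proof (rule ccontr)
    assume "\<not> g < 100"
    then have "zrun 0 t" using g0 by (auto simp: zrun_def)
    then show False using first_zrun_le[of 0 t] gt by auto
  qed
  let ?u = "seq_drop (Suc g) t"
  have ru: "zrun (first_zrun t - Suc g) ?u" using zrun_tau[OF ex] gt by (simp add: zrun_shift)
  then have ex': "\<exists>n. zrun n ?u" by blast
  have "first_zrun t \<le> Suc g + first_zrun ?u" using zrun_tau[OF ex'] by (intro first_zrun_le) (simp add: zrun_shift)
  moreover have "first_zrun ?u \<le> first_zrun t - Suc g" using ru by (rule first_zrun_le)
  ultimately have first_zrun: "first_zrun t = Suc g + first_zrun ?u" using gt by linarith
  have set: "{..<first_zrun t} = {..<g} \<union> ({g} \<union> (\<lambda>i. Suc g + i) ` {..<first_zrun ?u})"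
  proof (intro set_eqI iffI)
    fix i assume "i \<in> {..<first_zrun t}"
    then consider "i < g" | "i = g" | d where "i = Suc g + d" "d < first_zrun ?u"
      using first_zrun by (metis add_less_cancel_left lessThan_iff less_imp_Suc_add linorder_neqE_nat add_Suc)
    then show "i \<in> {..<g} \<union> ({g} \<union> (\<lambda>i. Suc g + i) ` {..<first_zrun ?u})" by cases auto
  qed (use first_zrun in auto)
  have "wsum t = (\<Sum>i<g. t i) + (\<Sum>i\<in>{g} \<union> (\<lambda>i. Suc g + i) ` {..<first_zrun ?u}. t i)"
    unfolding wsum_def set by (rule sum.union_disjoint) auto
  also have "(\<Sum>i\<in>{g} \<union> (\<lambda>i. Suc g + i) ` {..<first_zrun ?u}. t i) = t g + (\<Sum>i\<in>(\<lambda>i. Suc g + i) ` {..<first_zrun ?u}. t i)"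
    by (subst sum.union_disjoint) auto
  also have "(\<Sum>i\<in>(\<lambda>i. Suc g + i) ` {..<first_zrun ?u}. t i) = wsum ?u"
    by (subst sum.reindex) (auto simp: inj_on_def wsum_def seq_drop_def)
  finally have ws: "wsum t = t g + wsum ?u" using g0 by simp
  have "{i. i < first_zrun t \<and> t i \<noteq> 0} = insert g ((\<lambda>i. Suc g + i) ` {i. i < first_zrun ?u \<and> ?u i \<noteq> 0})" (is "?A = ?B")
  proof (intro set_eqI)
    fix i
    have "i \<in> ?A \<longleftrightarrow> i \<in> {..<first_zrun t} \<and> t i \<noteq> 0" by simp
    also have "\<dots> \<longleftrightarrow> i \<in> ?B" unfolding set using g g0 by (auto simp: seq_drop_def)
    finally show "i \<in> ?A \<longleftrightarrow> i \<in> ?B" .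
  qed
  moreover have "card ?B = Suc (nbad ?u)"
    unfolding nbad_def by (subst card_insert_disjoint) (auto simp: card_image inj_on_def)
  ultimately have "nbad ?u = n" using n by (simp add: nbad_def)
  then show thesis using that g100 g g0 ws first_zrun ex' by blast
qed

lemma first_zrun_le_nbad: "\<exists>n. zrun n t \<Longrightarrow> nbad t = n \<Longrightarrow> first_zrun t \<le> 100 * n"
proof (induction n arbitrary: t)
  case 0 then show ?case using nbad_0 by auto
next
  case (Suc n)
  obtain g where "g < 100" "nbad (seq_drop (Suc g) t) = n"
    "first_zrun t = Suc g + first_zrun (seq_drop (Suc g) t)" "\<exists>n. zrun n (seq_drop (Suc g) t)"
    using nbad_Suc[OF Suc.prems] by metis
  then show ?case using Suc.IH[of "seq_drop (Suc g) t"] by auto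
qed

text \<open>A boundary computed in \<open>seq_drop 50 x\<close> is read as a position in
  \<open>x\<close>, hence lies 50 columns before the end of a run. Before the first block there is
  no run; the hypothesis \<open>z\<close> takes its place.\<close>

lemma block_cut:
  assumes z: "\<And>i. i < 50 \<Longrightarrow> x i = 0" and runs: "\<And>n. \<exists>m. zrun m (seq_drop n x)"
  shows "block x (block_start (seq_drop 50 x) I) (block_start (seq_drop 50 x) (Suc I)) (word_costs (seq_drop 50 x) I)"
proof -
  define s where "s = block_start (seq_drop 50 x) I"
  define v where "v = seq_drop (50 + s) x"
  have v: "v i = x (50 + s + i)" for i by (simp add: v_def seq_drop_def)
  have ex: "\<exists>m. zrun m v" unfolding v_def by (rule runs)
  have e: "block_start (seq_drop 50 x) (Suc I) = s + first_zrun v + 100"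
    by (simp add: s_def v_def seq_drop_shift)
  have w: "word_costs (seq_drop 50 x) I = cost v" by (simp add: word_costs_def s_def v_def seq_drop_shift)
  \<comment> \<open>The second half of the run that ends the previous block.\<close>
  have pre: "x i = 0" if "s \<le> i" "i < s + 50" for i
  proof (cases I)
    case 0
    then show ?thesis using z that by (simp add: s_def)
  next
    case (Suc I')
    define v' where "v' = seq_drop (50 + block_start (seq_drop 50 x) I') x"
    have "\<exists>m. zrun m v'" unfolding v'_def by (rule runs)
    from zrun_tau[OF this] have r: "zrun (50 + block_start (seq_drop 50 x) I' + first_zrun v') x"
      by (simp add: v'_def zrun_shift)
    have s: "s = block_start (seq_drop 50 x) I' + first_zrun v' + 100" by (simp add: s_def Suc v'_def seq_drop_shift)
    define d where "d = i - (50 + block_start (seq_drop 50 x) I' + first_zrun v')"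
    have "i = 50 + block_start (seq_drop 50 x) I' + first_zrun v' + d" "d < 100" using that s by (auto simp: d_def)
    then show ?thesis using r by (auto simp: zrun_def)
  qed
  \<comment> \<open>The first half of the run that ends this block.\<close>
  have post: "x i = 0" if "s + 50 + first_zrun v \<le> i" "i < s + first_zrun v + 100" for i
  proof -
    define d where "d = i - (50 + s + first_zrun v)"
    have "i = 50 + s + first_zrun v + d" "d < 100" using that by (auto simp: d_def)
    then show ?thesis using zrun_tau[OF ex] by (auto simp: zrun_def v add.assoc)
  qed
  consider "nbad v = 0" | "nbad v = Suc 0" | "2 \<le> nbad v" by linarith
  then show ?thesis
  proof cases
    case 1
    note nb = nbad_0[OF ex 1]
    show ?thesis unfolding block_def e w s_def[symmetric]
    proof (intro exI conjI)
      \<comment> \<open>Without a bad column, an arbitrary good column serves as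
        \<open>a = b\<close>.\<close>
      show "s + 50 \<le> s + 50" "s + 50 \<le> s + 50" "s + 50 + 50 \<le> s + first_zrun v + 100" by auto
      show "\<forall>i. s \<le> i \<and> i < s + first_zrun v + 100 \<and> i \<notin> {s + 50..s + 50} \<longrightarrow> x i = 0"
        using pre post nb by (metis add.right_neutral not_less)
      have "x (s + 50) = 0" using nb v[of 0] by (simp add: add.commute)
      then show "s + 50 = s + 50 \<and> s + first_zrun v + 100 \<le> s + 200 \<and> x (s + 50) \<le> cost v + 1 \<or>
          sum x {s + 50..s + 50} + 82 * (s + first_zrun v + 100 - s) \<le> cost v"
        using nb by auto
    qed
  next
    case 2
    obtain g where g: "g < 100" "v g \<noteq> 0" "\<And>i. i < g \<Longrightarrow> v i = 0"
      "wsum v = v g + wsum (seq_drop (Suc g) v)" "nbad (seq_drop (Suc g) v) = 0"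
      "first_zrun v = Suc g + first_zrun (seq_drop (Suc g) v)" "\<exists>n. zrun n (seq_drop (Suc g) v)"
      using nbad_Suc[OF ex 2] by metis
    note nb = nbad_0[OF g(7) g(5)]
    have tg: "first_zrun v = Suc g" using g(6) nb by simp
    have cv: "cost v = v g - 1" using 2 g(4) nb by (simp add: cost_def)
    show ?thesis unfolding block_def e w s_def[symmetric]
    proof (intro exI conjI)
      \<comment> \<open>The lone bad column. As \<open>first_zrun v = g + 1 \<le> 100\<close>, the
        block has at most 200 columns.\<close>
      show "s + 50 \<le> s + 50 + g" "s + 50 + g \<le> s + 50 + g" "s + 50 + g + 50 \<le> s + first_zrun v + 100"
        using tg by auto
      show "\<forall>i. s \<le> i \<and> i < s + first_zrun v + 100 \<and> i \<notin> {s + 50 + g..s + 50 + g} \<longrightarrow> x i = 0"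
      proof (intro allI impI)
        fix i assume i: "s \<le> i \<and> i < s + first_zrun v + 100 \<and> i \<notin> {s + 50 + g..s + 50 + g}"
        show "x i = 0"
        proof (cases "i < s + 50")
          case False
          show ?thesis
          proof (cases "i < s + 50 + g")
            case True
            then show ?thesis using g(3)[of "i - (50 + s)"] v[of "i - (50 + s)"] False by simp
          next
            case False
            then show ?thesis using post i tg by auto
          qed
        qed (use pre i in auto)
      qed
      show "s + 50 + g = s + 50 + g \<and> s + first_zrun v + 100 \<le> s + 200 \<and> x (s + 50 + g) \<le> cost v + 1 \<or>
          sum x {s + 50 + g..s + 50 + g} + 82 * (s + first_zrun v + 100 - s) \<le> cost v"
      proof -
        have "x (s + 50 + g) = v g" by (simp add: v ac_simps)
        then show ?thesis using tg g(1) cv by linarith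
      qed
    qed
  next
    case 3
    have tn: "first_zrun v \<le> 100 * nbad v" by (rule first_zrun_le_nbad[OF ex refl])
    have t0: "0 < first_zrun v"
    proof (rule ccontr)
      assume "\<not> 0 < first_zrun v"
      then have "nbad v = 0" by (simp add: nbad_def)
      then show False using 3 by simp
    qed
    show ?thesis unfolding block_def e w s_def[symmetric]
    proof (intro exI conjI)
      \<comment> \<open>Here \<open>a..b\<close> is the whole word.\<close>
      show "s + 50 \<le> s + 50" "s + 50 \<le> s + 50 + (first_zrun v - 1)" "s + 50 + (first_zrun v - 1) + 50 \<le> s + first_zrun v + 100"
        using t0 by auto
      show "\<forall>i. s \<le> i \<and> i < s + first_zrun v + 100 \<and> i \<notin> {s + 50..s + 50 + (first_zrun v - 1)} \<longrightarrow> x i = 0"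
        using pre post t0 by auto
      have "sum x {s + 50..s + 50 + (first_zrun v - 1)} = sum x ((\<lambda>i. 50 + s + i) ` {..<first_zrun v})"
      proof (rule sum.cong[OF _ refl])
        have "(\<lambda>i. 50 + s + i) ` {..<first_zrun v} = (\<lambda>i. (50 + s) + i) ` {0..<first_zrun v}"
          by (simp add: atLeast0LessThan)
        also have "\<dots> = {50 + s..<50 + s + first_zrun v}" by (simp add: add.commute)
        finally show "{s + 50..s + 50 + (first_zrun v - 1)} = (\<lambda>i. 50 + s + i) ` {..<first_zrun v}"
          using t0 by auto
      qed
      also have "\<dots> = wsum v" by (subst sum.reindex) (auto simp: inj_on_def wsum_def v)
      finally show "s + 50 = s + 50 + (first_zrun v - 1) \<and> s + first_zrun v + 100 \<le> s + 200 \<and> x (s + 50) \<le> cost v + 1 \<or>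
          sum x {s + 50..s + 50 + (first_zrun v - 1)} + 82 * (s + first_zrun v + 100 - s) \<le> cost v"
        using tn 3 by (simp add: cost_def)
    qed
  qed
qed


section \<open>Law of the renormalised environment\<close>

lemma measurable_SQ_apply [measurable]: "(\<lambda>t. t i) \<in> SQ \<rightarrow>\<^sub>M count_space UNIV"
  by (rule measurable_component_singleton) simp

lemma measurable_shift_SQ [measurable]: "seq_drop n \<in> SQ \<rightarrow>\<^sub>M SQ"
  by (rule measurable_PiM_single') (auto simp: seq_drop_def intro!: measurable_SQ_apply)

lemma pred_zrun [measurable]: "Measurable.pred SQ (zrun n)"
  unfolding zrun_def by measurable

lemma measurable_tau [measurable]: "first_zrun \<in> SQ \<rightarrow>\<^sub>M count_space UNIV"
  unfolding first_zrun_def by measurable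

lemma measurable_wsum [measurable]: "wsum \<in> SQ \<rightarrow>\<^sub>M count_space UNIV"
  unfolding wsum_def
  by (rule measurable_compose_countable[OF _ measurable_tau, where f = "\<lambda>n t. \<Sum>i<n. t i"]) measurable

lemma measurable_nbad [measurable]: "nbad \<in> SQ \<rightarrow>\<^sub>M count_space UNIV"
proof -
  have "nbad = (\<lambda>t. \<Sum>i<first_zrun t. if t i \<noteq> 0 then 1 else 0)"
    by (auto simp: nbad_def fun_eq_iff sum.If_cases Int_def lessThan_def)
  moreover have "(\<lambda>t. \<Sum>i<first_zrun t. if t i \<noteq> 0 then 1 else (0::nat)) \<in> SQ \<rightarrow>\<^sub>M count_space UNIV"
    by (rule measurable_compose_countable[OF _ measurable_tau,
          where f = "\<lambda>n t. \<Sum>i<n. if t i \<noteq> 0 then 1 else (0::nat)"]) measurable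
  ultimately show ?thesis by simp
qed

lemma measurable_count2:
  fixes f g :: "'b \<Rightarrow> nat"
  assumes "f \<in> M \<rightarrow>\<^sub>M count_space UNIV" "g \<in> M \<rightarrow>\<^sub>M count_space UNIV"
  shows "(\<lambda>x. h (f x) (g x)) \<in> M \<rightarrow>\<^sub>M count_space UNIV"
  by (rule measurable_compose_countable[where f = "\<lambda>n x. h (f x) n", OF _ assms(2)],
      rule measurable_compose[OF assms(1)]) simp

lemma measurable_cost [measurable]: "cost \<in> SQ \<rightarrow>\<^sub>M count_space UNIV"
proof -
  let ?h = "\<lambda>s n. if n \<le> 1 then s - 1 else s + 12300 * n :: nat"
  have eq: "cost = (\<lambda>t. ?h (wsum t) (nbad t))" by (rule ext) (simp only: cost_def)
  show ?thesis
    unfolding eq by (rule measurable_count2[where h = ?h, OF measurable_wsum measurable_nbad])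
qed

lemma measurable_shift_random:
  assumes "f \<in> SQ \<rightarrow>\<^sub>M count_space UNIV"
  shows "(\<lambda>t. seq_drop (f t) t) \<in> SQ \<rightarrow>\<^sub>M SQ"
  by (rule measurable_compose_countable[OF _ assms, where f = "\<lambda>n t. seq_drop n t"]) measurable

lemma measurable_cut [measurable]: "(\<lambda>t. block_start t I) \<in> SQ \<rightarrow>\<^sub>M count_space UNIV"
proof (induction I)
  case (Suc I)
  show ?case unfolding block_start.simps
    using measurable_count2[OF Suc measurable_compose[OF measurable_shift_random[OF Suc] measurable_tau],
        of "\<lambda>a b. a + (b + 100)"] by simp
qed simp

lemma measurable_words [measurable]: "word_costs \<in> SQ \<rightarrow>\<^sub>M SQ"
proof (rule measurable_PiM_single')
  fix I :: nat
  show "(\<lambda>t. word_costs t I) \<in> SQ \<rightarrow>\<^sub>M count_space UNIV"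
    unfolding word_costs_def
    by (rule measurable_compose[OF measurable_shift_random[OF measurable_cut] measurable_cost])
qed auto

lemma cylinder_in_sets: "{t. \<forall>i<n. t i \<in> F i} \<in> sets SQ"
proof (induction n)
  case 0 show ?case using sets.top[of SQ] by (simp add: space_PiM)
next
  case (Suc n)
  have "{t. t n \<in> F n} \<in> sets SQ"
    using measurable_sets[OF measurable_SQ_apply, of "F n" n] by (simp add: space_PiM vimage_def)
  with Suc have "{t. \<forall>i<n. t i \<in> F i} \<inter> {t. t n \<in> F n} \<in> sets SQ" by (rule sets.Int)
  also have "{t. \<forall>i<n. t i \<in> F i} \<inter> {t. t n \<in> F n} = {t. \<forall>i<Suc n. t i \<in> F i}"
    by (auto simp: less_Suc_eq)
  finally show ?case .
qed

section \<open>I.i.d. sequences and the Markov property at the end of a block\<close>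

locale nat_iid =
  fixes N :: "nat measure"
  assumes prob_N: "prob_space N" and sets_N [measurable_cong, simp]: "sets N = UNIV"
begin

sublocale sequence_space N
proof -
  interpret prob_space N by (rule prob_N)
  show "sequence_space N" by unfold_locales
qed

lemma space_N [simp]: "space N = UNIV"
  using sets_eq_imp_space_eq[of N "count_space UNIV"] by simp

lemma sets_S [measurable_cong]: "sets S = sets SQ"
  by (rule sets_PiM_cong) auto

lemma space_S [simp]: "space S = UNIV"
  by (simp add: space_PiM)

text \<open>The first \<open>n\<close> terms of one sample followed by a second independent sample
  have the same law again (\<open>PiM_comb_seq\<close>). Then \<open>f\<close> sees only the first
  sample and \<open>g\<close> only the second, and Fubini applies.\<close>

lemma nn_split:
  assumes f [measurable]: "f \<in> borel_measurable SQ" and g [measurable]: "g \<in> borel_measurable SQ"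
    and dep: "\<And>t t'. (\<And>i. i < n \<Longrightarrow> t i = t' i) \<Longrightarrow> f t = f t'"
  shows "(\<integral>\<^sup>+t. f t * g (seq_drop n t) \<partial>S) = (\<integral>\<^sup>+t. f t \<partial>S) * (\<integral>\<^sup>+t. g t \<partial>S)"
proof -
  have sh: "seq_drop n (comb_seq n t t') = t'" for t t' :: "nat \<Rightarrow> nat"
    by (rule ext) (simp add: seq_drop_def comb_seq_def)
  have fc: "f (comb_seq n t t') = f t" for t t'
    by (rule dep) (simp add: comb_seq_def)
  have [measurable]: "f \<in> borel_measurable S" "g \<in> borel_measurable S" "seq_drop n \<in> S \<rightarrow>\<^sub>M S"
    using f g measurable_shift_SQ[of n] by (simp_all cong: measurable_cong_sets add: sets_S)
  have "(\<integral>\<^sup>+t. f t * g (seq_drop n t) \<partial>S) =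
      (\<integral>\<^sup>+t. f t * g (seq_drop n t) \<partial>distr (S \<Otimes>\<^sub>M S) S (\<lambda>(\<omega>, \<omega>'). comb_seq n \<omega> \<omega>'))"
    by (simp only: PiM_comb_seq)
  also have "\<dots> = (\<integral>\<^sup>+p. f (fst p) * g (snd p) \<partial>(S \<Otimes>\<^sub>M S))"
    by (subst nn_integral_distr[OF measurable_comb_seq]) (auto simp: sh fc split_beta' intro!: nn_integral_cong)
  also have "\<dots> = (\<integral>\<^sup>+t. \<integral>\<^sup>+t'. f t * g t' \<partial>S \<partial>S)"
    by (subst P.nn_integral_fst[symmetric]) auto
  also have "\<dots> = (\<integral>\<^sup>+t. f t \<partial>S) * (\<integral>\<^sup>+t. g t \<partial>S)"
    by (simp add: nn_integral_cmult nn_integral_multc)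
  finally show ?thesis .
qed

lemma measurable_pred_S: "Measurable.pred SQ P \<Longrightarrow> {t. P t} \<in> sets S"
  by (simp add: sets_S pred_def space_PiM)

lemma emeasure_split:
  assumes P: "Measurable.pred SQ P" and A: "A \<in> sets SQ"
    and dep: "\<And>t t'. (\<And>i. i < n \<Longrightarrow> t i = t' i) \<Longrightarrow> P t = P t'"
  shows "emeasure S {t. P t \<and> seq_drop n t \<in> A} = emeasure S {t. P t} * emeasure S A"
proof -
  note [measurable] = P A
  have "{t. seq_drop n t \<in> A} = seq_drop n -` A \<inter> space SQ" by (auto simp: space_PiM)
  then have "{t. seq_drop n t \<in> A} \<in> sets S"
    using measurable_sets[OF measurable_shift_SQ A] by (simp add: sets_S)
  then have m: "{t. P t \<and> seq_drop n t \<in> A} \<in> sets S"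
    using measurable_pred_S[OF P] by (simp add: Collect_conj_eq)
  have "(\<integral>\<^sup>+t. indicator {t. P t} t * indicator A (seq_drop n t) \<partial>S) =
     (\<integral>\<^sup>+t. indicator {t. P t} t \<partial>S) * (\<integral>\<^sup>+t. indicator A t \<partial>S)"
  proof (rule nn_split)
    have "{t. P t} \<in> sets SQ" using measurable_pred_S[OF P] by (simp add: sets_S)
    then show "indicator {t. P t} \<in> borel_measurable SQ" by (rule borel_measurable_indicator)
    show "indicator A \<in> borel_measurable SQ" using A by (rule borel_measurable_indicator)
    show "indicator {t. P t} t = (indicator {t. P t} t' :: ennreal)" if "\<And>i. i < n \<Longrightarrow> t i = t' i" for t t'
      using dep[OF that] by (simp add: indicator_def)
  qed
  moreover have "(\<integral>\<^sup>+t. indicator {t. P t} t * indicator A (seq_drop n t) \<partial>S) =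
     (\<integral>\<^sup>+t. indicator {t. P t \<and> seq_drop n t \<in> A} t \<partial>S)"
    by (intro nn_integral_cong) (auto simp: indicator_def)
  ultimately show ?thesis using m measurable_pred_S[OF P] A by (simp add: sets_S)
qed

lemma distr_shift: "distr S S (seq_drop n) = S"
proof (rule measure_eqI)
  fix A assume "A \<in> sets (distr S S (seq_drop n))"
  then have A: "A \<in> sets SQ" by (simp add: sets_S)
  have [measurable]: "seq_drop n \<in> S \<rightarrow>\<^sub>M S"
    using measurable_shift_SQ[of n] by (simp cong: measurable_cong_sets add: sets_S)
  have "emeasure S {t. True \<and> seq_drop n t \<in> A} = emeasure S {t. True} * emeasure S A"
    using A by (intro emeasure_split) auto
  moreover have "emeasure S UNIV = 1" using P.emeasure_space_1 by simp
  ultimately show "emeasure (distr S S (seq_drop n)) A = emeasure S A"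
    using A by (simp add: emeasure_distr sets_S vimage_def)
qed simp

text \<open>The strong Markov property at the stopping time \<open>first_zrun t + 100\<close>: the
  event \<open>Q n\<close> that the first run starts at \<open>n\<close>, with the cost in
  \<open>C\<close>, is decided by the first \<open>n + 100\<close> terms, and what follows is
  independent of it.\<close>

lemma emeasure_markov:
  assumes A: "A \<in> sets SQ"
  shows "emeasure S {t. (\<exists>n. zrun n t) \<and> cost t \<in> C \<and> seq_drop (first_zrun t + 100) t \<in> A} =
     emeasure S {t. (\<exists>n. zrun n t) \<and> cost t \<in> C} * emeasure S A"
proof -
  define Q where "Q n t \<longleftrightarrow> zrun n t \<and> first_zrun t = n \<and> cost t \<in> C" for n t
  have [measurable]: "Measurable.pred SQ (\<lambda>t. cost t \<in> C)"
    by (rule measurable_compose[OF measurable_cost]) simp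
  have Q [measurable]: "Measurable.pred SQ (Q n)" for n unfolding Q_def by measurable
  have dep: "Q n t = Q n t'" if eq: "\<And>i. i < n + 100 \<Longrightarrow> t i = t' i" for n t t'
  proof -
    have *: "Q n t'" if "Q n t" "\<And>i. i < n + 100 \<Longrightarrow> t i = t' i" for t t' :: "nat \<Rightarrow> nat"
    proof -
      have z: "zrun m t' = zrun m t" if "m \<le> n" for m
        unfolding zrun_def using that \<open>\<And>i. i < n + 100 \<Longrightarrow> t i = t' i\<close> by simp
      have zn: "zrun n t'" using z \<open>Q n t\<close> by (simp add: Q_def)
      have "first_zrun t' \<le> n" using zn by (rule first_zrun_le)
      then have "zrun (first_zrun t') t" using z zrun_tau zn by blast
      then have "n \<le> first_zrun t'" using \<open>Q n t\<close> first_zrun_le by (auto simp: Q_def)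
      then have first_zrun: "first_zrun t' = first_zrun t" "first_zrun t' = n" using \<open>first_zrun t' \<le> n\<close> \<open>Q n t\<close> by (auto simp: Q_def)
      have "wsum t' = wsum t" unfolding wsum_def using that(2) first_zrun by (intro sum.cong) auto
      moreover have "nbad t' = nbad t" unfolding nbad_def using that(2) first_zrun
        by (intro arg_cong[where f = card]) auto
      ultimately have "cost t' = cost t" by (simp add: cost_def)
      then show ?thesis using \<open>Q n t\<close> zn first_zrun by (simp add: Q_def)
    qed
    show ?thesis using *[of t t'] *[of t' t] eq by metis
  qed
  have mA: "{t. Q n t \<and> seq_drop (n + 100) t \<in> A} \<in> sets S" for n
  proof -
    have "{t. seq_drop (n + 100) t \<in> A} = seq_drop (n + 100) -` A \<inter> space SQ" by (auto simp: space_PiM)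
    then have "{t. seq_drop (n + 100) t \<in> A} \<in> sets S"
      using measurable_sets[OF measurable_shift_SQ A] by (simp add: sets_S)
    then show ?thesis using measurable_pred_S[OF Q] by (simp add: Collect_conj_eq)
  qed
  have U1: "{t. (\<exists>n. zrun n t) \<and> cost t \<in> C \<and> seq_drop (first_zrun t + 100) t \<in> A} =
      (\<Union>n. {t. Q n t \<and> seq_drop (n + 100) t \<in> A})"
    using zrun_tau by (auto simp: Q_def)
  have U2: "{t. (\<exists>n. zrun n t) \<and> cost t \<in> C} = (\<Union>n. {t. Q n t})"
    using zrun_tau by (auto simp: Q_def)
  have "emeasure S (\<Union>n. {t. Q n t \<and> seq_drop (n + 100) t \<in> A}) =
      (\<Sum>n. emeasure S {t. Q n t \<and> seq_drop (n + 100) t \<in> A})"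
    using mA by (intro suminf_emeasure[symmetric]) (auto simp: disjoint_family_on_def Q_def)
  also have "\<dots> = (\<Sum>n. emeasure S {t. Q n t} * emeasure S A)"
    using A dep by (intro suminf_cong emeasure_split Q) blast+
  also have "\<dots> = (\<Sum>n. emeasure S {t. Q n t}) * emeasure S A" by simp
  also have "(\<Sum>n. emeasure S {t. Q n t}) = emeasure S (\<Union>n. {t. Q n t})"
    using measurable_pred_S[OF Q] by (intro suminf_emeasure) (auto simp: disjoint_family_on_def Q_def)
  finally show ?thesis unfolding U1 U2 .
qed

text \<open>The event that there is no run of zeros is contained in the intersection of its translate with an
  independent event of probability less than 1.\<close>

lemma AE_zrun:
  assumes small: "100 * emeasure N {0<..} < 1"
  shows "AE t in S. \<exists>n. zrun n t"
proof -
  define D where "D = {t. \<forall>n. \<not> zrun n t}"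
  have mD: "D \<in> sets S" unfolding D_def by (rule measurable_pred_S) measurable
  have m0: "{t. \<not> zrun 0 t} \<in> sets S" by (rule measurable_pred_S) measurable
  have "{t. \<not> zrun 0 t} = (\<Union>i<100. {t. t i \<in> {0<..}})" by (auto simp: zrun_def)
  then have "emeasure S {t. \<not> zrun 0 t} = emeasure S (\<Union>i<100. {t. t i \<in> {0<..}})" by simp
  also have "\<dots> \<le> (\<Sum>i<(100::nat). emeasure S {t. t i \<in> {0<..}})"
  proof (rule emeasure_subadditive_finite)
    have "{t. t i \<in> {0<..}} \<in> sets S" for i
      by (rule measurable_pred_S, rule measurable_compose[OF measurable_SQ_apply]) simp
    then show "(\<lambda>i. {t. t i \<in> {0<..}}) ` {..<100} \<subseteq> sets S" by auto
  qed simp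
  also have "\<dots> = (\<Sum>i<(100::nat). emeasure N {0<..})"
    using emeasure_PiM_Collect_single[of _ "{0<..}"] by (intro sum.cong) auto
  also have "\<dots> < 1" using small by simp
  finally have q: "emeasure S {t. \<not> zrun 0 t} < 1" .
  have "emeasure S D \<le> emeasure S {t. \<not> zrun 0 t \<and> seq_drop 100 t \<in> D}"
  proof (rule emeasure_mono)
    show "D \<subseteq> {t. \<not> zrun 0 t \<and> seq_drop 100 t \<in> D}" by (auto simp: D_def zrun_shift)
    have "{t. \<not> zrun 0 t \<and> seq_drop 100 t \<in> D} = {t. \<not> zrun 0 t \<and> (\<forall>n. \<not> zrun (100 + n) t)}"
      by (auto simp: D_def zrun_shift)
    then show "{t. \<not> zrun 0 t \<and> seq_drop 100 t \<in> D} \<in> sets S"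
      by (simp only:) (rule measurable_pred_S, measurable)
  qed
  also have "\<dots> = emeasure S {t. \<not> zrun 0 t} * emeasure S D"
    using mD by (intro emeasure_split) (auto simp: sets_S zrun_def)
  finally have *: "emeasure S D \<le> emeasure S {t. \<not> zrun 0 t} * emeasure S D" .
  have "measure S D \<le> measure S {t. \<not> zrun 0 t} * measure S D"
    using * by (simp add: P.emeasure_eq_measure flip: ennreal_mult)
  moreover have "measure S {t. \<not> zrun 0 t} < 1"
    using q by (simp add: P.emeasure_eq_measure)
  ultimately have "measure S D = 0"
    using mult_strict_right_mono[of "measure S {t. \<not> zrun 0 t}" 1 "measure S D"]
      measure_nonneg[of S D] by linarith
  then have "emeasure S D = 0" by (simp add: P.emeasure_eq_measure)
  then show ?thesis using mD by (auto intro!: AE_I[of _ _ D] simp: D_def)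
qed

lemma AE_zruns:
  assumes small: "100 * emeasure N {0<..} < 1"
  shows "AE t in S. \<forall>m. \<exists>n. zrun n (seq_drop m t)"
proof -
  have "AE t in S. \<exists>n. zrun n (seq_drop m t)" for m
  proof -
    have [measurable]: "seq_drop m \<in> S \<rightarrow>\<^sub>M S"
      using measurable_shift_SQ[of m] by (simp cong: measurable_cong_sets add: sets_S)
    have "AE t in distr S S (seq_drop m). \<exists>n. zrun n t" unfolding distr_shift by (rule AE_zrun[OF small])
    then show ?thesis by (rule AE_distrD[rotated]) measurable
  qed
  then show ?thesis by (simp add: AE_all_countable)
qed

text \<open>The law of one column on the next scale.\<close>

definition N' :: "nat measure" where "N' = distr S (count_space UNIV) cost"

lemma measurable_cost_S [measurable]: "cost \<in> S \<rightarrow>\<^sub>M count_space UNIV"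
  using measurable_cost unfolding measurable_cong_sets[OF sets_S refl] .

lemma nat_iid_N': "nat_iid N'"
  unfolding N'_def by (rule nat_iid.intro) (simp_all add: P.prob_space_distr)

text \<open>Peeling off one block at a time with \<open>emeasure_markov\<close> makes the costs
  independent with law \<open>N'\<close>; cylinders over initial segments determine the product
  measure.\<close>

lemma distr_words:
  assumes small: "100 * emeasure N {0<..} < 1"
  shows "distr S SQ word_costs = PiM UNIV (\<lambda>_. N')"
proof -
  interpret N': nat_iid N' by (rule nat_iid_N')
  have mw [measurable]: "word_costs \<in> S \<rightarrow>\<^sub>M SQ" using measurable_words by (simp cong: measurable_cong_sets add: sets_S)
  have mF: "{t. \<forall>i<n. word_costs t i \<in> F i} \<in> sets SQ" for n and F :: "nat \<Rightarrow> nat set"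
  proof -
    have "{t. \<forall>i<n. word_costs t i \<in> F i} = word_costs -` {t. \<forall>i<n. t i \<in> F i} \<inter> space SQ"
      by (auto simp: space_PiM)
    then show ?thesis by (simp only: measurable_sets[OF measurable_words cylinder_in_sets])
  qed
  have N'F: "emeasure N' C = emeasure S {t. (\<exists>n. zrun n t) \<and> cost t \<in> C}" for C
  proof -
    have c: "{t. cost t \<in> C} \<in> sets S"
      using measurable_sets[OF measurable_cost_S, of C] by (simp add: vimage_def)
    have z: "{t. \<exists>n. zrun n t} \<in> sets S" by (rule measurable_pred_S) measurable
    have "emeasure N' C = emeasure S {t. cost t \<in> C}"
      unfolding N'_def using emeasure_distr[OF measurable_cost_S, of C] by (simp add: vimage_def)
    also have "\<dots> = emeasure S {t. (\<exists>n. zrun n t) \<and> cost t \<in> C}"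
      using c z AE_zrun[OF small] by (intro emeasure_eq_AE) (auto simp: Collect_conj_eq)
    finally show ?thesis .
  qed
  have fin: "emeasure S {t. \<forall>i<n. word_costs t i \<in> F i} = (\<Prod>i<n. emeasure N' (F i))" for n and F :: "nat \<Rightarrow> nat set"
  proof (induction n arbitrary: F)
    case 0 show ?case using P.emeasure_space_1 by simp
  next
    case (Suc n)
    let ?A = "{t. \<forall>i<n. word_costs t i \<in> F (Suc i)}"
    have eq: "(\<forall>i<Suc n. word_costs t i \<in> F i) \<longleftrightarrow> cost t \<in> F 0 \<and> seq_drop (first_zrun t + 100) t \<in> ?A" for t
      by (simp add: word_costs_0 word_costs_Suc All_less_Suc2)
    have "emeasure S {t. \<forall>i<Suc n. word_costs t i \<in> F i} =
       emeasure S {t. (\<exists>n. zrun n t) \<and> cost t \<in> F 0 \<and> seq_drop (first_zrun t + 100) t \<in> ?A}"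
    proof (rule emeasure_eq_AE)
      show 1: "{t. \<forall>i<Suc n. word_costs t i \<in> F i} \<in> sets S" using mF by (simp add: sets_S)
      have "{t. \<exists>n. zrun n t} \<in> sets S" by (rule measurable_pred_S) measurable
      then have "{t. \<exists>n. zrun n t} \<inter> {t. \<forall>i<Suc n. word_costs t i \<in> F i} \<in> sets S" using 1 by (rule sets.Int)
      then show "{t. (\<exists>n. zrun n t) \<and> cost t \<in> F 0 \<and> seq_drop (first_zrun t + 100) t \<in> ?A} \<in> sets S"
        unfolding eq by (simp add: Collect_conj_eq)
    qed (use AE_zrun[OF small] eq in auto)
    also have "\<dots> = emeasure N' (F 0) * emeasure S ?A"
      unfolding N'F by (rule emeasure_markov[OF mF])
    also have "emeasure S ?A = (\<Prod>i<n. emeasure N' (F (Suc i)))" by (rule Suc.IH)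
    finally show ?case by (simp add: prod.lessThan_Suc_shift del: prod.lessThan_Suc)
  qed
  show ?thesis
  proof (rule N'.PiM_eq)
    show "sets (distr S SQ word_costs) = sets (PiM UNIV (\<lambda>_. N'))" by (simp add: N'.sets_S)
    fix J :: "nat set" and F :: "nat \<Rightarrow> nat set" assume J: "finite J"
    obtain n where n: "J \<subseteq> {..<n}" using finite_nat_bounded[OF J] by blast
    \<comment> \<open>Trivial constraints extend \<open>J\<close> to an initial segment.\<close>
    define G where "G i = (if i \<in> J then F i else UNIV)" for i
    have "prod_emb UNIV (\<lambda>_. N') J (Pi\<^sub>E J F) = {t. \<forall>i<n. t i \<in> G i}"
    proof -
      have "i < n" if "i \<in> J" for i using n that by auto
      then show ?thesis by (auto simp: prod_emb_def G_def space_PiM PiE_iff)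
    qed
    moreover have "{t. \<forall>i<n. t i \<in> G i} \<in> sets SQ" by (rule cylinder_in_sets)
    ultimately have "emeasure (distr S SQ word_costs) (prod_emb UNIV (\<lambda>_. N') J (Pi\<^sub>E J F)) =
        emeasure S {t. \<forall>i<n. word_costs t i \<in> G i}"
      by (subst emeasure_distr[OF mw]) (auto simp: vimage_def)
    also have "\<dots> = (\<Prod>i<n. emeasure N' (G i))" by (rule fin)
    also have "\<dots> = (\<Prod>i\<in>J. emeasure N' (G i))"
      using n N'.M.emeasure_space_1 by (intro prod.mono_neutral_right) (auto simp: G_def)
    finally show "emeasure (distr S SQ word_costs) (prod_emb UNIV (\<lambda>_. N') J (Pi\<^sub>E J F)) = (\<Prod>j\<in>J. emeasure N' (F j))"
      by (simp add: G_def)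
  qed
qed

end


section \<open>Exponential moments\<close>

text \<open>The penalty is hidden behind a name because the simplifier would expand \<open>2048 ^ 12300\<close>.\<close>

definition pen :: nat where "pen = 12300"

text \<open>The value 0 at good columns lets \<open>phi\<close> measure the bad ones only.
  \<open>wt1\<close> is the weight after the loss of one unit, \<open>wt2\<close> the weight with
  the penalty added.\<close>

definition wt :: "nat \<Rightarrow> ennreal" where "wt x = (if x = 0 then 0 else 2048 ^ x)"

definition wt1 :: "nat \<Rightarrow> ennreal" where "wt1 x = (if x = 0 then 0 else 2048 ^ (x - 1))"

definition wt2 :: "nat \<Rightarrow> ennreal" where "wt2 x = (if x = 0 then 0 else 2048 ^ (x + pen))"

text \<open>The sum, over all positions of \<open>r\<close> successive bad columns with gaps below 100, of the product of
  their weights; by independence its expectation is a power.\<close>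

primrec chain :: "nat \<Rightarrow> (nat \<Rightarrow> nat) \<Rightarrow> ennreal" where
  "chain 0 t = 1"
| "chain (Suc r) t = (\<Sum>g<100. wt2 (t g) * chain r (seq_drop (Suc g) t))"

text \<open>The actual positions of the bad columns are one of the choices summed in
  \<open>chain\<close>, and all terms are nonnegative.\<close>

lemma chain_ge:
  "\<exists>n. zrun n t \<Longrightarrow> nbad t = n \<Longrightarrow> 2048 ^ (wsum t + pen * n) \<le> chain n t"
proof (induction n arbitrary: t)
  case 0 then show ?case using nbad_0 by simp
next
  case (Suc n)
  obtain g where g: "g < 100" "t g \<noteq> 0" "wsum t = t g + wsum (seq_drop (Suc g) t)"
    "nbad (seq_drop (Suc g) t) = n" "\<exists>n. zrun n (seq_drop (Suc g) t)"
    using nbad_Suc[OF Suc.prems] by metis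
  have "(2048::ennreal) ^ (wsum t + pen * Suc n)
      = 2048 ^ (t g + pen) * 2048 ^ (wsum (seq_drop (Suc g) t) + pen * n)"
    by (simp add: g(3) power_add mult_ac)
  also have "\<dots> = wt2 (t g) * 2048 ^ (wsum (seq_drop (Suc g) t) + pen * n)"
    using g(2) by (simp add: wt2_def)
  also have "\<dots> \<le> wt2 (t g) * chain n (seq_drop (Suc g) t)"
    using Suc.IH[OF g(5,4)] by (intro mult_left_mono) auto
  also have "\<dots> \<le> chain (Suc n) t"
    unfolding chain.simps using g(1)
    by (intro member_le_sum[where f = "\<lambda>g. wt2 (t g) * chain n (seq_drop (Suc g) t)"]) auto
  finally show ?case .
qed

text \<open>A single bad column is covered by the first sum, where the lost unit yields the factor 1
  / 2048; two or more are covered by \<open>chain (r + 2)\<close>, which is at least of second order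
  in \<open>phi\<close>.\<close>

lemma wt_cost_le:
  assumes ex: "\<exists>n. zrun n t"
  shows "wt (cost t) \<le> (\<Sum>g<100. wt1 (t g)) + (\<Sum>r. chain (r + 2) t)"
proof -
  consider "nbad t = 0" | "nbad t = Suc 0" | "2 \<le> nbad t" by linarith
  then show ?thesis
  proof cases
    case 1
    then have "cost t = 0" using nbad_0[OF ex 1] by (simp add: cost_def)
    then show ?thesis by (simp add: wt_def)
  next
    case 2
    obtain g where g: "g < 100" "t g \<noteq> 0" "wsum t = t g + wsum (seq_drop (Suc g) t)"
      "nbad (seq_drop (Suc g) t) = 0" "\<exists>n. zrun n (seq_drop (Suc g) t)"
      using nbad_Suc[OF ex 2] by metis
    have "cost t = t g - 1" using 2 g(3) nbad_0[OF g(5,4)] by (simp add: cost_def)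
    then have "wt (cost t) \<le> wt1 (t g)" using g(2) by (simp add: wt_def wt1_def)
    also have "\<dots> \<le> (\<Sum>g<100. wt1 (t g))"
      using g(1) by (intro member_le_sum[where f = "\<lambda>g. wt1 (t g)"]) auto
    also have "\<dots> \<le> (\<Sum>g<100. wt1 (t g)) + (\<Sum>r. chain (r + 2) t)" by simp
    finally show ?thesis .
  next
    case 3
    then obtain r where r: "nbad t = r + 2" by (metis add.commute le_Suc_ex)
    have "wt (cost t) \<le> 2048 ^ (wsum t + pen * nbad t)"
      using 3 by (simp add: wt_def cost_def pen_def[symmetric])
    also have "\<dots> \<le> chain (r + 2) t" using chain_ge[OF ex refl] r by simp
    also have "\<dots> \<le> (\<Sum>r. chain (r + 2) t)"
      using sum_le_suminf[of "\<lambda>r. chain (r + 2) t" "{r}"] by simp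
    also have "\<dots> \<le> (\<Sum>g<100. wt1 (t g)) + (\<Sum>r. chain (r + 2) t)" by simp
    finally show ?thesis .
  qed
qed

lemma measurable_SQ_fun: "(\<lambda>t. h (t i)) \<in> borel_measurable SQ"
  by (rule measurable_compose[OF measurable_SQ_apply]) simp

lemma measurable_chain [measurable]: "chain r \<in> borel_measurable SQ"
proof (induction r)
  case 0 then show ?case by simp
next
  case (Suc r)
  have [measurable]: "(\<lambda>t. chain r (seq_drop (Suc g) t)) \<in> borel_measurable SQ" for g
    by (rule measurable_compose[OF measurable_shift_SQ Suc])
  have [measurable]: "(\<lambda>t. wt2 (t g)) \<in> borel_measurable SQ" for g by (rule measurable_SQ_fun)
  show ?case unfolding chain.simps by measurable
qed

context nat_iid
begin

definition phi :: ennreal where "phi = (\<integral>\<^sup>+x. wt x \<partial>N)"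

lemma measurable_N: "h \<in> measurable N M' \<longleftrightarrow> h \<in> UNIV \<rightarrow> space M'"
  using measurable_cong_sets[of N "count_space UNIV" M' M'] by simp

lemma nn_coord: "(\<integral>\<^sup>+t. h (t i) \<partial>S) = (\<integral>\<^sup>+x. h x \<partial>N)"
proof -
  have "(\<integral>\<^sup>+x. h x \<partial>N) = (\<integral>\<^sup>+x. h x \<partial>distr S N (\<lambda>t. t i))" by (simp add: PiM_component)
  also have "\<dots> = (\<integral>\<^sup>+t. h (t i) \<partial>S)" by (rule nn_integral_distr) (simp_all add: measurable_N)
  finally show ?thesis by simp
qed

lemma nn_wt1: "2048 * (\<integral>\<^sup>+x. wt1 x \<partial>N) = phi"
proof -
  have "wt x = 2048 * wt1 x" for x by (cases x) (simp_all add: wt_def wt1_def)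
  then have "phi = (\<integral>\<^sup>+x. 2048 * wt1 x \<partial>N)" by (simp only: phi_def)
  also have "\<dots> = 2048 * (\<integral>\<^sup>+x. wt1 x \<partial>N)"
    by (rule nn_integral_cmult) (simp add: measurable_N)
  finally show ?thesis by (rule sym)
qed

lemma nn_wt2: "(\<integral>\<^sup>+x. wt2 x \<partial>N) = 2048 ^ pen * phi"
proof -
  have "wt2 x = 2048 ^ pen * wt x" for x by (simp add: wt_def wt2_def power_add mult.commute)
  then have "(\<integral>\<^sup>+x. wt2 x \<partial>N) = (\<integral>\<^sup>+x. 2048 ^ pen * wt x \<partial>N)" by (simp only:)
  also have "\<dots> = 2048 ^ pen * phi"
    unfolding phi_def by (rule nn_integral_cmult) (simp add: measurable_N)
  finally show ?thesis .
qed

lemma SQ_imp_S: "h \<in> borel_measurable SQ \<Longrightarrow> h \<in> borel_measurable S"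
  using measurable_cong_sets[OF sets_S refl, of borel] by simp

lemma nn_chain: "(\<integral>\<^sup>+t. chain r t \<partial>S) = (100 * (2048 ^ pen * phi)) ^ r"
proof (induction r)
  case 0 then show ?case by (simp add: P.emeasure_space_1[simplified])
next
  case (Suc r)
  have m: "(\<lambda>t. wt2 (t g) * chain r (seq_drop (Suc g) t)) \<in> borel_measurable S" for g
  proof -
    have "(\<lambda>t. chain r (seq_drop (Suc g) t)) \<in> borel_measurable SQ"
      by (rule measurable_compose[OF measurable_shift_SQ measurable_chain])
    then have "(\<lambda>t. wt2 (t g) * chain r (seq_drop (Suc g) t)) \<in> borel_measurable SQ"
      by (intro borel_measurable_times_ennreal measurable_SQ_fun)
    then show ?thesis by (rule SQ_imp_S)
  qed
  have "(\<integral>\<^sup>+t. chain (Suc r) t \<partial>S) = (\<Sum>g<(100::nat). \<integral>\<^sup>+t. wt2 (t g) * chain r (seq_drop (Suc g) t) \<partial>S)"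
    unfolding chain.simps by (rule nn_integral_sum[OF m])
  also have "\<dots> = (\<Sum>g<(100::nat). (2048 ^ pen * phi) * (100 * (2048 ^ pen * phi)) ^ r)"
  proof (rule sum.cong[OF refl])
    fix g :: nat
    have "(\<integral>\<^sup>+t. wt2 (t g) * chain r (seq_drop (Suc g) t) \<partial>S)
        = (\<integral>\<^sup>+t. wt2 (t g) \<partial>S) * (\<integral>\<^sup>+t. chain r t \<partial>S)"
      by (rule nn_split[OF measurable_SQ_fun measurable_chain]) simp
    also have "(\<integral>\<^sup>+t. wt2 (t g) \<partial>S) = 2048 ^ pen * phi" by (simp only: nn_coord nn_wt2)
    finally show "(\<integral>\<^sup>+t. wt2 (t g) * chain r (seq_drop (Suc g) t) \<partial>S) =
        (2048 ^ pen * phi) * (100 * (2048 ^ pen * phi)) ^ r" by (simp only: Suc.IH)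
  qed
  also have "\<dots> = (100 * (2048 ^ pen * phi)) ^ Suc r"
    by (simp only: sum_constant card_lessThan power_Suc) (simp add: mult.assoc)
  finally show ?case .
qed

text \<open>Single columns contribute \<open>100 / 2048 * f \<le> f / 16\<close>. The chains form a
  geometric series of ratio \<open>K * f \<le> 1 / 32\<close> and contribute at most
  \<open>2 * K\<^sup>2 * f * f \<le> f / 16\<close>. This explains the choice of 2048 and of
  32.\<close>

lemma nn_wt_cost:
  assumes small: "100 * emeasure N {0<..} < 1"
    and f: "phi = ennreal f" "0 \<le> f" and K: "K = 100 * 2048 ^ pen" "32 * K\<^sup>2 * f \<le> 1"
  shows "(\<integral>\<^sup>+x. wt x \<partial>N') \<le> ennreal (f / 8)"
proof -
  have K1: "100 \<le> K" unfolding K(1) by simp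
  have "(32 * K * f) * 1 \<le> (32 * K * f) * K" using K1 f(2) by (intro mult_left_mono) auto
  also have "\<dots> = 32 * K\<^sup>2 * f" by (simp add: power2_eq_square)
  finally have "32 * K * f \<le> 32 * K\<^sup>2 * f" by simp
  then have z: "K * f \<le> 1/32" using K(2) by linarith
  have z0: "0 \<le> K * f" using K1 f by simp
  have "(\<integral>\<^sup>+x. wt x \<partial>N') = (\<integral>\<^sup>+t. wt (cost t) \<partial>S)"
    unfolding N'_def by (rule nn_integral_distr[OF measurable_cost_S]) simp
  also have "\<dots> \<le> (\<integral>\<^sup>+t. (\<Sum>g<100. wt1 (t g)) + (\<Sum>r. chain (r + 2) t) \<partial>S)"
  proof (rule nn_integral_mono_AE)
    show "AE t in S. wt (cost t) \<le> (\<Sum>g<100. wt1 (t g)) + (\<Sum>r. chain (r + 2) t)"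
      using AE_zrun[OF small] by (rule eventually_mono) (rule wt_cost_le)
  qed
  also have "\<dots> = (\<integral>\<^sup>+t. (\<Sum>g<100. wt1 (t g)) \<partial>S) + (\<integral>\<^sup>+t. (\<Sum>r. chain (r + 2) t) \<partial>S)"
  proof (rule nn_integral_add)
    show "(\<lambda>t. \<Sum>g<100. wt1 (t g)) \<in> borel_measurable S"
      by (rule SQ_imp_S, rule borel_measurable_sum, rule measurable_SQ_fun)
    have "(\<lambda>t. \<Sum>r. chain (r + 2) t) \<in> borel_measurable SQ" by measurable
    then show "(\<lambda>t. \<Sum>r. chain (r + 2) t) \<in> borel_measurable S" by (rule SQ_imp_S)
  qed
  also have "(\<integral>\<^sup>+t. (\<Sum>g<100. wt1 (t g)) \<partial>S) = 100 * (\<integral>\<^sup>+x. wt1 x \<partial>N)"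
    by (subst nn_integral_sum[OF SQ_imp_S[OF measurable_SQ_fun]]) (simp add: nn_coord)
  also have "(\<integral>\<^sup>+x. wt1 x \<partial>N) = ennreal (f / 2048)"
  proof -
    have "2048 * (\<integral>\<^sup>+x. wt1 x \<partial>N) = 2048 * ennreal (f / 2048)"
      unfolding nn_wt1 f(1) using f(2) by (simp add: ennreal_mult[symmetric] flip: ennreal_numeral)
    then show ?thesis by (simp add: ennreal_mult_cancel_left)
  qed
  also have "(\<integral>\<^sup>+t. (\<Sum>r. chain (r + 2) t) \<partial>S) = (\<Sum>r. \<integral>\<^sup>+t. chain (r + 2) t \<partial>S)"
    by (rule nn_integral_suminf, rule SQ_imp_S, rule measurable_chain)
  also have "\<dots> = (\<Sum>r. ennreal ((K * f) ^ (r + 2)))"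
  proof (intro suminf_cong)
    fix r
    have "100 * (2048 ^ pen * phi) = ennreal (K * f)"
      unfolding K(1) f(1) using f(2)
      by (simp only: ennreal_mult ennreal_power[symmetric] ennreal_numeral mult.assoc
          zero_le_numeral zero_le_power mult_nonneg_nonneg)
    then show "(\<integral>\<^sup>+t. chain (r + 2) t \<partial>S) = ennreal ((K * f) ^ (r + 2))"
      unfolding nn_chain using z0 by (simp only: ennreal_power)
  qed
  also have "\<dots> = ennreal (\<Sum>r. (K * f) ^ (r + 2))"
    using z z0 by (intro suminf_ennreal2) (auto intro!: summable_mult2 summable_geometric simp: power_add)
  also have "(\<Sum>r. (K * f) ^ (r + 2)) = (K * f)\<^sup>2 / (1 - K * f)"
  proof -
    have "(\<lambda>r. (K * f)\<^sup>2 * (K * f) ^ r) sums ((K * f)\<^sup>2 * (1 / (1 - K * f)))"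
      using z z0 by (intro sums_mult geometric_sums) auto
    moreover have "(K * f)\<^sup>2 * (K * f) ^ r = (K * f) ^ (r + 2)" for r
      by (simp only: power_add mult.commute)
    ultimately have "(\<lambda>r. (K * f) ^ (r + 2)) sums ((K * f)\<^sup>2 * (1 / (1 - K * f)))" by (simp only:)
    then show ?thesis by (simp only: sums_unique[symmetric] times_divide_eq_right mult_1_right)
  qed
  also have "100 * ennreal (f / 2048) + ennreal ((K * f)\<^sup>2 / (1 - K * f)) =
      ennreal (100 * (f / 2048) + (K * f)\<^sup>2 / (1 - K * f))"
  proof -
    have "100 * ennreal (f / 2048) = ennreal (100 * (f / 2048))"
      using ennreal_mult[of 100 "f / 2048"] f(2) by simp
    moreover have "0 \<le> (K * f)\<^sup>2 / (1 - K * f)" "0 \<le> 100 * (f / 2048)" using z f(2) by auto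
    ultimately show ?thesis by (simp only: ennreal_plus)
  qed
  also have "\<dots> \<le> ennreal (f / 8)"
  proof (rule ennreal_leI)
    have "(K * f)\<^sup>2 / (1 - K * f) \<le> (K * f)\<^sup>2 / (1/2)"
      using z by (intro divide_left_mono) auto
    also have "\<dots> = 2 * (K\<^sup>2 * f) * f" by (simp add: power2_eq_square)
    also have "\<dots> \<le> 2 * (1/32) * f" using K(2) f(2) by (intro mult_right_mono mult_left_mono) auto
    finally show "100 * (f / 2048) + (K * f)\<^sup>2 / (1 - K * f) \<le> f / 8" using f(2) by simp
  qed
  finally show ?thesis .
qed

lemma emeasure_pos_le_phi: "emeasure N {0<..} \<le> phi"
proof -
  have "emeasure N {0<..} = (\<integral>\<^sup>+x. indicator {0<..} x \<partial>N)" by simp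
  also have "\<dots> \<le> phi" unfolding phi_def
    by (intro nn_integral_mono) (auto simp: wt_def indicator_def one_le_power)
  finally show ?thesis .
qed

end


section \<open>Environments that are good on all scales\<close>

definition envmap :: "(nat \<Rightarrow> nat) \<Rightarrow> nat \<Rightarrow> nat" where
  "envmap t = word_costs (seq_drop 50 t)"

text \<open>These are the hypotheses of \<open>block_cut\<close>.\<close>

definition clean :: "(nat \<Rightarrow> nat) set" where
  "clean = {t. (\<forall>i<50. t i = 0) \<and> (\<forall>m. \<exists>n. zrun n (seq_drop m t))}"

definition good_env :: "(nat \<Rightarrow> nat) set" where
  "good_env = {t. \<forall>k. (envmap ^^ k) t \<in> clean}"

lemma ladder_good_env:
  assumes "t \<in> good_env"
  shows "ladder (\<lambda>k. (envmap ^^ k) t) (\<lambda>k. block_start (seq_drop 50 ((envmap ^^ k) t)))"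
proof -
  have c: "(envmap ^^ k) t \<in> clean" for k using assms by (simp add: good_env_def)
  have "block ((envmap ^^ k) t) (block_start (seq_drop 50 ((envmap ^^ k) t)) I)
      (block_start (seq_drop 50 ((envmap ^^ k) t)) (Suc I)) ((envmap ^^ Suc k) t I)" for k I
    using block_cut[of "(envmap ^^ k) t" I] c[of k] by (simp add: clean_def envmap_def del: block_start.simps)
  moreover have "(envmap ^^ k) t 0 = 0" for k using c[of k] by (auto simp: clean_def)
  ultimately show ?thesis by (simp add: ladder_def)
qed

lemma measurable_envmap [measurable]: "envmap \<in> SQ \<rightarrow>\<^sub>M SQ"
  unfolding envmap_def[abs_def] by (rule measurable_compose[OF measurable_shift_SQ measurable_words])

lemma measurable_envmap_pow [measurable]: "envmap ^^ k \<in> SQ \<rightarrow>\<^sub>M SQ"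
proof (induction k)
  case (Suc k)
  then show ?case using measurable_comp[OF Suc measurable_envmap] by (simp add: comp_def)
qed simp

lemma sets_zruns: "{t. \<forall>m. \<exists>n. zrun n (seq_drop m t)} \<in> sets SQ"
proof -
  have "Measurable.pred SQ (\<lambda>t. \<forall>m. \<exists>n. zrun (m + n) t)" by measurable
  then show ?thesis by (simp add: zrun_shift pred_def space_PiM)
qed

lemma sets_clean: "clean \<in> sets SQ"
proof -
  have "{t. \<forall>i<50. t i \<in> {0::nat}} \<in> sets SQ" by (rule cylinder_in_sets)
  then have "{t. \<forall>i<50. t i \<in> {0::nat}} \<inter> {t. \<forall>m. \<exists>n. zrun n (seq_drop m t)} \<in> sets SQ"
    using sets_zruns by (rule sets.Int)
  also have "{t. \<forall>i<50. t i \<in> {0::nat}} \<inter> {t. \<forall>m. \<exists>n. zrun n (seq_drop m t)} = clean"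
    by (auto simp: clean_def)
  finally show ?thesis .
qed

lemma sets_envmap_clean: "{t. (envmap ^^ k) t \<in> clean} \<in> sets SQ"
  using measurable_sets[OF measurable_envmap_pow sets_clean, of k] by (simp add: vimage_def space_PiM)

lemma sets_good_env: "good_env \<in> sets SQ"
proof -
  have "good_env = (\<Inter>k. {t. (envmap ^^ k) t \<in> clean})" by (auto simp: good_env_def)
  also have "\<dots> \<in> sets SQ" using sets_envmap_clean by (intro sets.countable_INT) auto
  finally show ?thesis .
qed

context nat_iid
begin

lemma distr_envmap:
  assumes small: "100 * emeasure N {0<..} < 1"
  shows "distr S SQ envmap = PiM UNIV (\<lambda>_. N')"
proof -
  have m: "seq_drop 50 \<in> S \<rightarrow>\<^sub>M S" "word_costs \<in> S \<rightarrow>\<^sub>M SQ"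
    using measurable_shift_SQ measurable_words
    unfolding measurable_cong_sets[OF sets_S refl] measurable_cong_sets[OF refl sets_S] by auto
  have "distr S SQ envmap = distr (distr S S (seq_drop 50)) SQ word_costs"
    using distr_distr[OF m(2,1)] by (simp add: envmap_def[abs_def] comp_def)
  then show ?thesis using distr_words[OF small] by (simp add: distr_shift)
qed

lemma small_of_phi:
  assumes "phi \<le> ennreal f" "0 \<le> f" "f < 1 / 100"
  shows "100 * emeasure N {0<..} < 1"
proof -
  have "100 * emeasure N {0<..} \<le> 100 * ennreal f"
    using emeasure_pos_le_phi assms(1) by (intro mult_left_mono) auto
  also have "\<dots> = ennreal (100 * f)" using ennreal_mult[of 100 f] assms(2) by simp
  also have "\<dots> < 1" using assms by (simp add: ennreal_less_one_iff)
  finally show ?thesis .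
qed

lemma emeasure_not_clean:
  assumes phi: "phi \<le> ennreal f" "0 \<le> f" "f < 1 / 100"
  shows "emeasure S (- clean) \<le> ennreal (50 * f)"
proof -
  have c: "clean \<in> sets S" using sets_clean by (simp add: sets_S)
  have z: "{t. \<forall>m. \<exists>n. zrun n (seq_drop m t)} \<in> sets S" using sets_zruns by (simp add: sets_S)
  have s: "{t. t i \<in> {0<..}} \<in> sets S" for i
    by (rule measurable_pred_S, rule measurable_compose[OF measurable_SQ_apply]) simp
  have U: "(\<Union>i<50. {t. t i \<in> {0<..}}) \<in> sets S" using s by auto
  have "emeasure S (- clean) \<le> emeasure S (\<Union>i<50. {t. t i \<in> {0<..}})"
  proof (rule emeasure_mono_AE)
    show "AE t in S. t \<in> - clean \<longrightarrow> t \<in> (\<Union>i<50. {t. t i \<in> {0<..}})"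
      using AE_zruns[OF small_of_phi[OF phi]] by (rule eventually_mono) (auto simp: clean_def)
  qed (rule U)
  also have "\<dots> \<le> (\<Sum>i<(50::nat). emeasure S {t. t i \<in> {0<..}})"
    using s by (intro emeasure_subadditive_finite) auto
  also have "\<dots> = (\<Sum>i<(50::nat). emeasure N {0<..})"
    using emeasure_PiM_Collect_single[of _ "{0<..}"] by (intro sum.cong) auto
  also have "\<dots> \<le> 50 * ennreal f"
    using emeasure_pos_le_phi phi(1) by (simp add: mult_left_mono)
  also have "\<dots> = ennreal (50 * f)" using ennreal_mult[of 50 f] phi(2) by simp
  finally show ?thesis .
qed

lemma phi_N'_le:
  assumes phi: "phi \<le> ennreal f" "0 \<le> f" and K: "K = 100 * 2048 ^ pen" "32 * K\<^sup>2 * f \<le> 1"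
  shows "f < 1 / 100" "nat_iid.phi N' \<le> ennreal (f / 8)"
proof -
  have K1: "100 \<le> K" unfolding K(1) by simp
  have "100\<^sup>2 \<le> K\<^sup>2" using K1 by (intro power_mono) auto
  then have "320000 * f \<le> 32 * K\<^sup>2 * f" using phi(2) by (intro mult_right_mono) auto
  then show f: "f < 1 / 100" using K(2) by linarith
  obtain f' where f': "phi = ennreal f'" "0 \<le> f'"
    using phi(1) by (cases phi) (auto simp: top_unique)
  have le: "f' \<le> f" using phi f' by simp
  have "32 * K\<^sup>2 * f' \<le> 32 * K\<^sup>2 * f" using le by (intro mult_left_mono) auto
  then have "32 * K\<^sup>2 * f' \<le> 1" using K(2) by linarith
  from nn_wt_cost[OF small_of_phi[OF phi f] f' K(1) this]
  have "(\<integral>\<^sup>+x. wt x \<partial>N') \<le> ennreal (f' / 8)" .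
  also have "\<dots> \<le> ennreal (f / 8)" using le by (intro ennreal_leI) auto
  finally show "nat_iid.phi N' \<le> ennreal (f / 8)" using nat_iid_N' by (simp add: nat_iid.phi_def)
qed

end

text \<open>Only the law on each single scale is tracked, not the joint law of several scales; the
  union bound over the scales needs no more.\<close>

lemma envmap_law:
  assumes "nat_iid N" and phi: "nat_iid.phi N \<le> ennreal f" "0 \<le> f"
    and K: "K = 100 * 2048 ^ pen" "32 * K\<^sup>2 * f \<le> 1"
  shows "\<exists>Nk. nat_iid Nk \<and> nat_iid.phi Nk \<le> ennreal (f / 8 ^ k) \<and>
    distr (PiM UNIV (\<lambda>_. N)) SQ (envmap ^^ k) = PiM UNIV (\<lambda>_. Nk)"
proof (induction k)
  case 0
  interpret nat_iid N by fact
  have "distr S SQ (\<lambda>x. x) = distr S S (\<lambda>x. x)" by (rule distr_cong) (simp_all add: sets_S)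
  then have eq: "distr S SQ (envmap ^^ 0) = S" by (simp add: id_def)
  show ?case
    by (rule exI[of _ N], intro conjI, fact assms(1), simp only: power_0 div_by_1, fact phi(1), fact eq)
next
  case (Suc k)
  interpret nat_iid N by fact
  obtain Nk where Nk: "nat_iid Nk" "nat_iid.phi Nk \<le> ennreal (f / 8 ^ k)"
    "distr (PiM UNIV (\<lambda>_. N)) SQ (envmap ^^ k) = PiM UNIV (\<lambda>_. Nk)" using Suc.IH by blast
  interpret k: nat_iid Nk by fact
  have fk: "0 \<le> f / 8 ^ k" "f / 8 ^ k \<le> f"
    using phi(2) by (auto simp: divide_le_eq mult_le_cancel_left1)
  have "32 * K\<^sup>2 * (f / 8 ^ k) \<le> 32 * K\<^sup>2 * f" using fk by (intro mult_left_mono) auto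
  then have K': "32 * K\<^sup>2 * (f / 8 ^ k) \<le> 1" using K(2) by linarith
  note p = k.phi_N'_le[OF Nk(2) fk(1) K(1) K']
  have m: "envmap ^^ k \<in> S \<rightarrow>\<^sub>M SQ"
    using measurable_envmap_pow unfolding measurable_cong_sets[OF sets_S refl] .
  have "distr S SQ (envmap ^^ Suc k) = distr (distr S SQ (envmap ^^ k)) SQ envmap"
    by (subst distr_distr[OF measurable_envmap m]) (simp add: comp_def)
  also have "\<dots> = PiM UNIV (\<lambda>_. k.N')"
    unfolding Nk(3) by (rule k.distr_envmap[OF k.small_of_phi[OF Nk(2) fk(1) p(1)]])
  finally have law: "distr S SQ (envmap ^^ Suc k) = PiM UNIV (\<lambda>_. k.N')" .
  have "nat_iid.phi k.N' \<le> ennreal (f / 8 ^ Suc k)" using p(2) by (simp add: mult.commute)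
  then show ?case using law k.nat_iid_N' by blast
qed

text \<open>Scale \<open>k\<close> fails to be clean with probability at most
  \<open>50 * f / 8 ^ k\<close>, and these bounds sum to less than 1 since
  \<open>f < 1 / 100\<close>.\<close>

lemma emeasure_good_env_pos:
  assumes "nat_iid N" and phi: "nat_iid.phi N \<le> ennreal f" "0 \<le> f"
    and K: "K = 100 * 2048 ^ pen" "32 * K\<^sup>2 * f \<le> 1"
  shows "0 < emeasure (PiM UNIV (\<lambda>_. N)) good_env"
proof -
  interpret nat_iid N by fact
  have f1: "f < 1 / 100" by (rule phi_N'_le(1)[OF phi K])
  let ?B = "\<lambda>k. {t. (envmap ^^ k) t \<notin> clean}"
  have B: "?B k \<in> sets S" for k
    using sets_envmap_clean[of k, THEN sets.compl_sets] by (simp add: sets_S space_PiM Compl_eq_Diff_UNIV[symmetric] Collect_neg_eq)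
  have Bk: "emeasure S (?B k) \<le> ennreal (50 * (f / 8 ^ k))" for k
  proof -
    obtain Nk where Nk: "nat_iid Nk" "nat_iid.phi Nk \<le> ennreal (f / 8 ^ k)"
      "distr (PiM UNIV (\<lambda>_. N)) SQ (envmap ^^ k) = PiM UNIV (\<lambda>_. Nk)"
      using envmap_law[OF assms] by blast
    interpret k: nat_iid Nk by fact
    have fk: "0 \<le> f / 8 ^ k" "f / 8 ^ k \<le> f"
      using phi(2) by (auto simp: divide_le_eq mult_le_cancel_left1)
    have m: "envmap ^^ k \<in> S \<rightarrow>\<^sub>M SQ"
      using measurable_envmap_pow unfolding measurable_cong_sets[OF sets_S refl] .
    have c: "- clean \<in> sets SQ"
      using sets.compl_sets[OF sets_clean] by (simp add: space_PiM Compl_eq_Diff_UNIV)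
    have "emeasure S (?B k) = emeasure (distr S SQ (envmap ^^ k)) (- clean)"
      by (subst emeasure_distr[OF m c]) (simp add: vimage_def)
    also have "\<dots> \<le> ennreal (50 * (f / 8 ^ k))"
      unfolding Nk(3) using fk(2) f1 by (intro k.emeasure_not_clean[OF Nk(2) fk(1)]) linarith
    finally show ?thesis .
  qed
  have "emeasure S (\<Union>k. ?B k) \<le> (\<Sum>k. emeasure S (?B k))"
    using B by (intro emeasure_subadditive_countably) auto
  also have "\<dots> \<le> (\<Sum>k. ennreal (50 * (f / 8 ^ k)))" by (intro suminf_le Bk) auto
  also have "\<dots> = (\<Sum>k. ennreal (50 * f * (1 / 8) ^ k))" by (simp add: power_one_over)
  also have "\<dots> = ennreal (\<Sum>k. 50 * f * (1 / 8) ^ k)"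
  proof (rule suminf_ennreal2)
    show "summable (\<lambda>k. 50 * f * (1 / 8) ^ k)" by (intro summable_mult summable_geometric) simp
  qed (use phi(2) in simp)
  also have "(\<Sum>k. 50 * f * (1 / 8) ^ k) = 50 * f * (8 / 7)"
    by (subst suminf_mult) (auto simp: suminf_geometric summable_geometric)
  also have "ennreal \<dots> < 1" using f1 phi(2) by (simp add: ennreal_less_one_iff)
  finally have lt: "emeasure S (\<Union>k. ?B k) < 1" .
  have "good_env = UNIV - (\<Union>k. ?B k)" by (auto simp: good_env_def)
  then have "emeasure S good_env = 1 - emeasure S (\<Union>k. ?B k)"
    using emeasure_compl[of "\<Union>k. ?B k" S] B P.emeasure_space_1 by (auto simp: P.emeasure_eq_measure)
  then show ?thesis using lt by (simp add: diff_gr0_ennreal)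
qed


section \<open>Almost sure existence of a good starting column\<close>

text \<open>By stationarity every shift lies in \<open>A\<close> with the same probability, so
  infinitely many do with at least that probability. This is a tail event, and Kolmogorov's law
  raises its probability to 1.\<close>

lemma (in prob_space) AE_ex_shift:
  assumes ind: "indep_vars (\<lambda>_. count_space UNIV) X (UNIV :: nat set)"
    and law: "\<And>i. distr M (count_space UNIV) (X i) = N"
    and A: "A \<in> sets SQ" and pos: "0 < emeasure (PiM UNIV (\<lambda>_. N)) A"
  shows "AE \<omega> in M. \<exists>n. seq_drop n (\<lambda>i. X i \<omega>) \<in> A"
proof -
  have rv [measurable]: "X i \<in> M \<rightarrow>\<^sub>M count_space UNIV" for i
    using ind by (simp add: indep_vars_def)
  interpret N: nat_iid N
    using prob_space_distr[OF rv[of 0]] law[of 0] by (intro nat_iid.intro) auto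
  have mX [measurable]: "(\<lambda>\<omega> i. X i \<omega>) \<in> M \<rightarrow>\<^sub>M SQ"
    by (rule measurable_PiM_single') auto
  have XS: "(\<lambda>\<omega> i. X i \<omega>) \<in> M \<rightarrow>\<^sub>M N.S" using mX unfolding measurable_cong_sets[OF refl N.sets_S] .
  have shS: "seq_drop n \<in> N.S \<rightarrow>\<^sub>M N.S" for n
    using measurable_shift_SQ unfolding measurable_cong_sets[OF N.sets_S N.sets_S] .
  have "distr M SQ (\<lambda>\<omega> i. X i \<omega>) = N.S"
    using ind indep_vars_iff_distr_eq_PiM[where I = UNIV and M' = "\<lambda>_. count_space UNIV" and X = X] rv
    by (simp add: law restrict_UNIV)
  moreover have "distr M N.S (\<lambda>\<omega> i. X i \<omega>) = distr M SQ (\<lambda>\<omega> i. X i \<omega>)"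
    by (rule distr_cong) (simp_all add: N.sets_S)
  ultimately have dX: "distr M N.S (\<lambda>\<omega> i. X i \<omega>) = N.S" by simp
  have dn: "distr M N.S (\<lambda>\<omega>. seq_drop n (\<lambda>i. X i \<omega>)) = N.S" for n
    using distr_distr[OF shS XS, of n] unfolding dX N.distr_shift by (simp add: comp_def)
  let ?H = "\<lambda>n. {\<omega> \<in> space M. seq_drop n (\<lambda>i. X i \<omega>) \<in> A}"
  have Hn: "emeasure M (?H n) = emeasure N.S A" for n
  proof -
    have "emeasure (distr M N.S (\<lambda>\<omega>. seq_drop n (\<lambda>i. X i \<omega>))) A =
        emeasure M ((\<lambda>\<omega>. seq_drop n (\<lambda>i. X i \<omega>)) -` A \<inter> space M)"
      using A by (intro emeasure_distr measurable_compose[OF XS shS]) (simp add: N.sets_S)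
    then show ?thesis unfolding dn by (simp add: vimage_def Int_def conj_commute)
  qed
  define F where "F i = sigma_sets (space M) {X i -` B \<inter> space M |B. B \<in> sets (count_space UNIV)}" for i
  have Fsub: "F i \<subseteq> Pow (space M)" for i
    unfolding F_def using sigma_sets_into_sp[of "{X i -` B \<inter> space M |B. B \<in> sets (count_space UNIV)}" "space M"]
    by auto
  have sig: "?H m \<in> sigma_sets (space M) (\<Union>(F ` {n..}))" if "n \<le> m" for n m
  proof -
    define G where "G = sigma (space M) (\<Union>(F ` {n..}))"
    have Gs: "sets G = sigma_sets (space M) (\<Union>(F ` {n..}))" "space G = space M"
      unfolding G_def using Fsub by (auto intro!: sets_measure_of space_measure_of)
    have "(\<lambda>\<omega>. seq_drop m (\<lambda>i. X i \<omega>)) \<in> G \<rightarrow>\<^sub>M SQ"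
    proof (rule measurable_PiM_single')
      fix i :: nat
      have "X (m + i) -` B \<inter> space M \<in> sets G" for B
      proof -
        have "X (m + i) -` B \<inter> space M \<in> F (m + i)" unfolding F_def by (rule sigma_sets.Basic) auto
        then show ?thesis unfolding Gs using that by (intro sigma_sets.Basic) auto
      qed
      then show "(\<lambda>\<omega>. seq_drop m (\<lambda>i. X i \<omega>) i) \<in> G \<rightarrow>\<^sub>M count_space UNIV"
        unfolding seq_drop_def by (intro measurableI) (simp_all add: Gs)
    qed auto
    from measurable_sets[OF this A] show ?thesis by (simp add: Gs vimage_def Int_def conj_commute)
  qed
  define E where "E n = (\<Union>m\<in>{n..}. ?H m)" for n
  have H: "?H m \<in> events" for m
    using measurable_sets[OF measurable_compose[OF mX measurable_shift_SQ] A]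
    by (simp add: vimage_def Int_def conj_commute)
  have E: "E n \<in> events" for n unfolding E_def using H by (intro sets.countable_UN') auto
  have dec: "decseq E" unfolding decseq_def E_def by (meson UN_mono atLeast_subset_iff order_refl)
  have tail: "(\<Inter>n. E n) \<in> tail_events F"
    unfolding tail_events_def
  proof (intro INT_I)
    fix n :: nat
    have sub: "\<Union>(F ` {n..}) \<subseteq> Pow (space M)" using Fsub by blast
    interpret T: sigma_algebra "space M" "sigma_sets (space M) (\<Union>(F ` {n..}))"
      by (rule sigma_algebra_sigma_sets[OF sub])
    \<comment> \<open>As \<open>E\<close> decreases, its first \<open>n\<close> members may be
      dropped; the others depend only on \<open>X i\<close> with \<open>i \<ge> n\<close>.\<close>
    have "(\<Inter>k. E k) = (\<Inter>k. E (n + k))"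
    proof (rule antisym)
      show "(\<Inter>k. E (n + k)) \<subseteq> (\<Inter>k. E k)"
      proof (rule INT_greatest)
        fix k
        have "E (n + k) \<subseteq> E k" by (rule decseqD[OF dec]) simp
        then show "(\<Inter>k. E (n + k)) \<subseteq> E k" by blast
      qed
    qed blast
    also have "\<dots> \<in> sigma_sets (space M) (\<Union>(F ` {n..}))"
    proof (rule T.countable_INT, rule image_subsetI)
      fix k
      show "E (n + k) \<in> sigma_sets (space M) (\<Union>(F ` {n..}))"
        unfolding E_def by (rule T.countable_UN''[OF countable_subset[OF subset_UNIV countableI_type]]) (simp add: sig)
    qed simp
    finally show "(\<Inter>k. E k) \<in> sigma_sets (space M) (\<Union>(F ` {n..}))" .
  qed
  have "prob (\<Inter>n. E n) = 0 \<or> prob (\<Inter>n. E n) = 1"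
  proof (rule kolmogorov_0_1_law[OF _ _ tail])
    show "sigma_algebra (space M) (F i)" for i
      unfolding F_def by (rule sigma_algebra_sigma_sets) auto
    show "indep_sets F UNIV" using ind unfolding indep_vars_def F_def by simp
  qed
  moreover have "0 < prob (\<Inter>n. E n)"
  proof -
    have "(\<lambda>n. prob (E n)) \<longlonglongrightarrow> prob (\<Inter>n. E n)"
      using E by (intro finite_Lim_measure_decseq dec) auto
    moreover have "measure N.S A \<le> prob (E n)" for n
    proof -
      have "measure N.S A = prob (?H n)" using Hn[of n] by (simp add: measure_def)
      also have "\<dots> \<le> prob (E n)" using E[of n] by (intro finite_measure_mono) (auto simp: E_def)
      finally show ?thesis .
    qed
    ultimately have "measure N.S A \<le> prob (\<Inter>n. E n)" by (intro LIMSEQ_le_const) auto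
    moreover have "0 < measure N.S A" using pos by (simp add: N.P.emeasure_eq_measure)
    ultimately show ?thesis by linarith
  qed
  ultimately have "prob (\<Inter>n. E n) = 1" by linarith
  then have "AE \<omega> in M. \<omega> \<in> (\<Inter>n. E n)"
    using E prob_eq_1[of "\<Inter>n. E n"] by (simp add: sets.countable_INT)
  then show ?thesis by (rule eventually_mono) (auto simp: E_def)
qed

text \<open>For \<open>x > 0\<close> the term \<open>n = x - 1\<close> of the series of indicators
  already equals \<open>wt x\<close>. Integration turns indicators into tails and leaves a geometric
  series of ratio at most 1 / 2, hence the factor 2.\<close>

lemma phi_le_tails:
  fixes N :: "nat measure"
  assumes N: "nat_iid N" and tail: "\<And>n. emeasure N {n..} \<le> ennreal (q ^ n)"
    and q: "0 \<le> q" "2048 * q \<le> 1 / 2"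
  shows "nat_iid.phi N \<le> ennreal (2 * (2048 * q))"
proof -
  interpret nat_iid N by fact
  let ?r = "2048 * q"
  have le: "wt x \<le> (\<Sum>n. 2048 ^ Suc n * indicator {Suc n..} x)" for x
  proof (cases x)
    case (Suc y)
    have "wt x = 2048 ^ Suc y * indicator {Suc y..} x" by (simp add: wt_def Suc)
    also have "\<dots> \<le> (\<Sum>n. 2048 ^ Suc n * indicator {Suc n..} x)"
    proof -
      have "h y \<le> (\<Sum>n. h n)" for h :: "nat \<Rightarrow> ennreal"
        using sum_le_suminf[of h "{y}"] by simp
      then show ?thesis .
    qed
    finally show ?thesis .
  qed (simp add: wt_def)
  have "phi \<le> (\<integral>\<^sup>+x. (\<Sum>n. 2048 ^ Suc n * indicator {Suc n..} x) \<partial>N)"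
    unfolding phi_def using le by (rule nn_integral_mono)
  also have "\<dots> = (\<Sum>n. \<integral>\<^sup>+x. 2048 ^ Suc n * indicator {Suc n..} x \<partial>N)"
    by (rule nn_integral_suminf) (simp add: measurable_N)
  also have "\<dots> = (\<Sum>n. 2048 ^ Suc n * emeasure N {Suc n..})"
    by (intro suminf_cong nn_integral_cmult_indicator) simp
  also have "\<dots> \<le> (\<Sum>n. ennreal (?r * ?r ^ n))"
  proof (intro suminf_le)
    fix n
    have "2048 ^ Suc n * emeasure N {Suc n..} \<le> 2048 ^ Suc n * ennreal (q ^ Suc n)"
      by (intro mult_left_mono tail) simp
    also have "\<dots> = ennreal (2048 ^ Suc n) * ennreal (q ^ Suc n)"
      by (simp only: ennreal_power[symmetric] zero_le_numeral ennreal_numeral)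
    also have "\<dots> = ennreal (2048 ^ Suc n * q ^ Suc n)" using q(1) by (intro ennreal_mult[symmetric]) auto
    also have "2048 ^ Suc n * q ^ Suc n = ?r * ?r ^ n" by (simp add: power_mult_distrib)
    finally show "2048 ^ Suc n * emeasure N {Suc n..} \<le> ennreal (?r * ?r ^ n)" .
  qed auto
  also have "\<dots> = ennreal (\<Sum>n. ?r * ?r ^ n)"
  proof (rule suminf_ennreal2)
    show "summable (\<lambda>n. ?r * ?r ^ n)" using q by (intro summable_mult summable_geometric) simp
  qed (use q in simp)
  also have "(\<Sum>n. ?r * ?r ^ n) = ?r * (1 / (1 - ?r))"
  proof -
    have "norm ?r < 1" using q by simp
    then show ?thesis by (simp only: suminf_mult summable_geometric suminf_geometric)
  qed
  also have "ennreal \<dots> \<le> ennreal (2 * ?r)"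
  proof (rule ennreal_leI)
    have "?r * (1 / (1 - ?r)) \<le> ?r * 2"
      using q by (intro mult_left_mono) (auto simp: field_simps)
    then show "?r * (1 / (1 - ?r)) \<le> 2 * ?r" by simp
  qed
  finally show ?thesis .
qed


section \<open>From edges to sites\<close>

text \<open>The vertex of the original lattice that plays the role of site \<open>(i, j)\<close> when the field starts
  at the vertex \<open>(N, N)\<close>.\<close>

definition vmap :: "nat \<Rightarrow> nat \<times> int \<Rightarrow> int \<times> int" where
  "vmap N = (\<lambda>(i, j). (int (N + i), j + int N))"

definition up_edge :: "int \<times> int \<Rightarrow> (int \<times> int) \<times> (int \<times> int)" where
  "up_edge v = (v, (fst v + 1, snd v + 1))"

definition down_edge :: "int \<times> int \<Rightarrow> (int \<times> int) \<times> (int \<times> int)" where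
  "down_edge v = (v, (fst v + 1, snd v - 1))"

definition site_edges :: "nat \<Rightarrow> nat \<times> int \<Rightarrow> ((int \<times> int) \<times> (int \<times> int)) set" where
  "site_edges N x = (if even (int (fst x) + snd x) then {up_edge (vmap N x), down_edge (vmap N x)} else {})"

text \<open>Asking for both outgoing edges makes openness depend on the starting vertex alone, at
  the price of squaring the probability. Off the lattice there are no edges, so the site counts as
  open, as in \<open>renorm\<close>.\<close>

definition site_open :: "nat \<Rightarrow> (((int \<times> int) \<times> (int \<times> int)) \<Rightarrow> bool) \<Rightarrow> nat \<times> int \<Rightarrow> bool" where
  "site_open N \<omega> x \<longleftrightarrow> (\<forall>e\<in>site_edges N x. \<omega> e)"

lemma even_vmap: "even (fst (vmap N x) + snd (vmap N x)) \<longleftrightarrow> even (int (fst x) + snd x)"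
  by (cases x) (simp add: vmap_def)

lemma edges_in_Eset: "even (fst v + snd v) \<Longrightarrow> up_edge v \<in> Eset" "even (fst v + snd v) \<Longrightarrow> down_edge v \<in> Eset"
  by (cases v; auto simp: Eset_def Vset_def up_edge_def down_edge_def)+

lemma site_edges_subset: "site_edges N x \<subseteq> {e \<in> Eset. int N \<le> fst (fst e)}"
  using edges_in_Eset[of "vmap N x"] even_vmap[of N x]
  by (auto simp: site_edges_def up_edge_def down_edge_def vmap_def split: prod.splits)

lemma disjoint_site_edges: "disjoint_family (site_edges N)"
  by (auto simp: disjoint_family_on_def site_edges_def up_edge_def down_edge_def vmap_def split: prod.splits)

lemma finite_site_edges: "finite (site_edges N x)"
  by (simp add: site_edges_def)

lemma open_path_reaches:
  assumes "open_path (site_open N \<omega>) 0 0 n w"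
  shows "(open_step \<omega>)\<^sup>*\<^sup>* (vmap N (0, 0)) (vmap N (n, w))"
  using assms
proof (induction "0::nat" "0::int" n w rule: open_path.induct)
  case (step k v v')
  have ev: "even (int k + v)" using open_path_parity[OF step(1)] by simp
  have o: "\<forall>e\<in>{up_edge (vmap N (k, v)), down_edge (vmap N (k, v))}. \<omega> e"
    using open_path_end[OF step(1)] ev by (simp add: site_open_def site_edges_def)
  have "v' = v + 1 \<or> v' = v - 1" using step.hyps by linarith
  then have "(vmap N (k, v), vmap N (Suc k, v')) \<in> {up_edge (vmap N (k, v)), down_edge (vmap N (k, v))}"
    by (auto simp: up_edge_def down_edge_def vmap_def)
  then have "open_step \<omega> (vmap N (k, v)) (vmap N (Suc k, v'))"
    using o edges_in_Eset[of "vmap N (k, v)"] ev even_vmap[of N "(k, v)"] unfolding open_step_def by auto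
  with step(2) show ?case by (rule rtranclp.rtrancl_into_rtrancl)
qed simp

lemma prob_space_perc: "prob_space (perc_measure xi p)"
  unfolding perc_measure_def by (intro prob_space_PiM measure_pmf.prob_space_axioms)

lemma measurable_perc_edge:
  "e \<in> Eset \<Longrightarrow> Measurable.pred (perc_measure xi p) (\<lambda>\<omega>. \<omega> e)"
  unfolding perc_measure_def
  using measurable_component_singleton[of e Eset "\<lambda>e. measure_pmf (bernoulli_pmf (p ^ (xi (fst (fst e)) + 1)))"]
  by (simp cong: measurable_cong_sets)

lemma indep_edges:
  "prob_space.indep_vars (perc_measure xi p) (\<lambda>_. count_space UNIV) (\<lambda>e \<omega>. \<omega> e) Eset"
proof -
  let ?M' = "\<lambda>e :: (int \<times> int) \<times> (int \<times> int). measure_pmf (bernoulli_pmf (p ^ (xi (fst (fst e)) + 1)))"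
  interpret prob_space "perc_measure xi p" by (rule prob_space_perc)
  have P: "perc_measure xi p = PiM Eset ?M'" by (simp add: perc_measure_def)
  have ne: "Eset \<noteq> {}" using edges_in_Eset(1)[of "(0, 0)"] by auto
  have rv: "(\<lambda>\<omega>. \<omega> e) \<in> perc_measure xi p \<rightarrow>\<^sub>M ?M' e" if "e \<in> Eset" for e
    unfolding P using that by (rule measurable_component_singleton)
  have "distr (perc_measure xi p) (PiM Eset ?M') (\<lambda>x. \<lambda>e\<in>Eset. x e) =
      distr (perc_measure xi p) (perc_measure xi p) (\<lambda>x. x)"
    unfolding P by (rule distr_cong) (auto simp: space_PiM)
  also have "\<dots> = PiM Eset ?M'" by (simp add: P distr_id2)
  also have "\<dots> = PiM Eset (\<lambda>e. distr (perc_measure xi p) (?M' e) (\<lambda>\<omega>. \<omega> e))"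
  proof (rule PiM_cong[OF refl])
    show "?M' e = distr (perc_measure xi p) (?M' e) (\<lambda>\<omega>. \<omega> e)" if "e \<in> Eset" for e
      unfolding P using that by (intro distr_PiM_component[symmetric] measure_pmf.prob_space_axioms)
  qed
  finally have "indep_vars ?M' (\<lambda>e \<omega>. \<omega> e) Eset"
    using indep_vars_iff_distr_eq_PiM'[OF ne rv] by simp
  then show ?thesis by (rule indep_vars_compose2[where Y = "\<lambda>_ x. x"]) simp
qed

lemma prob_edge:
  assumes "e \<in> Eset" "0 \<le> p" "p \<le> 1"
  shows "measure (perc_measure xi p) {\<omega> \<in> space (perc_measure xi p). \<omega> e} = p ^ (xi (fst (fst e)) + 1)"
proof -
  let ?M' = "\<lambda>e :: (int \<times> int) \<times> (int \<times> int). measure_pmf (bernoulli_pmf (p ^ (xi (fst (fst e)) + 1)))"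
  interpret P: product_prob_space ?M' Eset by unfold_locales
  have "emeasure (PiM Eset ?M') {\<omega> \<in> space (PiM Eset ?M'). \<omega> e \<in> {True}} = emeasure (?M' e) {True}"
    using assms(1) by (rule P.emeasure_PiM_Collect_single) simp
  also have "\<dots> = ennreal (p ^ (xi (fst (fst e)) + 1))"
    using assms by (simp add: emeasure_pmf_single power_le_one mult_le_one)
  finally show ?thesis using assms
    unfolding perc_measure_def by (simp add: measure_def)
qed

lemma indep_field_site_open:
  "prob_space.indep_field (perc_measure xi p) (\<lambda>x \<omega>. site_open N \<omega> x)"
proof -
  interpret prob_space "perc_measure xi p" by (rule prob_space_perc)
  let ?K = "site_edges N"
  have "indep_vars (\<lambda>j. PiM (?K j) (\<lambda>_. count_space UNIV)) (\<lambda>j \<omega>. restrict (\<lambda>e. \<omega> e) (?K j)) UNIV"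
    using site_edges_subset disjoint_site_edges
    by (intro indep_vars_restrict[OF indep_edges]) auto
  then have "indep_vars (\<lambda>_. count_space UNIV) (\<lambda>j \<omega>. site_open N (restrict (\<lambda>e. \<omega> e) (?K j)) j) UNIV"
  proof (rule indep_vars_compose2)
    fix j
    show "(\<lambda>f. site_open N f j) \<in> PiM (?K j) (\<lambda>_. count_space UNIV) \<rightarrow>\<^sub>M count_space UNIV"
      unfolding site_open_def using finite_site_edges[of N j] by measurable
  qed
  moreover have "site_open N (restrict (\<lambda>e. \<omega> e) (?K j)) j = site_open N \<omega> j" for j \<omega>
    by (simp add: site_open_def)
  ultimately show ?thesis by (simp add: indep_field_def)
qed

lemma prob_site_open:
  assumes p: "0 \<le> p" "p \<le> 1"
  shows "(p ^ (xi (int (N + i)) + 1))\<^sup>2 \<le>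
    measure (perc_measure xi p) {\<omega> \<in> space (perc_measure xi p). site_open N \<omega> (i, j)}"
proof -
  interpret prob_space "perc_measure xi p" by (rule prob_space_perc)
  let ?v = "vmap N (i, j)" and ?M = "perc_measure xi p"
  show ?thesis
  proof (cases "even (int i + j)")
    case True
    let ?J = "{up_edge ?v, down_edge ?v}"
    have J: "?J \<subseteq> Eset" using edges_in_Eset[of ?v] even_vmap[of N "(i, j)"] True by simp
    have ne: "up_edge ?v \<noteq> down_edge ?v" by (simp add: up_edge_def down_edge_def)
    have "prob (\<Inter>e\<in>?J. (\<lambda>\<omega>. \<omega> e) -` {True} \<inter> space ?M) =
        (\<Prod>e\<in>?J. prob ((\<lambda>\<omega>. \<omega> e) -` {True} \<inter> space ?M))"
      using J by (intro indep_varsD[OF indep_edges]) auto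
    also have "\<dots> = (\<Prod>e\<in>?J. p ^ (xi (int (N + i)) + 1))"
    proof (rule prod.cong[OF refl])
      fix e assume e: "e \<in> ?J"
      have "prob ((\<lambda>\<omega>. \<omega> e) -` {True} \<inter> space ?M) = prob {\<omega> \<in> space ?M. \<omega> e}"
        by (rule arg_cong[where f = prob]) auto
      also have "\<dots> = p ^ (xi (fst (fst e)) + 1)" using e J by (intro prob_edge p) auto
      also have "fst (fst e) = int (N + i)" using e by (auto simp: up_edge_def down_edge_def vmap_def)
      finally show "prob ((\<lambda>\<omega>. \<omega> e) -` {True} \<inter> space ?M) = p ^ (xi (int (N + i)) + 1)" .
    qed
    also have "\<dots> = (p ^ (xi (int (N + i)) + 1))\<^sup>2" using ne by (simp add: power2_eq_square)
    also have "(\<Inter>e\<in>?J. (\<lambda>\<omega>. \<omega> e) -` {True} \<inter> space ?M) = {\<omega> \<in> space ?M. site_open N \<omega> (i, j)}"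
      using True by (auto simp: site_open_def site_edges_def)
    finally show ?thesis by simp
  next
    case False
    then have "{\<omega> \<in> space ?M. site_open N \<omega> (i, j)} = space ?M"
      by (simp add: site_open_def site_edges_def)
    moreover have "(p ^ (xi (int (N + i)) + 1))\<^sup>2 \<le> 1" using p by (intro power_le_one) auto
    ultimately show ?thesis by (simp add: prob_space)
  qed
qed

text \<open>Reachability is a countable union over path lengths, and a set of vertices is infinite
  if and only if its codes under \<open>to_nat\<close> are unbounded; so only countable operations
  occur.\<close>

lemma connected_measurable:
  "{\<omega> \<in> space (perc_measure xi p). connected_to_infinity \<omega>} \<in> sets (perc_measure xi p)"
proof -
  let ?M = "perc_measure xi p"
  have st: "Measurable.pred ?M (\<lambda>\<omega>. open_step \<omega> y z)" for y z
    unfolding open_step_def using measurable_perc_edge[of "(y, z)" xi p]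
    by (cases "(y, z) \<in> Eset") auto
  have pw: "Measurable.pred ?M (\<lambda>\<omega>. (open_step \<omega> ^^ n) x z)" for n x z
  proof (induction n arbitrary: z)
    case (Suc n)
    have "(open_step \<omega> ^^ Suc n) x z \<longleftrightarrow> (\<exists>y. (open_step \<omega> ^^ n) x y \<and> open_step \<omega> y z)" for \<omega>
      by auto
    then show ?case using Suc st by simp
  qed simp
  have inf: "infinite A \<longleftrightarrow> (\<forall>n. \<exists>v. v \<in> A \<and> n < to_nat v)" for A :: "(int \<times> int) set"
  proof -
    have "infinite A \<longleftrightarrow> infinite (to_nat ` A)" by (simp add: finite_image_iff)
    also have "\<dots> \<longleftrightarrow> (\<forall>n. \<exists>m>n. m \<in> to_nat ` A)" by (rule infinite_nat_iff_unbounded)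
    also have "\<dots> \<longleftrightarrow> (\<forall>n. \<exists>v. v \<in> A \<and> n < to_nat v)" by blast
    finally show ?thesis .
  qed
  have "connected_to_infinity \<omega> \<longleftrightarrow>
      (\<forall>n. \<exists>v. (\<exists>k. (open_step \<omega> ^^ k) (0, 0) v) \<and> n < to_nat v)" for \<omega>
    unfolding connected_to_infinity_def inf by (simp add: rtranclp_power)
  moreover have "Measurable.pred ?M (\<lambda>\<omega>. \<forall>n. \<exists>v. (\<exists>k. (open_step \<omega> ^^ k) (0, 0) v) \<and> n < to_nat v)"
    using pw by measurable
  ultimately show ?thesis by (simp add: pred_def)
qed

section \<open>Joining the origin to the column where the good environment starts\<close>

definition diag :: "nat \<Rightarrow> ((int \<times> int) \<times> (int \<times> int)) set" where
  "diag N = (\<lambda>k. up_edge (int k, int k)) ` {..<N}"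

lemma diag_subset: "diag N \<subseteq> {e \<in> Eset. fst (fst e) < int N}"
  using edges_in_Eset(1) by (auto simp: diag_def up_edge_def)

lemma diag_reaches:
  assumes "\<forall>e\<in>diag N. \<omega> e"
  shows "(open_step \<omega>)\<^sup>*\<^sup>* (0, 0) (int N, int N)"
  using assms
proof (induction N)
  case (Suc N)
  have "up_edge (int N, int N) \<in> diag (Suc N)" by (auto simp: diag_def)
  then have "\<omega> (up_edge (int N, int N))" "up_edge (int N, int N) \<in> Eset"
    using Suc.prems edges_in_Eset(1)[of "(int N, int N)"] by auto
  then have "open_step \<omega> (int N, int N) (int (Suc N), int (Suc N))"
    by (simp add: open_step_def up_edge_def add.commute)
  moreover have "(open_step \<omega>)\<^sup>*\<^sup>* (0, 0) (int N, int N)"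
    using Suc by (auto simp: diag_def)
  ultimately show ?case by (rule rtranclp.rtrancl_into_rtrancl[rotated])
qed simp

text \<open>The diagonal from the origin to \<open>(N, N)\<close> is open with positive probability,
  independently of the field beyond column \<open>N\<close>. The bound \<open>1 - 2 * B\<close> is
  uniform in \<open>n\<close> and therefore survives the limit of decreasing events.\<close>

lemma prob_connected_pos:
  assumes p: "0 < p" "p \<le> 1" and t: "t \<in> good_env" and B: "0 < B" "B \<le> 1 / 10 ^ 12"
    and g: "\<And>i. 1 / (1 + B * 2 ^ t i) \<le> (p ^ (xi (int (N + i)) + 1))\<^sup>2"
  shows "0 < measure (perc_measure xi p) {\<omega> \<in> space (perc_measure xi p). connected_to_infinity \<omega>}"
proof -
  interpret prob_space "perc_measure xi p" by (rule prob_space_perc)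
  let ?M = "perc_measure xi p"
  let ?R = "\<lambda>n \<omega>. \<exists>w. open_path (site_open N \<omega>) 0 0 n w"
  let ?I = "\<lambda>\<omega> :: ((int \<times> int) \<times> (int \<times> int)) \<Rightarrow> bool. \<forall>e\<in>diag N. \<omega> e"
  \<comment> \<open>Edges are sorted by the column where they start: those of \<open>diag N\<close>
    start before column \<open>N\<close>, those of the field at \<open>N\<close> or later.\<close>
  let ?F = "{e \<in> Eset. int N \<le> fst (fst e)}"
  let ?P = "\<lambda>A :: ((int \<times> int) \<times> (int \<times> int)) set. PiM A (\<lambda>_. count_space (UNIV :: bool set))"
  have finD: "finite (diag N)" by (simp add: diag_def)
  have DE: "diag N \<subseteq> Eset" using diag_subset by blast
  have R: "1 - 2 * B \<le> prob {\<omega> \<in> space ?M. ?R n \<omega>}" for n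
  proof (rule prob_path_ge[OF indep_field_site_open B])
    show "ladder (\<lambda>k. (envmap ^^ k) t) (\<lambda>k. block_start (seq_drop 50 ((envmap ^^ k) t)))"
      using t by (rule ladder_good_env)
    show "1 / (1 + B * 2 ^ (envmap ^^ 0) t i) \<le> prob {\<omega> \<in> space ?M. site_open N \<omega> (i, j)}" for i j
      using g[of i] prob_site_open[of p xi N i j] p by simp
  qed
  have I: "0 < prob {\<omega> \<in> space ?M. ?I \<omega>}"
  proof (cases "diag N = {}")
    case True then show ?thesis by (simp add: prob_space)
  next
    case False
    have "prob (\<Inter>e\<in>diag N. (\<lambda>\<omega>. \<omega> e) -` {True} \<inter> space ?M) =
        (\<Prod>e\<in>diag N. prob ((\<lambda>\<omega>. \<omega> e) -` {True} \<inter> space ?M))"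
      using DE False finD by (intro indep_varsD[OF indep_edges]) auto
    also have "\<dots> > 0"
    proof (rule prod_pos)
      fix e assume "e \<in> diag N"
      then have "prob {\<omega> \<in> space ?M. \<omega> e} = p ^ (xi (fst (fst e)) + 1)"
        using DE p by (intro prob_edge) auto
      moreover have "(\<lambda>\<omega>. \<omega> e) -` {True} \<inter> space ?M = {\<omega> \<in> space ?M. \<omega> e}" by auto
      ultimately show "0 < prob ((\<lambda>\<omega>. \<omega> e) -` {True} \<inter> space ?M)" using p by simp
    qed
    also have "(\<Inter>e\<in>diag N. (\<lambda>\<omega>. \<omega> e) -` {True} \<inter> space ?M) = {\<omega> \<in> space ?M. ?I \<omega>}"
      using False by auto
    finally show ?thesis .
  qed
  have so: "Measurable.pred (?P ?F) (\<lambda>f. site_open N f x)" for x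
  proof -
    have "Measurable.pred (?P ?F) (\<lambda>f. f e)" if "e \<in> site_edges N x" for e
      using subsetD[OF site_edges_subset that] by (rule measurable_component_singleton)
    then show ?thesis unfolding site_open_def using finite_site_edges[of N x] by measurable
  qed
  have mR: "{f \<in> space (?P ?F). ?R n f} \<in> sets (?P ?F)" for n
  proof -
    have "Measurable.pred (?P ?F) (\<lambda>f. open_path (\<lambda>x. site_open N f x) 0 0 n w)" for w
      by (rule pred_path[OF so])
    then show ?thesis by measurable
  qed
  have mI: "{f \<in> space (?P (diag N)). ?I f} \<in> sets (?P (diag N))"
    using finD by measurable
  have ind: "prob {\<omega> \<in> space ?M. ?I \<omega> \<and> ?R n \<omega>} = prob {\<omega> \<in> space ?M. ?I \<omega>} * prob {\<omega> \<in> space ?M. ?R n \<omega>}" for n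
  proof -
    have "indep_var (?P (diag N)) (\<lambda>\<omega>. restrict (\<lambda>e. \<omega> e) (diag N)) (?P ?F) (\<lambda>\<omega>. restrict (\<lambda>e. \<omega> e) ?F)"
      using diag_subset by (intro indep_var_restrict[OF indep_edges]) fastforce+
    from indep_varD[OF this mI mR[of n]] have
      "prob ((\<lambda>\<omega>. (restrict \<omega> (diag N), restrict \<omega> ?F)) -`
          ({f \<in> space (?P (diag N)). ?I f} \<times> {f \<in> space (?P ?F). ?R n f}) \<inter> space ?M) =
       prob ((\<lambda>\<omega>. restrict \<omega> (diag N)) -` {f \<in> space (?P (diag N)). ?I f} \<inter> space ?M) *
       prob ((\<lambda>\<omega>. restrict \<omega> ?F) -` {f \<in> space (?P ?F). ?R n f} \<inter> space ?M)" by simp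
    moreover have "site_open N (restrict \<omega> ?F) = site_open N \<omega>" for \<omega>
      using site_edges_subset[of N] by (fastforce simp: site_open_def fun_eq_iff)
    moreover have "?I (restrict \<omega> (diag N)) = ?I \<omega>" for \<omega> by simp
    moreover have "restrict \<omega> A \<in> space (?P A)" for \<omega> A by (simp add: space_PiM)
    ultimately show ?thesis by (simp add: vimage_def Int_def conj_commute)
  qed
  have mso: "Measurable.pred ?M (\<lambda>\<omega>. site_open N \<omega> x)" for x
    by (rule indep_field_measurable[OF indep_field_site_open])
  have E: "{\<omega> \<in> space ?M. ?I \<omega> \<and> ?R n \<omega>} \<in> events" for n
  proof -
    have [measurable]: "Measurable.pred ?M (\<lambda>\<omega>. open_path (\<lambda>x. site_open N \<omega> x) 0 0 n w)" for w
      by (rule pred_path[OF mso])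
    have "Measurable.pred ?M (\<lambda>\<omega>. \<omega> e)" if "e \<in> diag N" for e
      using that DE by (intro measurable_perc_edge) auto
    then have [measurable]: "Measurable.pred ?M ?I" using finD by measurable
    show ?thesis by measurable
  qed
  let ?E = "\<lambda>n. {\<omega> \<in> space ?M. ?I \<omega> \<and> ?R n \<omega>}"
  have dec: "decseq ?E"
  proof (rule decseq_SucI)
    show "?E (Suc n) \<subseteq> ?E n" for n
      using open_path_prefix[of _ 0 0 "Suc n" _ n] by auto
  qed
  have "(\<lambda>n. prob (?E n)) \<longlonglongrightarrow> prob (\<Inter>n. ?E n)"
    using E by (intro finite_Lim_measure_decseq dec) auto
  moreover have "prob {\<omega> \<in> space ?M. ?I \<omega>} * (1 - 2 * B) \<le> prob (?E n)" for n
    unfolding ind using R[of n] by (intro mult_left_mono) auto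
  ultimately have "prob {\<omega> \<in> space ?M. ?I \<omega>} * (1 - 2 * B) \<le> prob (\<Inter>n. ?E n)"
    by (intro LIMSEQ_le_const) auto
  also have "\<dots> \<le> prob {\<omega> \<in> space ?M. connected_to_infinity \<omega>}"
  proof (rule finite_measure_mono[OF _ connected_measurable])
    show "(\<Inter>n. ?E n) \<subseteq> {\<omega> \<in> space ?M. connected_to_infinity \<omega>}"
    proof
      fix \<omega> assume w: "\<omega> \<in> (\<Inter>n. ?E n)"
      then have sp: "\<omega> \<in> space ?M" and i: "?I \<omega>" and r: "?R n \<omega>" for n by auto
      let ?A = "{v. (open_step \<omega>)\<^sup>*\<^sup>* (0, 0) v}"
      have "\<exists>v\<in>?A. fst v = int (N + n)" for n
      proof -
        obtain w where "open_path (site_open N \<omega>) 0 0 n w" using r by blast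
        then have "(open_step \<omega>)\<^sup>*\<^sup>* (int N, int N) (vmap N (n, w))"
          using open_path_reaches by (fastforce simp: vmap_def)
        then show ?thesis
          using diag_reaches[OF i] by (intro bexI[of _ "vmap N (n, w)"]) (auto simp: vmap_def)
      qed
      then have "range (\<lambda>n. int (N + n)) \<subseteq> fst ` ?A" by force
      moreover have "infinite (range (\<lambda>n. int (N + n)))"
        by (rule range_inj_infinite) (auto simp: inj_on_def)
      ultimately have "infinite (fst ` ?A)" using infinite_super by blast
      then have "infinite ?A" by (metis finite_imageI)
      then show "\<omega> \<in> {\<omega> \<in> space ?M. connected_to_infinity \<omega>}"
        using sp by (simp add: connected_to_infinity_def)
    qed
  qed
  finally have "prob {\<omega> \<in> space ?M. ?I \<omega>} * (1 - 2 * B) \<le> prob {\<omega> \<in> space ?M. connected_to_infinity \<omega>}" .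
  moreover have "0 < prob {\<omega> \<in> space ?M. ?I \<omega>} * (1 - 2 * B)"
    using I B by (intro mult_pos_pos) auto
  ultimately show ?thesis by linarith
qed


section \<open>Numerical conditions on the two parameters\<close>

lemma two_powers_le_one: "a \<le> b \<Longrightarrow> (2::real) ^ a * (1 / 2) ^ b \<le> 1"
  by (simp add: power_one_over divide_le_eq power_increasing)

text \<open>This accounts for the exponent 1000: as \<open>10 ^ 96 \<ge> 2 ^ 300\<close>, the tail
  \<open>\<rho> ^ 1000\<close> is at most \<open>(1 / 2) ^ 300000\<close>, against
  \<open>2 ^ (31 + 22 * 12300)\<close> from the penalty and the remaining constants.\<close>

lemma scaled_tail_small:
  fixes \<rho> :: real
  assumes "0 \<le> \<rho>" "\<rho> \<le> 1 / 10 ^ 96"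
  shows "2048 * \<rho> ^ 1000 \<le> 1 / 2"
    and "32 * (100 * 2048 ^ pen)\<^sup>2 * (2 * (2048 * \<rho> ^ 1000)) \<le> 1"
proof -
  define b :: nat where "b = 300 * 1000"
  have "\<rho> \<le> (1 / 2) ^ 300" using assms(2) by (rule order_trans) (simp add: power_one_over)
  then have "\<rho> ^ 1000 \<le> ((1 / 2) ^ 300) ^ 1000" using assms(1) by (rule power_mono)
  also have "((1 / 2) ^ 300 :: real) ^ 1000 = (1 / 2) ^ b" unfolding b_def by (rule power_mult[symmetric])
  finally have q: "\<rho> ^ 1000 \<le> (1 / 2) ^ b" .
  have "(2::real) ^ 12 * \<rho> ^ 1000 \<le> 2 ^ 12 * (1 / 2) ^ b" using q by (intro mult_left_mono) auto
  also have "\<dots> \<le> 1" by (rule two_powers_le_one) (simp add: b_def)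
  finally show "2048 * \<rho> ^ 1000 \<le> 1 / 2" by simp
  have e: "31 + 22 * pen \<le> b" by (simp add: b_def pen_def)
  have "(100 * 2048 ^ pen)\<^sup>2 \<le> (2 ^ 7 * 2048 ^ pen :: real)\<^sup>2"
    by (intro power_mono mult_right_mono) auto
  also have "\<dots> = 2 ^ 14 * 2 ^ (22 * pen)"
  proof -
    have "(2048::real) ^ pen = 2 ^ (11 * pen)" by (simp add: power_mult)
    moreover have "(2 ^ (11 * pen) :: real)\<^sup>2 = 2 ^ (22 * pen)"
      by (simp add: power_mult[symmetric] mult.commute)
    ultimately show ?thesis by (simp add: power_mult_distrib)
  qed
  finally have K: "(100 * 2048 ^ pen)\<^sup>2 \<le> (2 ^ 14 * 2 ^ (22 * pen) :: real)" .
  have "32 * (100 * 2048 ^ pen)\<^sup>2 * (2 * (2048 * \<rho> ^ 1000)) \<le>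
      32 * (2 ^ 14 * 2 ^ (22 * pen)) * (2 * (2048 * (1 / 2) ^ b))"
    using K q assms(1) by (intro mult_mono) auto
  also have "\<dots> = 2 ^ (31 + 22 * pen) * (1 / 2) ^ b" by (simp add: power_add)
  also have "\<dots> \<le> 1" using e by (rule two_powers_le_one)
  finally show "32 * (100 * 2048 ^ pen)\<^sup>2 * (2 * (2048 * \<rho> ^ 1000)) \<le> 1" .
qed

text \<open>With \<open>m = x div 1000\<close> one has \<open>x + 1 \<le> 1000 * (m + 1)\<close>, so
  each unit of scaled badness costs a factor \<open>p ^ 2000\<close>. \<open>\<eta>\<close> is half
  of \<open>1 / 10 ^ 12\<close> because
  \<open>(1 + \<eta>) ^ (m + 1) \<le> 1 + \<eta> * 2 ^ (m + 1)\<close>.\<close>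

lemma open_prob_lower_bound:
  fixes p :: real
  assumes p: "1 - 1 / 10 ^ 60 \<le> p" "p \<le> 1"
  shows "1 / (1 + 1 / 10 ^ 12 * 2 ^ (x div 1000)) \<le> (p ^ (x + 1))\<^sup>2"
proof -
  define \<eta> :: real where "\<eta> = 1 / (2 * 10 ^ 12)"
  define m where "m = x div 1000"
  have \<eta>: "0 < \<eta>" "\<eta> \<le> 1" by (simp_all add: \<eta>_def)
  have p0: "0 < p" using p(1) by (rule less_le_trans[rotated]) simp
  have "1 / (1 + \<eta>) \<le> 1 + real 2000 * (- 1 / 10 ^ 60)" by (simp add: \<eta>_def)
  also have "\<dots> \<le> (1 + (- 1 / 10 ^ 60)) ^ 2000" by (rule Bernoulli_inequality) simp
  also have "\<dots> \<le> p ^ 2000" using p by (intro power_mono) auto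
  finally have r: "1 / (1 + \<eta>) \<le> p ^ 2000" .
  have "(1 + \<eta>) ^ (m + 1) = (\<Prod>i<m + 1. 1 + \<eta> * 1)" by simp
  also have "\<dots> \<le> 1 + \<eta> * ((\<Prod>i<m + 1. 1 + 1) - 1)" using \<eta> by (intro prod_one_plus_le) auto
  also have "\<dots> \<le> 1 + 1 / 10 ^ 12 * 2 ^ m" by (simp add: \<eta>_def)
  finally have le: "(1 + \<eta>) ^ (m + 1) \<le> 1 + 1 / 10 ^ 12 * 2 ^ m" .
  have "1 / (1 + 1 / 10 ^ 12 * 2 ^ m) \<le> 1 / (1 + \<eta>) ^ (m + 1)"
    using le \<eta> by (intro divide_left_mono) (auto intro!: mult_pos_pos add_pos_nonneg)
  also have "\<dots> = (1 / (1 + \<eta>)) ^ (m + 1)" by (simp add: power_one_over)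
  also have "\<dots> \<le> (p ^ 2000) ^ (m + 1)" using r \<eta> by (intro power_mono) auto
  also have "\<dots> = p ^ (2000 * (m + 1))" by (rule power_mult[symmetric])
  also have "\<dots> \<le> p ^ ((x + 1) * 2)"
    using p p0 unfolding m_def by (intro power_decreasing) auto
  also have "\<dots> = (p ^ (x + 1))\<^sup>2" by (rule power_mult)
  finally show ?thesis by (simp add: m_def)
qed

text \<open>Oriented paths from the origin never visit a negative column, so only the columns with
  index at least 0 are kept.\<close>

lemma (in prob_space) indep_vars_nonneg_indices:
  assumes "indep_vars (\<lambda>_. count_space UNIV) \<xi> (UNIV :: int set)"
  shows "indep_vars (\<lambda>_. count_space UNIV) (\<lambda>i \<omega>. h (\<xi> (int i) \<omega>)) UNIV"
proof -
  have "indep_vars (\<lambda>i. PiM {int i} (\<lambda>_. count_space UNIV)) (\<lambda>i \<omega>. restrict (\<lambda>j. \<xi> j \<omega>) {int i}) UNIV"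
    by (intro indep_vars_restrict[OF assms]) (auto simp: disjoint_family_on_def)
  then have "indep_vars (\<lambda>_. count_space UNIV) (\<lambda>i \<omega>. h (restrict (\<lambda>j. \<xi> j \<omega>) {int i} (int i))) UNIV"
  proof (rule indep_vars_compose2)
    fix i :: nat
    show "(\<lambda>f. h (f (int i))) \<in> PiM {int i} (\<lambda>_. count_space UNIV) \<rightarrow>\<^sub>M count_space UNIV"
      by (rule measurable_compose[OF measurable_component_singleton]) auto
  qed
  then show ?thesis by simp
qed

text \<open>Point masses are differences of consecutive tails. The given tail formula thus yields
  identical distribution.\<close>

lemma (in prob_space) distr_eq_of_tails:
  fixes X Y :: "'a \<Rightarrow> nat"
  assumes X: "X \<in> M \<rightarrow>\<^sub>M count_space UNIV" and Y: "Y \<in> M \<rightarrow>\<^sub>M count_space UNIV"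
    and eq: "\<And>n. prob {\<omega> \<in> space M. n \<le> X \<omega>} = prob {\<omega> \<in> space M. n \<le> Y \<omega>}"
  shows "distr M (count_space UNIV) X = distr M (count_space UNIV) Y"
proof (rule measure_eqI_countable)
  fix n :: nat
  have pt: "emeasure (distr M (count_space UNIV) Z) {n} =
      ennreal (prob {\<omega> \<in> space M. n \<le> Z \<omega>} - prob {\<omega> \<in> space M. Suc n \<le> Z \<omega>})"
    if Z: "Z \<in> M \<rightarrow>\<^sub>M count_space UNIV" for Z :: "'a \<Rightarrow> nat"
  proof -
    have m: "{\<omega> \<in> space M. k \<le> Z \<omega>} \<in> events" for k
      using measurable_sets[OF Z, of "{k..}"] by (simp add: vimage_def Int_def conj_commute)
    have "emeasure (distr M (count_space UNIV) Z) {n} = emeasure M (Z -` {n} \<inter> space M)"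
      using Z by (intro emeasure_distr) auto
    also have "Z -` {n} \<inter> space M = {\<omega> \<in> space M. n \<le> Z \<omega>} - {\<omega> \<in> space M. Suc n \<le> Z \<omega>}"
      (is "_ = ?D") by auto
    also have "emeasure M ?D = ennreal (prob ?D)" by (rule emeasure_eq_measure)
    also have "prob ?D = prob {\<omega> \<in> space M. n \<le> Z \<omega>} - prob {\<omega> \<in> space M. Suc n \<le> Z \<omega>}"
      using m by (intro finite_measure_Diff) auto
    finally show ?thesis .
  qed
  show "emeasure (distr M (count_space UNIV) X) {n} = emeasure (distr M (count_space UNIV) Y) {n}"
    unfolding pt[OF X] pt[OF Y] eq ..
qed (auto intro: countableI_type)

theorem theorem8p2:
  fixes M :: "'a measure" and \<xi> :: "int \<Rightarrow> 'a \<Rightarrow> nat" and \<rho> p L :: real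
  assumes "prob_space M"
    and "prob_space.indep_vars M (\<lambda>_. count_space UNIV) \<xi> UNIV"
    and "\<And>i n. measure M {\<omega> \<in> space M. \<xi> i \<omega> \<ge> n} = \<rho> ^ n"
    and "0 \<le> \<rho>" and "\<rho> \<le> 1" and "0 \<le> p" and "p \<le> 1"
    and "L = 10 ^ 6"
    and "\<rho> \<le> L powr (-16)"
    and "p \<ge> (1 - L powr (-10)) powr (1/4)"
  shows "AE \<omega> in M.
           measure (perc_measure (\<lambda>i. \<xi> i \<omega>) p)
             {\<eta> \<in> space (perc_measure (\<lambda>i. \<xi> i \<omega>) p). connected_to_infinity \<eta>} > 0"
proof -
  interpret prob_space M by fact
  have L0: "0 < L" using assms(8) by simp
  have "L powr (-16) = inverse (L ^ 16)" using L0 by (simp only: powr_minus powr_numeral)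
  also have "\<dots> = 1 / 10 ^ 96" by (simp add: assms(8) inverse_eq_divide)
  finally have "L powr (-16) = 1 / 10 ^ 96" .
  then have \<rho>: "\<rho> \<le> 1 / 10 ^ 96" using assms(9) by simp
  have "L powr (-10) = inverse (L ^ 10)" using L0 by (simp only: powr_minus powr_numeral)
  also have "\<dots> = 1 / 10 ^ 60" by (simp add: assms(8) inverse_eq_divide)
  finally have L10: "L powr (-10) = 1 / 10 ^ 60" .
  \<comment> \<open>For a base in the unit interval a smaller exponent gives a larger power, so the
    fourth root may be replaced by its base.\<close>
  have "1 - 1 / 10 ^ 60 = (1 - 1 / 10 ^ 60 :: real) powr 1" by simp
  also have "\<dots> \<le> (1 - 1 / 10 ^ 60) powr (1 / 4)" by (rule powr_mono') auto
  also have "\<dots> \<le> p" using assms(10) unfolding L10 .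
  finally have p: "1 - 1 / 10 ^ 60 \<le> p" .
  have p0: "0 < p" using p by (rule less_le_trans[rotated]) simp
  \<comment> \<open>Taking the integer part keeps the tails geometric, with
    \<open>\<rho> ^ 1000\<close> in place of \<open>\<rho>\<close>.\<close>
  define X where "X i \<omega> = \<xi> (int i) \<omega> div 1000" for i \<omega>
  have ind: "indep_vars (\<lambda>_. count_space UNIV) X UNIV"
    unfolding X_def[abs_def] by (rule indep_vars_nonneg_indices[OF assms(2)])
  have rv: "X i \<in> M \<rightarrow>\<^sub>M count_space UNIV" for i
    using ind unfolding indep_vars_def by blast
  have tail: "prob {\<omega> \<in> space M. n \<le> X i \<omega>} = (\<rho> ^ 1000) ^ n" for i n
  proof -
    have "(n \<le> X i \<omega>) = (n * 1000 \<le> \<xi> (int i) \<omega>)" for \<omega>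
      by (simp only: X_def less_eq_div_iff_mult_less_eq zero_less_numeral)
    moreover have "(\<rho> ^ 1000) ^ n = \<rho> ^ (n * 1000)" by (simp only: power_mult[symmetric] mult.commute)
    ultimately show ?thesis by (simp only: assms(3))
  qed
  define N where "N = distr M (count_space UNIV) (X 0)"
  have law: "distr M (count_space UNIV) (X i) = N" for i
    unfolding N_def by (rule distr_eq_of_tails[OF rv rv]) (simp only: tail)
  have N: "nat_iid N" unfolding N_def by (rule nat_iid.intro) (simp_all add: prob_space_distr rv)
  have "emeasure N {n..} \<le> ennreal ((\<rho> ^ 1000) ^ n)" for n
  proof -
    have "emeasure N {n..} = emeasure M {\<omega> \<in> space M. n \<le> X 0 \<omega>}"
      unfolding N_def using emeasure_distr[OF rv[of 0], of "{n..}"]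
      by (simp add: vimage_def Int_def conj_commute)
    then show ?thesis by (simp only: emeasure_eq_measure tail order_refl)
  qed
  then have phi: "nat_iid.phi N \<le> ennreal (2 * (2048 * \<rho> ^ 1000))"
    using assms(4) scaled_tail_small(1)[OF assms(4) \<rho>] by (intro phi_le_tails[OF N]) (auto simp del: power_mult)
  have "0 < emeasure (PiM UNIV (\<lambda>_. N)) good_env"
    by (rule emeasure_good_env_pos[OF N phi _ refl scaled_tail_small(2)[OF assms(4) \<rho>]])
      (use assms(4) in simp)
  from AE_ex_shift[OF ind law sets_good_env this]
  show ?thesis
  proof (rule eventually_mono)
    fix \<omega> assume "\<exists>n. seq_drop n (\<lambda>i. X i \<omega>) \<in> good_env"
    then obtain n where n: "seq_drop n (\<lambda>i. X i \<omega>) \<in> good_env" by blast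
    show "0 < measure (perc_measure (\<lambda>i. \<xi> i \<omega>) p)
        {\<eta> \<in> space (perc_measure (\<lambda>i. \<xi> i \<omega>) p). connected_to_infinity \<eta>}"
    proof (rule prob_connected_pos[OF p0 assms(7) n, where B = "1 / 10 ^ 12" and N = n])
      show "1 / (1 + 1 / 10 ^ 12 * 2 ^ seq_drop n (\<lambda>i. X i \<omega>) i) \<le> (p ^ (\<xi> (int (n + i)) \<omega> + 1))\<^sup>2" for i
        unfolding seq_drop_apply X_def by (rule open_prob_lower_bound[OF p assms(7)])
    qed simp_all
  qed
qed

end
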